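(* Let $(X,\omega)$ be a symplectic $4$-manifold, and suppose that $S_0,S_1,\dots,S_l\subset X$ are symplectic surfaces, all of them passing through the same point $p\in X$ and intersecting (pairwise) transversely and positively at $p$. Then the surfaces $S_j$, $1\le j\le l$, can be deformed to surfaces $\tilde S_j$ such that: (1) the perturbed surfaces $\tilde S_j$ are symplectic for $1\le j\le l$; (2) the deformation of the surfaces $S_j$ is $C^0$-small and only occurs in a small chart around $p$, and the surfaces $S_0$ and $\tilde S_j$, $1\le j\le l$, only intersect (pairwise) at $p$ in the given chart; (3) near the point $p$ there are Darboux coordinates $(z,w)\in\mathbb{C}^2$ (centered at $p$) for which $S_0=\{z=0\}$ and $\tilde S_j=\{w=a_jz\}$ for $1\le j\le l$, where $a_1,\dots,a_l\in\mathbb{C}^*$ are distinct complex numbers.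
   Context: $X$ is not assumed compact. A symplectic surface $S\subset X$ is a smooth embedded real surface with $\omega|_S$ nondegenerate; it is always oriented by $\omega|_S$. Symplectic surfaces $S_i,S_j$ ($i\ne j$) intersect transversely and positively at $p\in S_i\cap S_j$ if $T_pS_i\oplus T_pS_j=T_pX$ and the orientation of $T_pX$ (given by $\omega^2$) is the one given by $\mathcal{B}_i\cup\mathcal{B}_j$, with $\mathcal{B}_i,\mathcal{B}_j$ positive bases of $T_pS_i,T_pS_j$. Darboux coordinates $(z,w)$ are coordinates in which $\omega=\frac{\mathrm{i}}{2}(dz\wedge d\bar z+dw\wedge d\bar w)$. A $C^0$-small deformation occurring in a small chart around $p$ means: the deformed surfaces agree with the original ones outside a neighbourhood of $p$, which may be taken as small as desired, and they are $C^0$-close to the original ones. *)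

theory Defs
  imports "HOL-Analysis.Analysis"
begin

section \<open>Smooth maps between open subsets of normed spaces\<close>

text \<open>
  On an open set, f is C^(k+1) iff it is differentiable and all its directional derivatives are C^k.
\<close>

primrec ck_on :: "nat \<Rightarrow> 'a::real_normed_vector set \<Rightarrow> ('a \<Rightarrow> 'b::real_normed_vector) \<Rightarrow> bool" where
  "ck_on 0 S f \<longleftrightarrow> continuous_on S f"
| "ck_on (Suc k) S f \<longleftrightarrow>
     (\<forall>x\<in>S. f differentiable (at x)) \<and> (\<forall>v. ck_on k S (\<lambda>x. frechet_derivative f (at x) v))"

definition smooth_on :: "'a::real_normed_vector set \<Rightarrow> ('a \<Rightarrow> 'b::real_normed_vector) \<Rightarrow> bool" where
  "smooth_on S f \<longleftrightarrow> (\<forall>k. ck_on k S f)"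


section \<open>Smooth 4-manifolds\<close>

text \<open>
  The manifold is the whole type \<open>'a\<close>, which will be Hausdorff and second countable.
  Charts take values in \<open>complex \<times> complex\<close>, regarded as the real vector space R^4; smoothness is
  real smoothness throughout. The values of the coordinate map outside the domain are irrelevant.
\<close>

type_synonym 'a chart = "'a set \<times> ('a \<Rightarrow> complex \<times> complex)"

abbreviation chart_dom :: "'a chart \<Rightarrow> 'a set" where
  "chart_dom c \<equiv> fst c"

abbreviation coord :: "'a chart \<Rightarrow> 'a \<Rightarrow> complex \<times> complex" where
  "coord c \<equiv> snd c"

definition chart_inv :: "'a chart \<Rightarrow> complex \<times> complex \<Rightarrow> 'a" where
  "chart_inv c = inv_into (chart_dom c) (coord c)"

definition is_chart :: "('a::topological_space) chart \<Rightarrow> bool" where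
  "is_chart c \<longleftrightarrow> open (chart_dom c) \<and> open (coord c ` chart_dom c) \<and>
     homeomorphism (chart_dom c) (coord c ` chart_dom c) (coord c) (chart_inv c)"

definition transition :: "'a chart \<Rightarrow> 'a chart \<Rightarrow> complex \<times> complex \<Rightarrow> complex \<times> complex" where
  "transition c c' = coord c' \<circ> chart_inv c"

definition compatible :: "'a chart \<Rightarrow> 'a chart \<Rightarrow> bool" where
  "compatible c c' \<longleftrightarrow>
     smooth_on (coord c ` (chart_dom c \<inter> chart_dom c')) (transition c c') \<and>
     smooth_on (coord c' ` (chart_dom c \<inter> chart_dom c')) (transition c' c)"

definition smooth_structure :: "('a::topological_space) chart set \<Rightarrow> bool" where
  "smooth_structure A \<longleftrightarrow>
     (\<forall>c\<in>A. is_chart c) \<and> (\<Union>c\<in>A. chart_dom c) = UNIV \<and>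
     (\<forall>c\<in>A. \<forall>c'\<in>A. compatible c c') \<and>
     (\<forall>c. is_chart c \<and> (\<forall>c'\<in>A. compatible c c') \<longrightarrow> c \<in> A)"


section \<open>Symplectic forms\<close>

text \<open>
  A 2-form is given by its coordinate expressions: \<open>\<omega> c q u v\<close> is the value at the point \<open>q\<close> on the
  tangent vectors whose coordinates in the chart \<open>c\<close> are \<open>u\<close> and \<open>v\<close>. The last clause of
  \<open>two_form\<close> is the transformation law of a covariant 2-tensor.
\<close>

type_synonym 'a form2 =
  "'a chart \<Rightarrow> 'a \<Rightarrow> complex \<times> complex \<Rightarrow> complex \<times> complex \<Rightarrow> real"

definition two_form :: "'a chart set \<Rightarrow> 'a form2 \<Rightarrow> bool" where
  "two_form A \<omega> \<longleftrightarrow>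
     (\<forall>c\<in>A. \<forall>q\<in>chart_dom c. bilinear (\<omega> c q) \<and> (\<forall>u. \<omega> c q u u = 0)) \<and>
     (\<forall>c\<in>A. \<forall>u v. smooth_on (coord c ` chart_dom c) (\<lambda>x. \<omega> c (chart_inv c x) u v)) \<and>
     (\<forall>c\<in>A. \<forall>c'\<in>A. \<forall>q\<in>chart_dom c \<inter> chart_dom c'. \<forall>u v.
        \<omega> c q u v =
        \<omega> c' q (frechet_derivative (transition c c') (at (coord c q)) u)
               (frechet_derivative (transition c c') (at (coord c q)) v))"

text \<open>
  Closedness is \<open>d\<omega> = 0\<close> evaluated on constant coordinate vector fields, whose brackets vanish.
\<close>

definition closed_form :: "'a chart set \<Rightarrow> 'a form2 \<Rightarrow> bool" where
  "closed_form A \<omega> \<longleftrightarrow>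
     (\<forall>c\<in>A. \<forall>q\<in>chart_dom c. \<forall>u v w.
        frechet_derivative (\<lambda>x. \<omega> c (chart_inv c x) v w) (at (coord c q)) u +
        frechet_derivative (\<lambda>x. \<omega> c (chart_inv c x) w u) (at (coord c q)) v +
        frechet_derivative (\<lambda>x. \<omega> c (chart_inv c x) u v) (at (coord c q)) w = 0)"

definition nondegenerate :: "'a chart set \<Rightarrow> 'a form2 \<Rightarrow> bool" where
  "nondegenerate A \<omega> \<longleftrightarrow>
     (\<forall>c\<in>A. \<forall>q\<in>chart_dom c. \<forall>u. u \<noteq> 0 \<longrightarrow> (\<exists>v. \<omega> c q u v \<noteq> 0))"

definition symplectic_manifold ::
  "('a::{t2_space,second_countable_topology}) chart set \<Rightarrow> 'a form2 \<Rightarrow> bool" where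
  "symplectic_manifold A \<omega> \<longleftrightarrow>
     smooth_structure A \<and> two_form A \<omega> \<and> closed_form A \<omega> \<and> nondegenerate A \<omega>"

text \<open>The 4-form \<open>\<omega> \<and> \<omega>\<close>, which orients the manifold.\<close>

definition wedge_square :: "'a form2 \<Rightarrow> 'a chart \<Rightarrow> 'a \<Rightarrow> complex \<times> complex \<Rightarrow> complex \<times> complex
    \<Rightarrow> complex \<times> complex \<Rightarrow> complex \<times> complex \<Rightarrow> real" where
  "wedge_square \<omega> c q e1 e2 e3 e4 =
     2 * (\<omega> c q e1 e2 * \<omega> c q e3 e4 - \<omega> c q e1 e3 * \<omega> c q e2 e4 + \<omega> c q e1 e4 * \<omega> c q e2 e3)"

text \<open>\<open>\<omega> = (i/2) (dz \<and> d(cnj z) + dw \<and> d(cnj w))\<close> on the whole domain of the chart.\<close>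

definition darboux_chart :: "'a chart set \<Rightarrow> 'a form2 \<Rightarrow> 'a chart \<Rightarrow> bool" where
  "darboux_chart A \<omega> c \<longleftrightarrow> c \<in> A \<and>
     (\<forall>q\<in>chart_dom c. \<forall>z w z' w'.
        complex_of_real (\<omega> c q (z, w) (z', w')) =
          \<i> / 2 * ((z * cnj z' - cnj z * z') + (w * cnj w' - cnj w * w')))"


section \<open>Symplectic surfaces\<close>

text \<open>
  A smooth embedded real surface (without boundary, not assumed closed as a subset or connected)
  is a subset that, near each of its points, is the plane \<open>\<complex> \<times> {0}\<close> in some chart.
\<close>

definition embedded_surface :: "'a chart set \<Rightarrow> 'a set \<Rightarrow> bool" where
  "embedded_surface A S \<longleftrightarrow>
     (\<forall>q\<in>S. \<exists>c\<in>A. q \<in> chart_dom c \<and>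
        coord c ` (S \<inter> chart_dom c) = coord c ` chart_dom c \<inter> {x. snd x = 0})"

text \<open>The tangent space of \<open>S\<close> at \<open>q\<close>, in the coordinates of the chart \<open>c\<close>.\<close>

definition tangent_space :: "'a chart \<Rightarrow> 'a set \<Rightarrow> 'a \<Rightarrow> (complex \<times> complex) set" where
  "tangent_space c S q =
     {v. \<exists>\<gamma> (e::real). 0 < e \<and> \<gamma> ` {-e<..<e} \<subseteq> S \<inter> chart_dom c \<and> \<gamma> 0 = q \<and>
           smooth_on {-e<..<e} (coord c \<circ> \<gamma>) \<and>
           ((coord c \<circ> \<gamma>) has_vector_derivative v) (at 0)}"

definition symplectic_surface :: "'a chart set \<Rightarrow> 'a form2 \<Rightarrow> 'a set \<Rightarrow> bool" where
  "symplectic_surface A \<omega> S \<longleftrightarrow> embedded_surface A S \<and>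
     (\<forall>q\<in>S. \<forall>c\<in>A. q \<in> chart_dom c \<longrightarrow>
        (\<forall>u\<in>tangent_space c S q. u \<noteq> 0 \<longrightarrow> (\<exists>v\<in>tangent_space c S q. \<omega> c q u v \<noteq> 0)))"

text \<open>Bases of \<open>T\<^sub>q S\<close> that are positive for the orientation given by the restriction of \<open>\<omega>\<close>.\<close>

definition positive_basis :: "'a form2 \<Rightarrow> 'a chart \<Rightarrow> 'a set \<Rightarrow> 'a
    \<Rightarrow> complex \<times> complex \<Rightarrow> complex \<times> complex \<Rightarrow> bool" where
  "positive_basis \<omega> c S q u v \<longleftrightarrow>
     u \<noteq> v \<and> independent {u, v} \<and> span {u, v} = tangent_space c S q \<and> \<omega> c q u v > 0"

definition transverse_positive_at ::
  "'a chart set \<Rightarrow> 'a form2 \<Rightarrow> 'a set \<Rightarrow> 'a set \<Rightarrow> 'a \<Rightarrow> bool" where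
  "transverse_positive_at A \<omega> S S' q \<longleftrightarrow> q \<in> S \<inter> S' \<and>
     (\<forall>c\<in>A. q \<in> chart_dom c \<longrightarrow>
        tangent_space c S q \<inter> tangent_space c S' q = {0} \<and>
        {u + v |u v. u \<in> tangent_space c S q \<and> v \<in> tangent_space c S' q} = UNIV \<and>
        (\<forall>u1 u2 v1 v2. positive_basis \<omega> c S q u1 u2 \<and> positive_basis \<omega> c S' q v1 v2 \<longrightarrow>
           wedge_square \<omega> c q u1 u2 v1 v2 > 0))"


section \<open>Deformations of surfaces\<close>

text \<open>
  Maps on a subset \<open>S\<close> of the manifold are smooth if in charts they extend locally to smooth maps on
  open subsets of the model space.
\<close>

definition smooth_map :: "'a chart set \<Rightarrow> 'a set \<Rightarrow> ('a \<Rightarrow> 'a) \<Rightarrow> bool" where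
  "smooth_map A S f \<longleftrightarrow>
     (\<forall>x\<in>S. \<exists>c\<in>A. \<exists>c'\<in>A. \<exists>N G. x \<in> chart_dom c \<and> open N \<and> coord c x \<in> N \<and> smooth_on N G \<and>
        (\<forall>y\<in>S \<inter> chart_dom c. coord c y \<in> N \<longrightarrow> f y \<in> chart_dom c' \<and> coord c' (f y) = G (coord c y)))"

definition smooth_family :: "'a chart set \<Rightarrow> 'a set \<Rightarrow> (real \<Rightarrow> 'a \<Rightarrow> 'a) \<Rightarrow> bool" where
  "smooth_family A S \<Phi> \<longleftrightarrow>
     (\<forall>t\<in>{0..1}. \<forall>x\<in>S. \<exists>c\<in>A. \<exists>c'\<in>A. \<exists>N G.
        x \<in> chart_dom c \<and> open N \<and> (t, coord c x) \<in> N \<and> smooth_on N G \<and>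
        (\<forall>s\<in>{0..1}. \<forall>y\<in>S \<inter> chart_dom c. (s, coord c y) \<in> N \<longrightarrow>
           \<Phi> s y \<in> chart_dom c' \<and> coord c' (\<Phi> s y) = G (s, coord c y)))"

text \<open>A smooth isotopy of embeddings of \<open>S\<close>, starting at the inclusion.\<close>

definition isotopy :: "'a chart set \<Rightarrow> 'a set \<Rightarrow> (real \<Rightarrow> 'a \<Rightarrow> 'a) \<Rightarrow> bool" where
  "isotopy A S \<Phi> \<longleftrightarrow> smooth_family A S \<Phi> \<and> (\<forall>x\<in>S. \<Phi> 0 x = x) \<and>
     (\<forall>t\<in>{0..1}. inj_on (\<Phi> t) S \<and> embedded_surface A (\<Phi> t ` S) \<and>
        smooth_map A (\<Phi> t ` S) (inv_into S (\<Phi> t)))"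

text \<open>
  \<open>S'\<close> is obtained from \<open>S\<close> by an isotopy that is stationary outside \<open>V\<close>, keeps \<open>V\<close> to itself,
  and moves points by less than \<open>\<epsilon>\<close> as measured in the chart \<open>c\<close>, whose domain should contain \<open>V\<close>.
\<close>

definition local_deformation ::
  "'a chart set \<Rightarrow> 'a chart \<Rightarrow> 'a set \<Rightarrow> real \<Rightarrow> 'a set \<Rightarrow> 'a set \<Rightarrow> bool" where
  "local_deformation A c V \<epsilon> S S' \<longleftrightarrow>
     (\<exists>\<Phi>. isotopy A S \<Phi> \<and> \<Phi> 1 ` S = S' \<and>
        (\<forall>t\<in>{0..1}. \<forall>x\<in>S - V. \<Phi> t x = x) \<and>
        (\<forall>t\<in>{0..1}. \<forall>x\<in>S \<inter> V. \<Phi> t x \<in> V \<and> dist (coord c (\<Phi> t x)) (coord c x) < \<epsilon>))"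

end

theory Submission
  imports Defs
begin

text \<open>
  The surfaces are made flat inside a chart in which they are graphs, and everything is read off from
  the differentials of these graphs at \<open>p\<close>.

  By a relative version of Darboux' theorem (\<open>adapted_darboux_chart\<close>) there are Darboux coordinates
  \<open>(z, w)\<close> at \<open>p\<close> with \<open>S\<^sub>0 = {z = 0}\<close>. Every other surface is transverse to \<open>S\<^sub>0\<close>, hence a graph
  \<open>w = F\<^sub>j z\<close> near \<open>p\<close> (\<open>implicit_graph\<close>). Write its differential at \<open>0\<close> as \<open>\<alpha>\<^sub>j \<zeta> + \<beta>\<^sub>j cnj \<zeta>\<close>. That \<open>S\<^sub>j\<close> is
  symplectic and meets \<open>S\<^sub>0\<close> positively means \<open>1 + |\<alpha>\<^sub>j|\<^sup>2 - |\<beta>\<^sub>j|\<^sup>2 > 0\<close>, and that \<open>S\<^sub>i\<close> and \<open>S\<^sub>j\<close> meet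
  transversely and positively means \<open>|\<beta>\<^sub>i - \<beta>\<^sub>j| < |\<alpha>\<^sub>i - \<alpha>\<^sub>j|\<close> (\<open>graph_tangent_positive\<close>,
  \<open>graphs_tangent_positive\<close>). Both conditions persist along the path \<open>(\<alpha>\<^sub>j + s \<kappa>, (1 - s) \<beta>\<^sub>j)\<close>, where \<open>\<kappa>\<close>
  is small and the same for all \<open>j\<close>. The path ends at complex lines \<open>w = a\<^sub>j z\<close> with
  \<open>a\<^sub>j = \<alpha>\<^sub>j + \<kappa>\<close>; these are distinct, and \<open>\<kappa>\<close> is chosen so that none of them is \<open>0\<close>.

  The deformed surface is the graph of \<open>F\<^sub>j + \<psi> (a\<^sub>j z - F\<^sub>j)\<close> for a cut-off function \<open>\<psi>\<close>. Its tangent plane at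
  \<open>z\<close> is the member \<open>s = \<psi> z\<close> of the path, up to an error that tends to 0 with \<open>z\<close> and one of the size of
  \<open>|z| |D\<psi> z|\<close>. For an ordinary cut-off function the latter is bounded but not small; a logarithmic one (\<open>log_cutoff\<close>) makes it as small as
  desired, so the graph stays symplectic (\<open>flattening_positive\<close>). As \<open>\<psi>\<close> is the same for all \<open>j\<close>, two
  deformed surfaces are at the same stage \<open>s\<close> of their paths over each \<open>z\<close>, and the second condition keeps
  them apart for \<open>z \<noteq> 0\<close> (\<open>flattening_disjoint\<close>). Sliding the graphs vertically is the isotopy
  (\<open>isotopy_Phi\<close>).

  For the Darboux chart, coordinates are first chosen in which \<open>S\<^sub>0\<close> is \<open>{z = 0}\<close>, the form is standard
  at \<open>0\<close>, and the \<open>z\<close>- and \<open>w\<close>-directions are orthogonal along \<open>{z = 0}\<close> (\<open>normalized_chart\<close>). The radial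
  primitive of the difference to the standard form then annihilates the \<open>z\<close>-directions along \<open>{z = 0}\<close>, so
  Moser's vector field is tangent to that plane and its flow preserves it (\<open>darboux_normal_form\<close>). The
  flow is obtained from an integral equation whose right-hand side is a contraction, because the
  field and its derivative vanish at \<open>0\<close>; smooth dependence on the initial value follows since the
  derivatives solve equations of the same kind (\<open>integral_equation_ck\<close>).
\<close>

section \<open>Calculus of differentiable maps of class C^k\<close>

lemma ck_on_subset: "ck_on k S f \<Longrightarrow> T \<subseteq> S \<Longrightarrow> ck_on k T f"
  by (induction k arbitrary: f) (auto intro: continuous_on_subset)

lemma ck_on_cong:
  assumes "open S" "\<And>x. x \<in> S \<Longrightarrow> f x = g x" "ck_on k S f"
  shows "ck_on k S g"
  using assms(2,3)
proof (induction k arbitrary: f g)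
  case 0
  then show ?case by (simp cong: continuous_on_cong)
next
  case (Suc k)
  have der: "(g has_derivative frechet_derivative f (at x)) (at x)" if "x \<in> S" for x
  proof (rule has_derivative_transform_within_open[OF _ assms(1) that])
    show "(f has_derivative frechet_derivative f (at x)) (at x)"
      using Suc.prems that by (auto simp: frechet_derivative_works)
  qed (use Suc.prems in auto)
  then have "frechet_derivative g (at x) = frechet_derivative f (at x)" if "x \<in> S" for x
    using frechet_derivative_at that by metis
  note eq = this
  have "ck_on k S (\<lambda>x. frechet_derivative g (at x) v)" for v
    by (rule Suc.IH[of "\<lambda>x. frechet_derivative f (at x) v"])
      (use Suc.prems(2) eq in auto)
  then show ?case
    using der unfolding ck_on.simps differentiable_def by blast
qed

text \<open>
  Any family \<open>f'\<close> of derivatives may be used in place of the canonical \<open>frechet_derivative\<close>, so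
  that the usual derivative rules apply.
\<close>

lemma ck_on_SucI:
  assumes "open S" "\<And>x. x \<in> S \<Longrightarrow> (f has_derivative f' x) (at x)"
    and "\<And>v. ck_on k S (\<lambda>x. f' x v)"
  shows "ck_on (Suc k) S f"
proof -
  have "ck_on k S (\<lambda>x. frechet_derivative f (at x) v)" for v
  proof (rule ck_on_cong[OF assms(1) _ assms(3)[of v]])
    show "f' x v = frechet_derivative f (at x) v" if "x \<in> S" for x
      using frechet_derivative_at[OF assms(2)[OF that]] by (rule fun_cong)
  qed
  moreover have "f differentiable (at x)" if "x \<in> S" for x
    using assms(2)[OF that] unfolding differentiable_def by blast
  ultimately show ?thesis unfolding ck_on.simps by blast
qed

lemma ck_on_has_derivative:
  "ck_on (Suc k) S f \<Longrightarrow> x \<in> S \<Longrightarrow> (f has_derivative frechet_derivative f (at x)) (at x)"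
  by (simp add: frechet_derivative_works)

lemma ck_on_Suc_imp: "ck_on (Suc k) S f \<Longrightarrow> ck_on k S f"
proof (induction k arbitrary: f)
  case 0
  then show ?case
    by (simp add: continuous_at_imp_continuous_on differentiable_imp_continuous_within)
next
  case (Suc k)
  then show ?case unfolding ck_on.simps(2)[of "Suc k"] ck_on.simps(2)[of k S f] by blast
qed

lemma ck_on_mono: "ck_on k S f \<Longrightarrow> j \<le> k \<Longrightarrow> ck_on j S f"
  by (rule inc_induct[of j k "\<lambda>i. ck_on i S f"]) (use ck_on_Suc_imp in blast)+

lemma ck_on_continuous: "ck_on k S f \<Longrightarrow> continuous_on S f"
  using ck_on_mono[of k S f 0] by simp

lemma ck_on_local:
  "(\<And>x. x \<in> S \<Longrightarrow> \<exists>T. open T \<and> x \<in> T \<and> ck_on k T f) \<Longrightarrow> ck_on k S f"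
proof (induction k arbitrary: f)
  case 0
  have "isCont f x" if "x \<in> S" for x
    using 0[OF that] continuous_on_eq_continuous_at by auto
  then show ?case by (simp add: continuous_at_imp_continuous_on)
next
  case (Suc k)
  show ?case unfolding ck_on.simps
  proof (intro conjI ballI allI)
    show "f differentiable at x" if "x \<in> S" for x
      using Suc.prems[OF that] by auto
    show "ck_on k S (\<lambda>x. frechet_derivative f (at x) v)" for v
      by (rule Suc.IH) (use Suc.prems in fastforce)
  qed
qed

lemma ck_on_const [simp]: "ck_on k S (\<lambda>x. c)"
proof (induction k arbitrary: c)
  case (Suc k)
  then show ?case by (simp add: frechet_derivative_const)
qed simp

lemma ck_on_id: "open S \<Longrightarrow> ck_on k S (\<lambda>x. x)"
  by (cases k) (auto simp del: ck_on.simps(2) intro!: ck_on_SucI[where f'="\<lambda>x v. v"] derivative_intros)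

lemma ck_on_linear:
  assumes "bounded_linear L" "open S"
  shows "ck_on k S f \<Longrightarrow> ck_on k S (\<lambda>x. L (f x))"
proof (induction k arbitrary: f)
  case 0
  then show ?case by (simp add: bounded_linear.continuous_on[OF assms(1)])
next
  case (Suc k)
  show ?case
    by (rule ck_on_SucI[OF assms(2) bounded_linear.has_derivative[OF assms(1) ck_on_has_derivative[OF Suc.prems]]])
      (use Suc in auto)
qed

lemma ck_on_add:
  assumes "open S"
  shows "ck_on k S f \<Longrightarrow> ck_on k S g \<Longrightarrow> ck_on k S (\<lambda>x. f x + g x)"
proof (induction k arbitrary: f g)
  case 0
  then show ?case by (simp add: continuous_on_add)
next
  case (Suc k)
  show ?case
    by (rule ck_on_SucI[OF assms has_derivative_add[OF ck_on_has_derivative[OF Suc.prems(1)] ck_on_has_derivative[OF Suc.prems(2)]]])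
      (use Suc in auto)
qed

lemma ck_on_bilinear:
  assumes "bounded_bilinear B" "open S"
  shows "ck_on k S f \<Longrightarrow> ck_on k S g \<Longrightarrow> ck_on k S (\<lambda>x. B (f x) (g x))"
proof (induction k arbitrary: f g)
  case 0
  then show ?case by (simp add: bounded_bilinear.continuous_on[OF assms(1)])
next
  case (Suc k)
  have "ck_on k S f" "ck_on k S g" using Suc.prems ck_on_Suc_imp by blast+
  show ?case
  proof (rule ck_on_SucI[OF assms(2) bounded_bilinear.FDERIV[OF assms(1) ck_on_has_derivative[OF Suc.prems(1)] ck_on_has_derivative[OF Suc.prems(2)]]])
    fix v
    have "ck_on k S (\<lambda>x. frechet_derivative f (at x) v)" "ck_on k S (\<lambda>x. frechet_derivative g (at x) v)"
      using Suc.prems unfolding ck_on.simps by blast+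
    then show "ck_on k S (\<lambda>x. B (f x) (frechet_derivative g (at x) v) + B (frechet_derivative f (at x) v) (g x))"
      using \<open>ck_on k S f\<close> \<open>ck_on k S g\<close> Suc.IH by (auto intro: ck_on_add[OF assms(2)])
  qed
qed

lemmas ck_on_scaleR = ck_on_bilinear[OF bounded_bilinear_scaleR]
lemmas ck_on_mult = ck_on_bilinear[OF bounded_bilinear_mult]
lemmas ck_on_inner = ck_on_bilinear[OF bounded_bilinear_inner]

lemma ck_on_minus: "open S \<Longrightarrow> ck_on k S f \<Longrightarrow> ck_on k S (\<lambda>x. - f x)"
  by (rule ck_on_linear[OF bounded_linear_minus[OF bounded_linear_ident]])

lemma ck_on_diff: "open S \<Longrightarrow> ck_on k S f \<Longrightarrow> ck_on k S g \<Longrightarrow> ck_on k S (\<lambda>x. f x - g x)"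
  using ck_on_add[OF _ _ ck_on_minus] by fastforce

lemma ck_on_sum:
  "open S \<Longrightarrow> (\<And>i. i \<in> I \<Longrightarrow> ck_on k S (f i)) \<Longrightarrow> ck_on k S (\<lambda>x. \<Sum>i\<in>I. f i x)"
  by (induction I rule: infinite_finite_induct) (auto intro: ck_on_add)

lemma ck_on_fst: "open S \<Longrightarrow> ck_on k S f \<Longrightarrow> ck_on k S (\<lambda>x. fst (f x))"
  by (rule ck_on_linear[OF bounded_linear_fst])

lemma ck_on_snd: "open S \<Longrightarrow> ck_on k S f \<Longrightarrow> ck_on k S (\<lambda>x. snd (f x))"
  by (rule ck_on_linear[OF bounded_linear_snd])

lemma ck_on_Pair:
  assumes "open S" "ck_on k S f" "ck_on k S g"
  shows "ck_on k S (\<lambda>x. (f x, g x))"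
proof -
  have "bounded_linear (\<lambda>a. (a, 0))" "bounded_linear (\<lambda>b. (0, b))"
    by (intro bounded_linear_Pair bounded_linear_ident bounded_linear_zero)+
  then have "ck_on k S (\<lambda>x. (f x, 0) + (0, g x))"
    by (intro ck_on_add ck_on_linear[where L="\<lambda>a. (a, 0)"] ck_on_linear[where L="\<lambda>b. (0, b)"] assms)
  then show ?thesis by simp
qed

lemma linear_expand_Basis:
  fixes f :: "'a::euclidean_space \<Rightarrow> 'b::real_normed_vector"
  assumes "linear f"
  shows "(\<Sum>b\<in>Basis. (v \<bullet> b) *\<^sub>R f b) = f v"
proof -
  have "(\<Sum>b\<in>Basis. (v \<bullet> b) *\<^sub>R f b) = f (\<Sum>b\<in>Basis. (v \<bullet> b) *\<^sub>R b)"
    by (simp add: linear_sum[OF assms] linear_cmul[OF assms])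
  then show ?thesis by (simp add: euclidean_representation)
qed

text \<open>
  A linear map that depends on \<open>x\<close> is controlled by its values on the finitely many basis vectors.
  This reduces differentiability in the operator norm to that of vector-valued maps.
\<close>

lemma ck_on_linear_expand:
  fixes f' :: "'a::real_normed_vector \<Rightarrow> 'b::euclidean_space \<Rightarrow> 'c::real_normed_vector"
  assumes "open S" "\<And>x. x \<in> S \<Longrightarrow> linear (f' x)" "ck_on k S g"
    and "\<And>b. b \<in> Basis \<Longrightarrow> ck_on k S (\<lambda>x. f' x b)"
  shows "ck_on k S (\<lambda>x. f' x (g x))"
proof (rule ck_on_cong[OF assms(1)])
  show "ck_on k S (\<lambda>x. \<Sum>b\<in>Basis. (g x \<bullet> b) *\<^sub>R f' x b)"
    by (intro ck_on_sum ck_on_scaleR ck_on_inner assms ck_on_const)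
  show "(\<Sum>b\<in>Basis. (g x \<bullet> b) *\<^sub>R f' x b) = f' x (g x)" if "x \<in> S" for x
    by (rule linear_expand_Basis[OF assms(2)[OF that]])
qed

lemma ck_on_compose:
  fixes f :: "'b::euclidean_space \<Rightarrow> 'c::real_normed_vector"
    and g :: "'a::real_normed_vector \<Rightarrow> 'b"
  assumes "open S" "open T" "\<And>x. x \<in> S \<Longrightarrow> g x \<in> T"
  shows "ck_on k T f \<Longrightarrow> ck_on k S g \<Longrightarrow> ck_on k S (\<lambda>x. f (g x))"
proof (induction k arbitrary: f)
  case 0
  then show ?case using assms(3) by (auto intro: continuous_on_compose2)
next
  case (Suc k)
  note Df = ck_on_has_derivative[OF Suc.prems(1)] and Dg = ck_on_has_derivative[OF Suc.prems(2)]
  show ?case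
  proof (rule ck_on_SucI[OF assms(1)])
    show "((\<lambda>x. f (g x)) has_derivative
        (\<lambda>v. frechet_derivative f (at (g x)) (frechet_derivative g (at x) v))) (at x)"
      if "x \<in> S" for x
      using has_derivative_compose[OF Dg[OF that] Df] assms(3)[OF that] by simp
    show "ck_on k S (\<lambda>x. frechet_derivative f (at (g x)) (frechet_derivative g (at x) v))" for v
    proof (rule ck_on_linear_expand[OF assms(1)])
      show "linear (frechet_derivative f (at (g x)))" if "x \<in> S" for x
        using Df assms(3)[OF that] has_derivative_linear by blast
      show "ck_on k S (\<lambda>x. frechet_derivative g (at x) v)" using Suc.prems(2) by simp
      show "ck_on k S (\<lambda>x. frechet_derivative f (at (g x)) b)" for b
        by (rule Suc.IH[OF _ ck_on_Suc_imp[OF Suc.prems(2)]]) (use Suc.prems in auto)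
    qed
  qed
qed

text \<open>
  A product of two factors vanishing at \<open>x\<close> is differentiable there as soon as one of them is
  differentiable and the other one continuous.
\<close>

lemma has_derivative_scaleR_zero:
  fixes B :: "'a::real_normed_vector \<Rightarrow> 'b::real_normed_vector"
  assumes "isCont a x" "a x = 0" "(B has_derivative B') (at x)" "B x = 0"
  shows "((\<lambda>y. a y *\<^sub>R B y) has_derivative (\<lambda>v. 0)) (at x)"
  unfolding has_derivative_within
proof (intro conjI bounded_linear_zero)
  interpret B': bounded_linear B' using assms(3) by (rule has_derivative_bounded_linear)
  obtain K where K: "\<And>v. norm (B' v) \<le> norm v * K" using B'.bounded by blast
  have 1: "((\<lambda>y. (1 / norm (y - x)) *\<^sub>R (B y - (B x + B' (y - x)))) \<longlongrightarrow> 0) (at x)"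
    using assms(3) by (simp add: has_derivative_within)
  have 2: "(a \<longlongrightarrow> 0) (at x)" using assms(1,2) by (simp add: isCont_def)
  have 3: "((\<lambda>y. a y *\<^sub>R ((1 / norm (y - x)) *\<^sub>R B' (y - x))) \<longlongrightarrow> 0) (at x)"
  proof (rule Lim_null_comparison)
    show "((\<lambda>y. \<bar>a y\<bar> * \<bar>K\<bar>) \<longlongrightarrow> 0) (at x)" using 2 by (auto intro!: tendsto_eq_intros)
    show "\<forall>\<^sub>F y in at x. norm (a y *\<^sub>R ((1 / norm (y - x)) *\<^sub>R B' (y - x))) \<le> \<bar>a y\<bar> * \<bar>K\<bar>"
    proof (rule always_eventually, rule allI)
      fix y
      have "norm (B' (y - x)) / norm (y - x) \<le> \<bar>K\<bar>"
        using K[of "y - x"] by (cases "y = x") (auto simp: divide_simps mult.commute intro: order_trans[OF K] mult_left_mono)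
      from mult_left_mono[OF this abs_ge_zero[of "a y"]]
      show "norm (a y *\<^sub>R ((1 / norm (y - x)) *\<^sub>R B' (y - x))) \<le> \<bar>a y\<bar> * \<bar>K\<bar>"
        by simp
    qed
  qed
  have "((\<lambda>y. a y *\<^sub>R ((1 / norm (y - x)) *\<^sub>R (B y - (B x + B' (y - x)))) +
      a y *\<^sub>R ((1 / norm (y - x)) *\<^sub>R B' (y - x))) \<longlongrightarrow> 0 *\<^sub>R 0 + 0) (at x)"
    by (intro tendsto_add tendsto_scaleR 1 2 3)
  then show "((\<lambda>y. (1 / norm (y - x)) *\<^sub>R (a y *\<^sub>R B y - (a x *\<^sub>R B x + 0))) \<longlongrightarrow> 0) (at x)"
    using assms(2,4) by (simp add: algebra_simps)
qed

lemma linear_norm_le_sum_Basis: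
  fixes f :: "'a::euclidean_space \<Rightarrow> 'b::real_normed_vector"
  assumes "linear f"
  shows "norm (f v) \<le> (\<Sum>b\<in>Basis. norm (f b)) * norm v"
proof -
  have "f v = (\<Sum>b\<in>Basis. (v \<bullet> b) *\<^sub>R f b)"
    by (rule linear_expand_Basis[OF assms, symmetric])
  also have "norm \<dots> \<le> (\<Sum>b\<in>Basis. norm (f b) * norm v)"
  proof (rule sum_norm_le)
    fix b :: 'a assume "b \<in> Basis"
    from mult_right_mono[OF Basis_le_norm[OF this, of v] norm_ge_zero[of "f b"]]
    show "norm ((v \<bullet> b) *\<^sub>R f b) \<le> norm (f b) * norm v" by (simp add: mult.commute)
  qed
  finally show ?thesis by (simp add: sum_distrib_right)
qed

lemma linear_inj_left_inverse:
  fixes f :: "'a::euclidean_space \<Rightarrow> 'a"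
  assumes "linear f" "inj f"
  obtains g where "bounded_linear g" "\<And>v. g (f v) = v" "\<And>v. f (g v) = v"
proof -
  obtain g where g: "linear g" "g \<circ> f = id"
    using linear_injective_left_inverse[OF assms] by blast
  moreover have "f \<circ> g = id" using g assms(1) linear_inverse_left by metis
  ultimately show ?thesis using that linear_conv_bounded_linear by (metis comp_apply id_apply)
qed

text \<open>
  Inverse operators are not formed. Differentiating \<open>L x (h x) = m x\<close> shows that \<open>D h\<close> solves a
  linear system with the same operators \<open>L x\<close> and the right-hand side \<open>D m - (D L) h\<close>, which has
  one derivative less; hence induction on \<open>k\<close>.
\<close>

lemma ck_on_linear_solve:
  fixes L :: "'a::real_normed_vector \<Rightarrow> 'b::euclidean_space \<Rightarrow> 'b"
  assumes S: "open S" and lin: "\<And>x. x \<in> S \<Longrightarrow> linear (L x)" and inj: "\<And>x. x \<in> S \<Longrightarrow> inj (L x)"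
  shows "(\<And>e. ck_on k S (\<lambda>x. L x e)) \<Longrightarrow> ck_on k S m \<Longrightarrow> (\<And>x. x \<in> S \<Longrightarrow> L x (h x) = m x)
    \<Longrightarrow> ck_on k S h"
proof (induction k arbitrary: m h)
  case 0
  have "isCont h x" if x: "x \<in> S" for x
  proof -
    obtain P where P: "bounded_linear P" "\<And>v. P (L x v) = v" "\<And>v. L x (P v) = v"
      using linear_inj_left_inverse[OF lin[OF x] inj[OF x]] by blast
    interpret P: bounded_linear P by fact
    obtain K where K: "K > 0" "\<And>v. norm (P v) \<le> norm v * K" using P.pos_bounded by blast
    define N where "N y = (\<Sum>b\<in>Basis. norm (L y b - L x b))" for y
    have cL: "isCont (\<lambda>y. L y e) x" for e
      using "0.prems"(1) x S continuous_on_eq_continuous_at by auto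
    have cm: "isCont m x" using "0.prems"(2) x S continuous_on_eq_continuous_at by auto
    have cN: "isCont N x" unfolding N_def by (intro continuous_intros cL)
    have N: "(N \<longlongrightarrow> 0) (at x)" using cN by (simp add: isCont_def N_def)
    have *: "norm (h y - h x) \<le> norm (m y - L y (h x)) * K + N y * K * norm (h y - h x)" if y: "y \<in> S" for y
    proof -
      interpret Ly: linear "L y" using lin[OF y] .
      interpret Lx: linear "L x" using lin[OF x] .
      have eq: "h y - h x = P (m y - L y (h x)) - P (L y (h y - h x) - L x (h y - h x))"
        using "0.prems"(3)[OF y] P(2) by (simp add: P.diff Ly.diff Lx.diff)
      have l: "linear (\<lambda>v. L y v - L x v)"
        using Ly.linear_axioms Lx.linear_axioms by (rule linear_compose_sub)
      have "norm (L y (h y - h x) - L x (h y - h x)) \<le> N y * norm (h y - h x)"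
        using linear_norm_le_sum_Basis[OF l] by (simp add: N_def)
      then have "norm (L y (h y - h x) - L x (h y - h x)) * K \<le> N y * norm (h y - h x) * K"
        using K(1) by (intro mult_right_mono) auto
      moreover have "norm (h y - h x) \<le> norm (m y - L y (h x)) * K + norm (L y (h y - h x) - L x (h y - h x)) * K"
        using norm_triangle_ineq4[of "P (m y - L y (h x))" "P (L y (h y - h x) - L x (h y - h x))"]
          K(2)[of "m y - L y (h x)"] K(2)[of "L y (h y - h x) - L x (h y - h x)"]
        unfolding eq[symmetric] by linarith
      ultimately show ?thesis by (simp add: mult_ac)
    qed
    have "\<forall>\<^sub>F y in at x. N y < 1 / (2 * K)" using N K by (intro order_tendstoD) auto
    moreover have "\<forall>\<^sub>F y in at x. y \<in> S" using S x by (simp add: eventually_at_in_open')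
    ultimately have ev: "\<forall>\<^sub>F y in at x. norm (h y - h x) \<le> 2 * K * norm (m y - L y (h x))"
    proof eventually_elim
      case (elim y)
      have "N y * K * norm (h y - h x) \<le> 1 / 2 * norm (h y - h x)"
        using elim K by (intro mult_right_mono) (auto simp: field_simps)
      then show ?case using *[OF elim(2)] by (simp add: mult_ac)
    qed
    have "((\<lambda>y. 2 * K * norm (m y - L y (h x))) \<longlongrightarrow> 2 * K * norm (m x - L x (h x))) (at x)"
      using cL cm by (intro tendsto_intros) (auto simp: isCont_def)
    then have "((\<lambda>y. h y - h x) \<longlongrightarrow> 0) (at x)"
      using "0.prems"(3)[OF x] by (intro Lim_null_comparison[OF ev]) simp
    then show ?thesis by (simp add: isCont_def LIM_zero_iff)
  qed
  then show ?case by (simp add: continuous_at_imp_continuous_on)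
next
  case (Suc k)
  have IH: "ck_on k S h'" if "ck_on k S m'" "\<And>x. x \<in> S \<Longrightarrow> L x (h' x) = m' x" for m' h'
    by (rule Suc.IH[OF ck_on_Suc_imp[OF Suc.prems(1)] that])
  have hk: "ck_on k S h"
    by (rule IH[OF ck_on_Suc_imp[OF Suc.prems(2)] Suc.prems(3)])
  note DL = ck_on_has_derivative[OF Suc.prems(1)] and Dm = ck_on_has_derivative[OF Suc.prems(2)]
  define Q where "Q x v = frechet_derivative m (at x) v - frechet_derivative (\<lambda>y. L y (h x)) (at x) v" for x v
  have der: "\<exists>P. (h has_derivative (\<lambda>v. P (Q x v))) (at x) \<and> (\<forall>v. L x (P v) = v)" if x: "x \<in> S" for x
  proof -
    obtain P where P: "bounded_linear P" "\<And>v. P (L x v) = v" "\<And>v. L x (P v) = v"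
      using linear_inj_left_inverse[OF lin[OF x] inj[OF x]] by blast
    interpret P: bounded_linear P by fact
    interpret Lx: linear "L x" using lin[OF x] .
    have ch: "isCont h x" using ck_on_continuous[OF hk] x S continuous_on_eq_continuous_at by auto
    \<comment> \<open>The correction term is a product of two factors that vanish at \<open>x\<close>; so far \<open>h\<close> is only
      known to be continuous.\<close>
    have z: "((\<lambda>y. ((h y - h x) \<bullet> b) *\<^sub>R (L y b - L x b)) has_derivative (\<lambda>v. 0)) (at x)" for b
    proof (rule has_derivative_scaleR_zero)
      show "((\<lambda>y. L y b - L x b) has_derivative frechet_derivative (\<lambda>y. L y b) (at x)) (at x)"
        using DL[OF x, of b] by (auto intro!: derivative_eq_intros)
    qed (auto intro!: continuous_intros ch)
    have "((\<lambda>y. h x + P (m y - L y (h x)) - P (\<Sum>b\<in>Basis. ((h y - h x) \<bullet> b) *\<^sub>R (L y b - L x b)))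
        has_derivative (\<lambda>v. 0 + P (Q x v) - P (\<Sum>b\<in>(Basis::'b set). 0))) (at x)"
      unfolding Q_def
      by (intro has_derivative_add has_derivative_diff has_derivative_const P.has_derivative
          has_derivative_sum z DL Dm x)
    then have "((\<lambda>y. h x + P (m y - L y (h x)) - P (\<Sum>b\<in>Basis. ((h y - h x) \<bullet> b) *\<^sub>R (L y b - L x b)))
        has_derivative (\<lambda>v. P (Q x v))) (at x)" by (simp add: P.zero)
    then have "(h has_derivative (\<lambda>v. P (Q x v))) (at x)"
    proof (rule has_derivative_transform_within_open[OF _ S x])
      fix y assume y: "y \<in> S"
      interpret Ly: linear "L y" using lin[OF y] .
      have l: "linear (\<lambda>v. L y v - L x v)"
        using Ly.linear_axioms Lx.linear_axioms by (rule linear_compose_sub)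
      have "(\<Sum>b\<in>Basis. ((h y - h x) \<bullet> b) *\<^sub>R (L y b - L x b)) = L y (h y - h x) - L x (h y - h x)"
        by (rule linear_expand_Basis[OF l])
      then show "h x + P (m y - L y (h x)) - P (\<Sum>b\<in>Basis. ((h y - h x) \<bullet> b) *\<^sub>R (L y b - L x b)) = h y"
        using Suc.prems(3)[OF y] P(2) by (simp add: P.diff Ly.diff Lx.diff)
    qed
    then show ?thesis using P by blast
  qed
  have Dh: "(h has_derivative frechet_derivative h (at x)) (at x)" if "x \<in> S" for x
    using der[OF that] frechet_derivative_at by metis
  have sol: "L x (frechet_derivative h (at x) v) = Q x v" if "x \<in> S" for x v
    using der[OF that] frechet_derivative_at by metis
  show ?case
  proof (rule ck_on_SucI[OF S Dh])
    fix v
    have "ck_on k S (\<lambda>x. (\<lambda>e. frechet_derivative (\<lambda>y. L y e) (at x) v) (h x))"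
    proof (rule ck_on_linear_expand[OF S _ hk])
      show "ck_on k S (\<lambda>x. frechet_derivative (\<lambda>y. L y b) (at x) v)" for b
        using Suc.prems(1)[of b] by simp
      show "linear (\<lambda>e. frechet_derivative (\<lambda>y. L y e) (at x) v)" if x: "x \<in> S" for x
      proof (rule linearI)
        fix a b c
        have *: "((\<lambda>y. L y (a + b)) has_derivative
            (\<lambda>v. frechet_derivative (\<lambda>y. L y a) (at x) v + frechet_derivative (\<lambda>y. L y b) (at x) v)) (at x)"
          by (rule has_derivative_transform_within_open[OF has_derivative_add[OF DL[OF x] DL[OF x]] S x])
            (simp add: linear_add[OF lin])
        show "frechet_derivative (\<lambda>y. L y (a + b)) (at x) v =
          frechet_derivative (\<lambda>y. L y a) (at x) v + frechet_derivative (\<lambda>y. L y b) (at x) v"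
          using frechet_derivative_at[OF *] by metis
        have *: "((\<lambda>y. L y (c *\<^sub>R b)) has_derivative
            (\<lambda>v. c *\<^sub>R frechet_derivative (\<lambda>y. L y b) (at x) v)) (at x)"
          by (rule has_derivative_transform_within_open[OF has_derivative_scaleR_right[OF DL[OF x]] S x])
            (simp add: linear_cmul[OF lin])
        show "frechet_derivative (\<lambda>y. L y (c *\<^sub>R b)) (at x) v =
          c *\<^sub>R frechet_derivative (\<lambda>y. L y b) (at x) v"
          using frechet_derivative_at[OF *] by metis
      qed
    qed
    then have "ck_on k S (\<lambda>x. Q x v)"
      unfolding Q_def using Suc.prems(2) by (intro ck_on_diff S) auto
    then show "ck_on k S (\<lambda>x. frechet_derivative h (at x) v)"
      by (rule IH[of "\<lambda>x. Q x v"]) (rule sol)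
  qed
qed

section \<open>Smooth maps and their inverses\<close>

lemma smooth_onD: "smooth_on S f \<Longrightarrow> ck_on k S f"
  by (simp add: smooth_on_def)

lemma smooth_has_derivative:
  "smooth_on S f \<Longrightarrow> x \<in> S \<Longrightarrow> (f has_derivative frechet_derivative f (at x)) (at x)"
  by (rule ck_on_has_derivative[OF smooth_onD])

lemma smooth_frechet: "smooth_on S f \<Longrightarrow> smooth_on S (\<lambda>x. frechet_derivative f (at x) v)"
  unfolding smooth_on_def
proof
  assume "\<forall>k. ck_on k S f"
  then show "ck_on k S (\<lambda>x. frechet_derivative f (at x) v)" for k
    using ck_on.simps(2)[of k S f] by blast
qed

lemma smooth_on_continuous: "smooth_on S f \<Longrightarrow> continuous_on S f"
  using smooth_onD ck_on_continuous by blast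

lemma smooth_on_subset: "smooth_on S f \<Longrightarrow> T \<subseteq> S \<Longrightarrow> smooth_on T f"
  by (auto simp: smooth_on_def intro: ck_on_subset)

lemma smooth_on_cong: "open S \<Longrightarrow> (\<And>x. x \<in> S \<Longrightarrow> f x = g x) \<Longrightarrow> smooth_on S f \<Longrightarrow> smooth_on S g"
  using ck_on_cong[of S f g] by (auto simp: smooth_on_def)

lemma smooth_on_local:
  "(\<And>x. x \<in> S \<Longrightarrow> \<exists>T. open T \<and> x \<in> T \<and> smooth_on T f) \<Longrightarrow> smooth_on S f"
  unfolding smooth_on_def by (intro allI ck_on_local) blast

lemma smooth_onI_frechet:
  assumes "open S" "\<And>x. x \<in> S \<Longrightarrow> (f has_derivative f' x) (at x)"
    and "\<And>v. smooth_on S (\<lambda>x. f' x v)"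
  shows "smooth_on S f"
  unfolding smooth_on_def
proof
  show "ck_on k S f" for k
    using ck_on_Suc_imp[OF ck_on_SucI[OF assms(1,2)]] assms(3) by (simp add: smooth_on_def)
qed

named_theorems smooth_intros

lemma smooth_on_const [simp, smooth_intros]: "smooth_on S (\<lambda>x. c)"
  and smooth_on_id [smooth_intros]: "open S \<Longrightarrow> smooth_on S (\<lambda>x. x)"
  and smooth_on_add [smooth_intros]: "open S \<Longrightarrow> smooth_on S f \<Longrightarrow> smooth_on S g \<Longrightarrow> smooth_on S (\<lambda>x. f x + g x)"
  and smooth_on_diff [smooth_intros]: "open S \<Longrightarrow> smooth_on S f \<Longrightarrow> smooth_on S g \<Longrightarrow> smooth_on S (\<lambda>x. f x - g x)"
  and smooth_on_minus [smooth_intros]: "open S \<Longrightarrow> smooth_on S f \<Longrightarrow> smooth_on S (\<lambda>x. - f x)"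
  for f g :: "'a::real_normed_vector \<Rightarrow> 'b::real_normed_vector"
  by (auto simp: smooth_on_def intro: ck_on_id ck_on_add ck_on_diff ck_on_minus)

lemma smooth_on_scaleR [smooth_intros]:
  "open S \<Longrightarrow> smooth_on S f \<Longrightarrow> smooth_on S g \<Longrightarrow> smooth_on S (\<lambda>x. f x *\<^sub>R g x)"
  by (simp add: smooth_on_def ck_on_scaleR)

lemma smooth_on_mult [smooth_intros]:
  fixes f g :: "'a::real_normed_vector \<Rightarrow> 'b::real_normed_algebra"
  shows "open S \<Longrightarrow> smooth_on S f \<Longrightarrow> smooth_on S g \<Longrightarrow> smooth_on S (\<lambda>x. f x * g x)"
  by (simp add: smooth_on_def ck_on_mult)

lemma smooth_on_inner [smooth_intros]:
  "open S \<Longrightarrow> smooth_on S f \<Longrightarrow> smooth_on S g \<Longrightarrow> smooth_on S (\<lambda>x. f x \<bullet> g x)"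
  by (simp add: smooth_on_def ck_on_inner)

lemma smooth_on_fst [smooth_intros]: "open S \<Longrightarrow> smooth_on S f \<Longrightarrow> smooth_on S (\<lambda>x. fst (f x))"
  by (simp add: smooth_on_def ck_on_fst)

lemma smooth_on_snd [smooth_intros]: "open S \<Longrightarrow> smooth_on S f \<Longrightarrow> smooth_on S (\<lambda>x. snd (f x))"
  by (simp add: smooth_on_def ck_on_snd)

lemma smooth_on_Pair [smooth_intros]:
  "open S \<Longrightarrow> smooth_on S f \<Longrightarrow> smooth_on S g \<Longrightarrow> smooth_on S (\<lambda>x. (f x, g x))"
  by (simp add: smooth_on_def ck_on_Pair)

lemma smooth_on_sum [smooth_intros]:
  "open S \<Longrightarrow> (\<And>i. i \<in> I \<Longrightarrow> smooth_on S (f i)) \<Longrightarrow> smooth_on S (\<lambda>x. \<Sum>i\<in>I. f i x)"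
  by (simp add: smooth_on_def ck_on_sum)

lemma smooth_on_linear:
  "bounded_linear L \<Longrightarrow> open S \<Longrightarrow> smooth_on S f \<Longrightarrow> smooth_on S (\<lambda>x. L (f x))"
  by (simp add: smooth_on_def ck_on_linear)

lemmas smooth_on_Re [smooth_intros] = smooth_on_linear[OF bounded_linear_Re]
lemmas smooth_on_Im [smooth_intros] = smooth_on_linear[OF bounded_linear_Im]
lemma smooth_on_compose:
  fixes f :: "'b::euclidean_space \<Rightarrow> 'c::real_normed_vector"
  assumes "smooth_on T f" "smooth_on S g" "open S" "open T" "\<And>x. x \<in> S \<Longrightarrow> g x \<in> T"
  shows "smooth_on S (\<lambda>x. f (g x))"
  using assms by (simp add: smooth_on_def ck_on_compose)

lemma smooth_on_linear_solve:
  fixes L :: "'a::real_normed_vector \<Rightarrow> 'b::euclidean_space \<Rightarrow> 'b"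
  assumes "open S" "\<And>x. x \<in> S \<Longrightarrow> linear (L x)" "\<And>x. x \<in> S \<Longrightarrow> inj (L x)"
    and "\<And>e. smooth_on S (\<lambda>x. L x e)" "smooth_on S m" "\<And>x. x \<in> S \<Longrightarrow> L x (h x) = m x"
  shows "smooth_on S h"
  unfolding smooth_on_def
  using ck_on_linear_solve[OF assms(1-3) smooth_onD[OF assms(4)] smooth_onD[OF assms(5)] assms(6)] by blast

lemma smooth_on_linear_expand:
  fixes f' :: "'a::real_normed_vector \<Rightarrow> 'b::euclidean_space \<Rightarrow> 'c::real_normed_vector"
  assumes "open S" "\<And>x. x \<in> S \<Longrightarrow> linear (f' x)" "smooth_on S g"
    and "\<And>b. b \<in> Basis \<Longrightarrow> smooth_on S (\<lambda>x. f' x b)"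
  shows "smooth_on S (\<lambda>x. f' x (g x))"
  unfolding smooth_on_def
  using ck_on_linear_expand[OF assms(1,2) smooth_onD[OF assms(3)] smooth_onD[OF assms(4)]] by blast

text \<open>
  The derivative \<open>P\<close> of the inverse map \<open>g\<close> at \<open>y\<close> solves \<open>D f (g y) (P v) = v\<close>, a linear system
  whose coefficients are as smooth as \<open>g\<close>. So \<open>g\<close> is once more differentiable than already known.
  Openness of the image is invariance of domain.
\<close>

lemma smooth_inverse:
  fixes f :: "'a::euclidean_space \<Rightarrow> 'a"
  assumes U: "open U" and f: "smooth_on U f" and inj: "inj_on f U"
    and injD: "\<And>x. x \<in> U \<Longrightarrow> inj (frechet_derivative f (at x))"
  shows "open (f ` U)" "smooth_on (f ` U) (inv_into U f)"
proof -
  show op: "open (f ` U)" using invariance_of_domain[OF smooth_on_continuous[OF f] U inj] .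
  define g where "g = inv_into U f"
  have gU: "g y \<in> U" "f (g y) = y" if "y \<in> f ` U" for y
    using that by (auto simp: g_def inv_into_into f_inv_into_f)
  have cg: "continuous_on (f ` U) g"
    unfolding g_def
    by (rule continuous_on_inverse_open[OF U smooth_on_continuous[OF f]]) (use inj in auto)
  have der: "\<exists>P. (g has_derivative P) (at y) \<and> (\<forall>v. frechet_derivative f (at (g y)) (P v) = v)"
    if y: "y \<in> f ` U" for y
  proof -
    have Df: "(f has_derivative frechet_derivative f (at (g y))) (at (g y))"
      using smooth_has_derivative[OF f gU(1)[OF y]] .
    obtain P where P: "bounded_linear P" "\<And>v. P (frechet_derivative f (at (g y)) v) = v"
      "\<And>v. frechet_derivative f (at (g y)) (P v) = v"
      using linear_inj_left_inverse[OF has_derivative_linear[OF Df] injD[OF gU(1)[OF y]]] by blast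
    have "(g has_derivative P) (at y)"
      by (rule has_derivative_inverse_basic[OF Df P(1) _ _ op y gU(2)])
        (use P(2) y in \<open>auto simp: fun_eq_iff cg[unfolded continuous_on_eq_continuous_at[OF op]]\<close>)
    then show ?thesis using P by blast
  qed
  have Dg: "(g has_derivative frechet_derivative g (at y)) (at y)" if "y \<in> f ` U" for y
    using der[OF that] frechet_derivative_at by metis
  have sol: "frechet_derivative f (at (g y)) (frechet_derivative g (at y) v) = v" if "y \<in> f ` U" for y v
    using der[OF that] frechet_derivative_at by metis
  have "ck_on k (f ` U) g" for k
  proof (induction k)
    case 0
    then show ?case using cg by simp
  next
    case (Suc k)
    show ?case
    proof (rule ck_on_SucI[OF op Dg])
      fix v
      show "ck_on k (f ` U) (\<lambda>y. frechet_derivative g (at y) v)"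
      proof (rule ck_on_linear_solve[OF op, where L="\<lambda>y. frechet_derivative f (at (g y))" and m="\<lambda>y. v"])
        show "linear (frechet_derivative f (at (g y)))" "inj (frechet_derivative f (at (g y)))"
          if "y \<in> f ` U" for y
          using has_derivative_linear[OF smooth_has_derivative[OF f]] injD gU(1)[OF that] by auto
        show "ck_on k (f ` U) (\<lambda>y. frechet_derivative f (at (g y)) e)" for e
          using ck_on_compose[OF op U gU(1) smooth_onD[OF smooth_frechet[OF f]] Suc] .
      qed (use sol in auto)
    qed
  qed
  then show "smooth_on (f ` U) (inv_into U f)" by (simp add: smooth_on_def g_def)
qed

text \<open>
  The hypotheses of \<open>smooth_inverse\<close> hold on a small ball: local injectivity is the inverse
  function theorem, and injectivity of the derivative is an open condition.
\<close>

lemma smooth_local_diffeo: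
  fixes f :: "'a::euclidean_space \<Rightarrow> 'a"
  assumes U: "open U" and f: "smooth_on U f" and a: "a \<in> U"
    and injD: "inj (frechet_derivative f (at a))"
  obtains r where "r > 0" "ball a r \<subseteq> U" "inj_on f (ball a r)"
    "\<And>x. x \<in> ball a r \<Longrightarrow> inj (frechet_derivative f (at x))"
proof -
  note Df = smooth_has_derivative[OF f]
  note lin = has_derivative_linear[OF Df]
  define N where "N x = (\<Sum>b\<in>Basis. norm (frechet_derivative f (at x) b - frechet_derivative f (at a) b))" for x
  have "continuous_on U N" unfolding N_def
    by (intro continuous_intros smooth_on_continuous[OF smooth_frechet[OF f]])
  then have cN: "isCont N a" using U a continuous_on_eq_continuous_at by auto
  have small: "\<exists>d>0. \<forall>x. dist a x < d \<longrightarrow> x \<in> U \<and> N x < e" if "e > 0" for e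
  proof -
    have "\<forall>\<^sub>F x in nhds a. N x < e \<and> x \<in> U"
      using cN that U a unfolding isCont_def
      by (intro eventually_conj order_tendstoD(2)[of N "N a"])
        (auto simp: N_def eventually_nhds_in_open tendsto_nhds_iff[of N])
    then show ?thesis by (auto simp: eventually_nhds_metric dist_commute)
  qed
  have lsub: "linear (\<lambda>v. frechet_derivative f (at x) v - frechet_derivative f (at a) v)" if "x \<in> U" for x
    using lin[OF that] lin[OF a] by (rule linear_compose_sub)
  have on: "onorm (\<lambda>v. frechet_derivative f (at x) v - frechet_derivative f (at a) v) \<le> N x" if "x \<in> U" for x
    using linear_norm_le_sum_Basis[OF lsub[OF that]] by (intro onorm_le) (auto simp: N_def)
  obtain P where P: "bounded_linear P" "\<And>v. P (frechet_derivative f (at a) v) = v"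
    by (rule linear_inj_left_inverse[OF lin[OF a] injD]) blast
  obtain r where r: "r > 0" "ball a r \<subseteq> U" "inj_on f (ball a r)"
  proof (rule has_derivative_locally_injective[OF a U P(1), of "\<lambda>x. frechet_derivative f (at x)" f])
    show "P \<circ> frechet_derivative f (at a) = id" using P(2) by auto
    show "(f has_derivative frechet_derivative f (at x)) (at x)" if "x \<in> U" for x using Df[OF that] .
    show "\<exists>d>0. \<forall>x. dist a x < d \<longrightarrow> onorm (\<lambda>v. frechet_derivative f (at x) v - frechet_derivative f (at a) v) < e"
      if "e > 0" for e using small[OF that] on by (meson le_less_trans)
  qed
  obtain B where B: "B > 0" "\<And>v. B * norm v \<le> norm (frechet_derivative f (at a) v)"
    using linear_inj_bounded_below_pos[OF lin[OF a] injD] by blast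
  obtain d where d: "d > 0" "\<And>x. dist a x < d \<Longrightarrow> x \<in> U \<and> N x < B" using small[OF B(1)] by blast
  have "inj (frechet_derivative f (at x))" if "dist a x < d" for x
  proof -
    have x: "x \<in> U" "N x < B" using d(2)[OF that] by auto
    have "v = 0" if v: "frechet_derivative f (at x) v = 0" for v
    proof (rule ccontr)
      assume "v \<noteq> 0"
      have "B * norm v \<le> N x * norm v"
        using B(2)[of v] linear_norm_le_sum_Basis[OF lsub[OF x(1)], of v] v by (simp add: N_def)
      then show False using x(2) \<open>v \<noteq> 0\<close> by simp
    qed
    then show ?thesis using linear_injective_0[OF lin[OF x(1)]] by blast
  qed
  then show ?thesis using r d(1) by (intro that[of "min r d"]) (auto intro: inj_on_subset)
qed

section \<open>Smooth cut-off functions\<close>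

lemma ck_on_inverse_real: "ck_on k (- {0::real}) inverse"
proof (induction k)
  case 0
  then show ?case by (auto intro!: continuous_intros)
next
  case (Suc k)
  have o: "open (- {0::real})" by auto
  show ?case
  proof (rule ck_on_SucI[OF o])
    show "(inverse has_derivative (\<lambda>v. - (inverse x * v * inverse x))) (at x)" if "x \<in> - {0}" for x :: real
      using that by (auto intro!: derivative_eq_intros)
    show "ck_on k (- {0}) (\<lambda>x. - (inverse x * v * inverse x))" for v :: real
      by (intro ck_on_minus ck_on_mult Suc ck_on_const o)
  qed
qed

lemma smooth_on_inverse [smooth_intros]:
  fixes f :: "'a::real_normed_vector \<Rightarrow> real"
  assumes "open S" "smooth_on S f" "\<And>x. x \<in> S \<Longrightarrow> f x \<noteq> 0"
  shows "smooth_on S (\<lambda>x. inverse (f x))"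
  by (rule smooth_on_compose[of "- {0}"]) (use assms ck_on_inverse_real in \<open>auto simp: smooth_on_def\<close>)

lemma smooth_on_divide [smooth_intros]:
  fixes f g :: "'a::real_normed_vector \<Rightarrow> real"
  assumes "open S" "smooth_on S f" "smooth_on S g" "\<And>x. x \<in> S \<Longrightarrow> g x \<noteq> 0"
  shows "smooth_on S (\<lambda>x. f x / g x)"
  unfolding divide_inverse by (intro smooth_intros assms)

lemma smooth_on_ln [smooth_intros]:
  fixes f :: "'a::real_normed_vector \<Rightarrow> real"
  assumes "open S" "smooth_on S f" "\<And>x. x \<in> S \<Longrightarrow> f x > 0"
  shows "smooth_on S (\<lambda>x. ln (f x))"
proof -
  have "smooth_on {0<..} (ln :: real \<Rightarrow> real)"
  proof (rule smooth_onI_frechet[where f'="\<lambda>x v. v * inverse x"])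
    show "(ln has_derivative (\<lambda>v. v * inverse x)) (at x)" if "x \<in> {0<..}" for x :: real
      using that by (auto intro!: derivative_eq_intros simp: divide_inverse)
    show "smooth_on {0<..} (\<lambda>x. v * inverse x)" for v :: real
      by (intro smooth_intros) auto
  qed auto
  then show ?thesis by (rule smooth_on_compose) (use assms in auto)
qed

text \<open>
  The factor \<open>inverse t ^ n\<close> makes the family stable under differentiation, so that all members are
  shown to be smooth at once; \<open>flat 0\<close> is the function of interest.
\<close>

definition flat :: "nat \<Rightarrow> real \<Rightarrow> real" where
  "flat n t = (if t > 0 then inverse t ^ n * exp (- inverse t) else 0)"

lemma flat_tendsto_0: "(flat n \<longlongrightarrow> 0) (at 0)"
proof -
  have "((\<lambda>x::real. x ^ n / exp x) \<longlongrightarrow> 0) at_top" by (rule tendsto_power_div_exp_0)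
  from filterlim_compose[OF this filterlim_inverse_at_top_right]
  have "((\<lambda>t::real. inverse t ^ n / exp (inverse t)) \<longlongrightarrow> 0) (at_right 0)" .
  then have R: "(flat n \<longlongrightarrow> 0) (at_right 0)"
    by (rule Lim_transform_eventually)
      (auto simp: flat_def exp_minus divide_inverse eventually_at_filter)
  have L: "(flat n \<longlongrightarrow> 0) (at_left 0)"
    by (rule tendsto_eventually) (auto simp: flat_def eventually_at_filter)
  have "(flat n \<longlongrightarrow> 0) (at 0)" using filterlim_split_at[OF L R] .
  then show "(flat n \<longlongrightarrow> 0) (at 0)" .
qed

lemma flat_has_derivative:
  "(flat n has_real_derivative (flat (n + 2) t - real n * flat (n + 1) t)) (at t)"
proof -
  consider "t > 0" | "t < 0" | "t = 0" by linarith
  then show ?thesis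
  proof cases
    case 1
    have "((\<lambda>t. inverse t ^ n * exp (- inverse t)) has_real_derivative
        (flat (n + 2) t - real n * flat (n + 1) t)) (at t)"
    proof -
      have "((\<lambda>t. inverse t) has_real_derivative - (inverse t ^ 2)) (at t)"
        using 1 by (auto intro!: derivative_eq_intros simp: power2_eq_square)
      then have "((\<lambda>t. inverse t ^ n * exp (- inverse t)) has_real_derivative
          inverse t ^ n * (exp (- inverse t) * inverse t ^ 2) +
          (real n * (- (inverse t ^ 2) * inverse t ^ (n - Suc 0))) * exp (- inverse t)) (at t)"
        using 1 by (intro DERIV_mult' DERIV_power) (auto intro!: derivative_eq_intros simp: power2_eq_square)
      then show ?thesis
        by (rule DERIV_cong) (use 1 in \<open>cases n; auto simp: flat_def power2_eq_square algebra_simps\<close>)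
    qed
    then show ?thesis
      by (rule has_field_derivative_transform_within_open[where S="{0<..}"]) (use 1 in \<open>auto simp: flat_def\<close>)
  next
    case 2
    have "((\<lambda>t. 0) has_real_derivative (flat (n + 2) t - real n * flat (n + 1) t)) (at t)"
      using 2 by (auto simp: flat_def)
    then show ?thesis
      by (rule has_field_derivative_transform_within_open[where S="{..<0}"]) (use 2 in \<open>auto simp: flat_def\<close>)
  next
    case 3
    have "((\<lambda>h. flat n h / h) \<longlongrightarrow> 0) (at 0)"
      by (rule Lim_transform_eventually[OF flat_tendsto_0[of "n + 1"]])
        (auto simp: flat_def divide_inverse eventually_at_filter)
    then show ?thesis using 3 by (simp add: DERIV_def flat_def)
  qed
qed

lemma smooth_flat: "smooth_on UNIV (flat n)"
proof -
  have "\<forall>n. ck_on k UNIV (flat n)" for k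
  proof (induction k)
    case 0
    have "isCont (flat n) t" for n t using flat_has_derivative DERIV_isCont by blast
    then show ?case by (simp add: continuous_at_imp_continuous_on)
  next
    case (Suc k)
    have "ck_on (Suc k) UNIV (flat n)" for n
    proof (rule ck_on_SucI)
      show "(flat n has_derivative (\<lambda>v. (flat (n + 2) t - real n * flat (n + 1) t) * v)) (at t)" for t
        using flat_has_derivative has_field_derivative_def by blast
      show "ck_on k UNIV (\<lambda>t. (flat (n + 2) t - real n * flat (n + 1) t) * v)" for v
        by (intro ck_on_mult ck_on_diff ck_on_const) (use Suc in auto)
    qed auto
    then show ?case by blast
  qed
  then show ?thesis by (simp add: smooth_on_def)
qed

definition smooth_step :: "real \<Rightarrow> real" where
  "smooth_step t = flat 0 t / (flat 0 t + flat 0 (1 - t))"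

lemma flat_0_pos: "flat 0 t + flat 0 (1 - t) > 0"
  by (cases "t > 0") (auto simp: flat_def intro: add_pos_nonneg add_nonneg_pos)

lemma smooth_step_nonpos: "t \<le> 0 \<Longrightarrow> smooth_step t = 0"
  and smooth_step_ge_1: "t \<ge> 1 \<Longrightarrow> smooth_step t = 1"
  and smooth_step_nonneg: "0 \<le> smooth_step t"
  and smooth_step_le_1: "smooth_step t \<le> 1"
  using flat_0_pos[of t] by (auto simp: smooth_step_def flat_def divide_simps)

lemma smooth_smooth_step: "smooth_on UNIV smooth_step"
  unfolding smooth_step_def[abs_def]
proof (intro smooth_intros)
  show "smooth_on UNIV (\<lambda>t. flat 0 (1 - t))"
    by (rule smooth_on_compose[OF smooth_flat smooth_on_diff[OF open_UNIV smooth_on_const smooth_on_id]]) auto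
  show "flat 0 t + flat 0 (1 - t) \<noteq> 0" for t using flat_0_pos[of t] by simp
qed (auto simp: smooth_flat)

lemma smooth_on_smooth_step [smooth_intros]:
  "open S \<Longrightarrow> smooth_on S f \<Longrightarrow> smooth_on S (\<lambda>x. smooth_step (f x))"
  by (rule smooth_on_compose[OF smooth_smooth_step]) auto

definition smooth_step' :: "real \<Rightarrow> real" where
  "smooth_step' t = frechet_derivative smooth_step (at t) 1"

lemma smooth_step_has_derivative:
  "(smooth_step has_derivative (\<lambda>v. v * smooth_step' t)) (at t)"
proof -
  have D: "(smooth_step has_derivative frechet_derivative smooth_step (at t)) (at t)"
    using smooth_has_derivative[OF smooth_smooth_step] by simp
  have "frechet_derivative smooth_step (at t) v = v * smooth_step' t" for v
    using linear_cmul[OF has_derivative_linear[OF D], of v 1] by (simp add: smooth_step'_def)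
  then show ?thesis using D by presburger
qed

lemma smooth_step_has_real_derivative:
  "(smooth_step has_real_derivative smooth_step' t) (at t)"
  using smooth_step_has_derivative[of t] by (simp add: has_field_derivative_def mult_commute_abs)

lemma smooth_step'_outside:
  assumes "t \<notin> {0..1}"
  shows "smooth_step' t = 0"
proof -
  have "(smooth_step has_real_derivative 0) (at t)"
  proof (cases "t < 0")
    case True
    show ?thesis
      by (rule has_field_derivative_transform_within_open[where S="{..<0}" and f="\<lambda>_. 0"])
        (use True in \<open>auto simp: smooth_step_nonpos\<close>)
  next
    case False
    show ?thesis
      by (rule has_field_derivative_transform_within_open[where S="{1<..}" and f="\<lambda>_. 1"])
        (use False assms in \<open>auto simp: smooth_step_ge_1\<close>)
  qed
  then show ?thesis using smooth_step_has_real_derivative DERIV_unique by blast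
qed

lemma smooth_on_smooth_step' [smooth_intros]:
  "open S \<Longrightarrow> smooth_on S f \<Longrightarrow> smooth_on S (\<lambda>x. smooth_step' (f x))"
  by (rule smooth_on_compose[of UNIV])
    (auto simp: smooth_step'_def[abs_def] intro: smooth_frechet smooth_smooth_step)

lemma smooth_step'_bounded: obtains B where "B > 0" "\<And>t. \<bar>smooth_step' t\<bar> \<le> B"
proof -
  have "continuous_on {0..1} smooth_step'"
    using smooth_on_continuous[OF smooth_on_smooth_step'[OF open_UNIV smooth_on_id]]
      continuous_on_subset by auto
  then have "bounded (smooth_step' ` {0..1})"
    using compact_continuous_image compact_imp_bounded compact_Icc by blast
  then obtain B where B: "B > 0" "\<And>t. t \<in> {0..1} \<Longrightarrow> norm (smooth_step' t) \<le> B"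
    by (auto simp: bounded_pos)
  then show ?thesis using that[of B] smooth_step'_outside by (metis abs_zero less_imp_le real_norm_def)
qed

lemma norm_diff_le_of_derivative_bound:
  fixes f :: "'a::euclidean_space \<Rightarrow> 'b::real_normed_vector"
  assumes "convex S" "\<And>x. x \<in> S \<Longrightarrow> (f has_derivative f' x) (at x)"
    and "\<And>x v. x \<in> S \<Longrightarrow> norm (f' x v) \<le> C * norm v"
    and "x \<in> S" "y \<in> S"
  shows "norm (f x - f y) \<le> C * norm (x - y)"
  by (rule differentiable_bound[OF assms(1) _ onorm_le assms(4,5)])
    (use assms in \<open>auto intro: has_derivative_at_withinI\<close>)

text \<open>
  A smooth map that is the identity on the ball of radius \<open>r\<close> and takes all values in the ball of
  radius \<open>2 * r\<close>. Composition with it extends a map defined near \<open>0\<close> to the whole space.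
\<close>

definition radial_cutoff :: "real \<Rightarrow> 'a::euclidean_space \<Rightarrow> 'a" where
  "radial_cutoff r x = smooth_step (2 - (x \<bullet> x) / r\<^sup>2) *\<^sub>R x"

lemma smooth_radial_cutoff: "r > 0 \<Longrightarrow> smooth_on UNIV (radial_cutoff r :: 'a::euclidean_space \<Rightarrow> 'a)"
  unfolding radial_cutoff_def[abs_def] by (intro smooth_intros) auto

lemma radial_cutoff_id: "r > 0 \<Longrightarrow> norm x \<le> r \<Longrightarrow> radial_cutoff r x = x"
  using power_mono[of "norm x" r 2]
  by (simp add: radial_cutoff_def smooth_step_ge_1 power2_norm_eq_inner field_simps)

lemma radial_cutoff_norm:
  fixes x :: "'a::euclidean_space"
  assumes "r > 0" shows "norm (radial_cutoff r x) < 2 * r"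
proof (cases "norm x < 2 * r")
  case True
  have "norm (radial_cutoff r x) \<le> 1 * norm x"
    unfolding radial_cutoff_def norm_scaleR
    by (rule mult_right_mono) (use smooth_step_nonneg smooth_step_le_1 in auto)
  then show ?thesis using True by simp
next
  case False
  then have "(2 * r)\<^sup>2 \<le> (norm x)\<^sup>2" using assms by (intro power_mono) auto
  then have "2 * r\<^sup>2 \<le> x \<bullet> x"
    unfolding power2_norm_eq_inner power_mult_distrib by (rule order_trans[rotated]) simp
  then have "2 - (x \<bullet> x) / r\<^sup>2 \<le> 0" using assms
    by (simp add: field_simps)
  then show ?thesis using assms by (simp add: radial_cutoff_def smooth_step_nonpos)
qed

text \<open>
  The Lipschitz constant does not depend on \<open>r\<close>, because \<open>radial_cutoff r\<close> is a rescaling of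
  \<open>radial_cutoff 1\<close>.
\<close>

lemma radial_cutoff_lipschitz:
  obtains C where "C > 0"
    "\<And>r (x::'a::euclidean_space) y. r > 0 \<Longrightarrow> norm (radial_cutoff r x - radial_cutoff r y) \<le> C * norm (x - y)"
proof -
  let ?s = "radial_cutoff 1 :: 'a \<Rightarrow> 'a"
  have sm: "smooth_on UNIV ?s" by (rule smooth_radial_cutoff) simp
  have D: "(?s has_derivative frechet_derivative ?s (at x)) (at x)" for x
    using smooth_has_derivative[OF sm] by simp
  define N where "N x = (\<Sum>b\<in>Basis. norm (frechet_derivative ?s (at x) b))" for x
  have cN: "continuous_on UNIV N" unfolding N_def
    by (intro continuous_intros smooth_on_continuous[OF smooth_frechet[OF sm]])
  have "bounded (N ` cball 0 3)"
    by (intro compact_imp_bounded compact_continuous_image continuous_on_subset[OF cN]) auto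
  then obtain C where C: "C > 0" "\<And>x. x \<in> cball 0 3 \<Longrightarrow> norm (N x) \<le> C"
    by (auto simp: bounded_pos)
  have "N x \<le> C" for x
  proof (cases "norm x \<le> 3")
    case True
    then show ?thesis using C(2)[of x] by simp
  next
    case False
    have "((\<lambda>_. 0) has_derivative (\<lambda>_. 0)) (at x)" by simp
    then have "(?s has_derivative (\<lambda>_. 0)) (at x)"
    proof (rule has_derivative_transform_within_open[of _ _ _ _ "- cball 0 3"])
      fix y :: 'a assume "y \<in> - cball 0 3"
      then have "3\<^sup>2 \<le> (norm y)\<^sup>2" by (intro power_mono) auto
      then show "0 = ?s y" by (simp add: radial_cutoff_def power2_norm_eq_inner smooth_step_nonpos)
    qed (use False in auto)
    then have "frechet_derivative ?s (at x) = (\<lambda>_. 0)" using frechet_derivative_at by metis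
    then show ?thesis using C(1) by (simp add: N_def)
  qed
  then have "norm (frechet_derivative ?s (at x) v) \<le> C * norm v" for x v
    using linear_norm_le_sum_Basis[OF has_derivative_linear[OF D], of x v]
      mult_right_mono[of "N x" C "norm v"] unfolding N_def by force
  then have L: "norm (?s x - ?s y) \<le> C * norm (x - y)" for x y
    by (intro norm_diff_le_of_derivative_bound[OF convex_UNIV D]) auto
  have "norm (radial_cutoff r x - radial_cutoff r y) \<le> C * norm (x - y)" if "r > 0" for r and x y :: 'a
  proof -
    have eq: "radial_cutoff r x = r *\<^sub>R ?s ((1 / r) *\<^sub>R x)" for x :: 'a
      using that by (simp add: radial_cutoff_def power2_eq_square)
    have "norm (radial_cutoff r x - radial_cutoff r y) = r * norm (?s ((1 / r) *\<^sub>R x) - ?s ((1 / r) *\<^sub>R y))"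
      unfolding eq using that by (simp flip: scaleR_diff_right)
    also have "\<dots> \<le> r * (C * norm ((1 / r) *\<^sub>R x - (1 / r) *\<^sub>R y))"
      using that by (intro mult_left_mono L) auto
    also have "\<dots> = C * norm (x - y)" using that by (simp flip: scaleR_diff_right)
    finally show ?thesis .
  qed
  then show ?thesis using that C(1) by blast
qed

text \<open>
  A function of \<open>ln (norm z)\<close> that changes slowly has gradient of size \<open>\<eta> / norm z\<close> for small \<open>\<eta>\<close>.
  It decreases from 1 to 0 over the annulus between \<open>r\<close> and \<open>R\<close>, which is possible if \<open>R / r\<close> is
  exponentially large in \<open>1 / \<eta>\<close>.
\<close>

lemma log_cutoff:
  fixes R \<eta> :: real
  assumes "R > 0" "\<eta> > 0"
  obtains \<psi> :: "'a::euclidean_space \<Rightarrow> real" and r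
  where "0 < r" "r < R" "smooth_on UNIV \<psi>" "\<And>z. norm z \<le> r \<Longrightarrow> \<psi> z = 1"
    "\<And>z. norm z \<ge> R \<Longrightarrow> \<psi> z = 0" "\<And>z. 0 \<le> \<psi> z" "\<And>z. \<psi> z \<le> 1"
    "\<And>z v. \<bar>frechet_derivative \<psi> (at z) v\<bar> * norm z \<le> \<eta> * norm v"
proof -
  obtain B where B: "B > 0" "\<And>t. \<bar>smooth_step' t\<bar> \<le> B" by (rule smooth_step'_bounded) blast
  define \<delta> where "\<delta> = \<eta> / (2 * B)"
  have \<delta>: "\<delta> > 0" using B assms by (simp add: \<delta>_def)
  \<comment> \<open>With this \<open>r\<close> the argument \<open>g\<close> of the step function is 1 at \<open>norm z = r\<close> and 0 at
    \<open>norm z = R\<close>.\<close>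
  define r where "r = R * exp (- (1 / (2 * \<delta>)))"
  have r: "0 < r" "r < R" using assms(1) \<delta> by (auto simp: r_def mult_less_cancel_left1)
  define g :: "'a \<Rightarrow> real" where "g z = 1 - \<delta> * ln ((z \<bullet> z) / r\<^sup>2)" for z
  define \<psi> where "\<psi> z = smooth_step (g z)" for z
  have one: "\<psi> z = 1" if "norm z \<le> r" for z
  proof (cases "z = 0")
    case False
    have "(norm z)\<^sup>2 \<le> r\<^sup>2" using that by (intro power_mono) auto
    then have "ln ((z \<bullet> z) / r\<^sup>2) \<le> 0" using False r
      by (subst ln_le_zero_iff) (auto simp: power2_norm_eq_inner divide_simps)
    then show ?thesis using \<delta> by (simp add: \<psi>_def g_def smooth_step_ge_1 mult_le_0_iff)
  qed (simp add: \<psi>_def g_def smooth_step_ge_1)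
  have zero: "\<psi> z = 0" if "norm z \<ge> R" for z
  proof -
    have "R\<^sup>2 \<le> (norm z)\<^sup>2" using that assms(1) by (intro power_mono) auto
    then have "R\<^sup>2 / r\<^sup>2 \<le> (z \<bullet> z) / r\<^sup>2" by (simp add: power2_norm_eq_inner divide_right_mono)
    moreover have "R\<^sup>2 / r\<^sup>2 = exp (1 / \<delta>)"
      using assms(1) \<delta> by (simp add: r_def power_mult_distrib exp_minus power2_eq_square field_simps flip: exp_add)
    ultimately have "1 / \<delta> \<le> ln ((z \<bullet> z) / r\<^sup>2)" by (metis exp_gt_zero ln_exp ln_le_cancel_iff order_less_le_trans)
    then show ?thesis using \<delta> by (simp add: \<psi>_def g_def smooth_step_nonpos field_simps)
  qed
  have sg: "smooth_on (- {0}) g" unfolding g_def[abs_def] using r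
    by (intro smooth_intros) (auto simp: zero_less_divide_iff)
  have "smooth_on UNIV \<psi>"
  proof (rule smooth_on_local)
    fix z :: 'a
    show "\<exists>T. open T \<and> z \<in> T \<and> smooth_on T \<psi>"
    proof (cases "z = 0")
      case True
      have "smooth_on (ball 0 r) \<psi>"
        by (rule smooth_on_cong[where f="\<lambda>_. 1"]) (use one in auto)
      then show ?thesis using True r by (intro exI[of _ "ball 0 r"]) auto
    next
      case False
      have "smooth_on (- {0}) \<psi>" unfolding \<psi>_def[abs_def] by (intro smooth_intros sg) auto
      then show ?thesis using False by (intro exI[of _ "- {0}"]) auto
    qed
  qed
  moreover have "\<bar>frechet_derivative \<psi> (at z) v\<bar> * norm z \<le> \<eta> * norm v" for z v
  proof (cases "z = 0")
    case True
    then show ?thesis using assms by simp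
  next
    case False
    have "(g has_derivative (\<lambda>v. - (\<delta> * (2 * (z \<bullet> v) / (z \<bullet> z))))) (at z)"
      unfolding g_def[abs_def] using False r
      by (auto intro!: derivative_eq_intros simp: inner_commute field_simps)
    from has_derivative_compose[OF this smooth_step_has_derivative]
    have "frechet_derivative \<psi> (at z) v = - (\<delta> * (2 * (z \<bullet> v) / (z \<bullet> z))) * smooth_step' (g z)"
      unfolding \<psi>_def[abs_def] by (metis frechet_derivative_at)
    then have "\<bar>frechet_derivative \<psi> (at z) v\<bar> * norm z = 2 * \<delta> * \<bar>smooth_step' (g z)\<bar> * (\<bar>z \<bullet> v\<bar> / norm z)"
      using \<delta> False by (simp add: abs_mult power2_norm_eq_inner[symmetric] power2_eq_square)
    also have "\<dots> \<le> 2 * \<delta> * B * norm v"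
    proof (rule mult_mono)
      show "\<bar>z \<bullet> v\<bar> / norm z \<le> norm v"
        using Cauchy_Schwarz_ineq2[of z v] False by (simp add: divide_simps mult.commute)
    qed (use B \<delta> in auto)
    finally show ?thesis using B by (simp add: \<delta>_def)
  qed
  ultimately show ?thesis
    using that[of r \<psi>] r one zero smooth_step_nonneg smooth_step_le_1 unfolding \<psi>_def by blast
qed

section \<open>Integral equations depending smoothly on a parameter\<close>

lemma continuous_zero_at_ends:
  fixes g :: "real \<Rightarrow> 'f::real_normed_vector"
  assumes "continuous_on UNIV g" "\<And>s. s \<notin> {0..1} \<Longrightarrow> g s = 0"
  shows "g 0 = 0" "g 1 = 0"
proof -
  have l: "(g \<longlongrightarrow> g s) (at s within T)" for s T
    by (rule Lim_at_imp_Lim_at_within)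
      (use assms(1) in \<open>simp add: continuous_on_eq_continuous_at isCont_def\<close>)
  have "(g \<longlongrightarrow> 0) (at_left 0)"
    by (rule tendsto_eventually) (use assms(2) in \<open>auto simp: eventually_at_filter\<close>)
  moreover have "(g \<longlongrightarrow> 0) (at_right 1)"
    by (rule tendsto_eventually) (use assms(2) in \<open>auto simp: eventually_at_filter\<close>)
  ultimately show "g 0 = 0" "g 1 = 0"
    using tendsto_unique[OF trivial_limit_at_left_real l[of 0]]
      tendsto_unique[OF trivial_limit_at_right_real l[of 1]] by auto
qed

text \<open>
  For negative \<open>t\<close> the integral over the empty set \<open>{0..t}\<close> is 0, and so is \<open>g\<close>; by continuity \<open>g\<close>
  vanishes at 0, too. Hence the formula holds for all real \<open>t\<close>.
\<close>

lemma primitive_has_vector_derivative: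
  fixes g :: "real \<Rightarrow> 'f::euclidean_space"
  assumes "continuous_on UNIV g" "\<And>s. s \<notin> {0..1} \<Longrightarrow> g s = 0"
  shows "((\<lambda>t. integral {0..t} g) has_vector_derivative g t) (at t)"
proof -
  define a where "a = min 0 t - 1"
  have c: "continuous_on S g" for S using assms(1) continuous_on_subset by blast
  have "((\<lambda>u. integral {a..u} g) has_vector_derivative g t) (at t within {a..t+1})"
    by (rule integral_has_vector_derivative[OF c]) (auto simp: a_def)
  then have "((\<lambda>u. integral {a..u} g) has_vector_derivative g t) (at t within {a<..<t+1})"
    by (rule has_vector_derivative_within_subset) auto
  then have D: "((\<lambda>u. integral {a..u} g) has_vector_derivative g t) (at t)"
    by (subst (asm) at_within_open) (auto simp: a_def)
  have zero: "integral {a..u} g = 0" if "u \<le> 0" for u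
  proof -
    have g0: "g 0 = 0"
      by (rule continuous_zero_at_ends[OF assms])
    have "integral {a..u} g = integral {a..u} (\<lambda>_. 0)"
    proof (rule integral_cong)
      show "g x = 0" if "x \<in> {a..u}" for x
        using that \<open>u \<le> 0\<close> assms(2)[of x] g0 by (cases "x = 0") auto
    qed
    then show ?thesis by simp
  qed
  have eq: "integral {a..u} g = integral {0..u} g" for u
  proof (cases "u < 0")
    case True
    then show ?thesis using zero[of u] by simp
  next
    case False
    have "integral {a..0} g + integral {0..u} g = integral {a..u} g"
      by (rule Henstock_Kurzweil_Integration.integral_combine)
        (use False c in \<open>auto simp: a_def intro: integrable_continuous_real\<close>)
    then show ?thesis using zero[of 0] by simp
  qed
  show ?thesis using D unfolding eq .
qed

lemma primitive_after_1:
  fixes g :: "real \<Rightarrow> 'f::euclidean_space"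
  assumes "continuous_on UNIV g" "\<And>s. s \<notin> {0..1} \<Longrightarrow> g s = 0" "1 \<le> t"
  shows "integral {0..t} g = integral {0..1} g"
proof -
  have "\<exists>c. \<forall>s\<in>{1..t}. integral {0..s} g = c"
  proof (rule has_vector_derivative_zero_constant[of "{1..t}", THEN exE])
    show "((\<lambda>t. integral {0..t} g) has_vector_derivative 0) (at s within {1..t})" if "s \<in> {1..t}" for s
    proof -
      have "g s = 0"
        using that assms(2)[of s] continuous_zero_at_ends[OF assms(1,2)] by (cases "s = 1") auto
      then show ?thesis
        using primitive_has_vector_derivative[OF assms(1,2), of s] has_vector_derivative_at_within by metis
    qed
  qed auto
  then show ?thesis using assms(3) by auto
qed

lemma primitive_bound:
  fixes g :: "real \<Rightarrow> 'f::euclidean_space"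
  assumes "continuous_on UNIV g" "\<And>s. s \<notin> {0..1} \<Longrightarrow> g s = 0"
    and "\<And>s. s \<in> {0..1} \<Longrightarrow> norm (g s) \<le> B"
  shows "norm (integral {0..t} g) \<le> B"
proof -
  have B: "0 \<le> B" using order_trans[OF norm_ge_zero assms(3)[of 0]] by simp
  have c: "continuous_on S g" for S using assms(1) continuous_on_subset by blast
  have *: "norm (integral {0..t} g) \<le> B" if "t \<in> {0..1}" for t
  proof -
    have "norm (integral {0..t} g) \<le> B * (t - 0)"
      by (rule integral_bound[OF _ c]) (use that assms(3) in auto)
    also have "\<dots> \<le> B" using that B mult_left_le[of t B] by simp
    finally show ?thesis .
  qed
  show ?thesis
    using * B primitive_after_1[OF assms(1,2), of t] by (cases "t \<in> {0..1}"; cases "t < 0") auto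
qed

text \<open>
  Gronwall's estimate for a contraction: at a maximum of \<open>norm (w t)\<close> on the unit interval the
  hypothesis gives \<open>norm (w t) \<le> K + 3/4 * norm (w t)\<close>. The constant 3/4 exceeds the Lipschitz
  constant 1/2 of the equations below, which leaves room for error terms.
\<close>

lemma integral_equation_bound:
  fixes g w :: "real \<Rightarrow> 'f::euclidean_space"
  assumes g: "continuous_on UNIV g" "\<And>s. s \<notin> {0..1} \<Longrightarrow> g s = 0"
    and w: "\<And>t. w t = integral {0..t} g"
    and K: "\<And>s. s \<in> {0..1} \<Longrightarrow> norm (g s) \<le> K + 3/4 * norm (w s)"
  shows "norm (w t) \<le> 4 * K"
proof -
  have "(w has_vector_derivative g t) (at t)" for t
    using primitive_has_vector_derivative[OF g, of t] by (simp add: w[abs_def] w)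
  then have "continuous_on {0..1} (\<lambda>t. norm (w t))"
    using has_vector_derivative_continuous by (intro continuous_at_imp_continuous_on continuous_intros) blast
  then obtain s where s: "s \<in> {0..1}" "\<And>t. t \<in> {0..1} \<Longrightarrow> norm (w t) \<le> norm (w s)"
    using continuous_attains_sup[of "{0..1::real}" "\<lambda>t. norm (w t)"] by auto
  have b: "norm (w t) \<le> K + 3/4 * norm (w s)" for t
    unfolding w[of t] by (rule primitive_bound[OF g]) (use K s(2) in force)+
  from b[of s] b[of t] show ?thesis by simp
qed

text \<open>
  The equation \<open>u (t, x) = integral {0..t} (\<lambda>s. f (s, x, u (s, x)))\<close>, with parameter \<open>x\<close>. Since \<open>f\<close>
  vanishes for times outside the unit interval, the solution is constant there and the equation
  makes sense for all real times; this avoids one-sided derivatives at the ends. The Lipschitz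
  constant 1/2 makes the right-hand side a contraction for the supremum norm.
\<close>

locale integral_equation =
  fixes U :: "'e::euclidean_space set" and f :: "real \<times> 'e \<times> 'f::euclidean_space \<Rightarrow> 'f"
  assumes open_U: "open U"
    and cont_f: "continuous_on (UNIV \<times> U \<times> UNIV) f"
    and lip_f: "\<And>t x u u'. x \<in> U \<Longrightarrow> norm (f (t, x, u) - f (t, x, u')) \<le> 1/2 * norm (u - u')"
    and zero_f: "\<And>t x u. x \<in> U \<Longrightarrow> t \<notin> {0..1} \<Longrightarrow> f (t, x, u) = 0"
begin

lemma cont_along: "x \<in> U \<Longrightarrow> continuous_on UNIV w \<Longrightarrow> continuous_on UNIV (\<lambda>s. f (s, x, w s))"
  by (rule continuous_on_compose2[OF cont_f])
    (auto intro: continuous_on_Pair[OF continuous_on_id continuous_on_Pair[OF continuous_on_const]])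

text \<open>
  Banach's fixed point theorem in the space of bounded continuous functions on the real line.
\<close>

lemma solution_at:
  assumes x: "x \<in> U"
  shows "\<exists>w. continuous_on UNIV w \<and> (\<forall>t. w t = integral {0..t} (\<lambda>s. f (s, x, w s)))"
proof -
  define T where "T w = Bcontfun (\<lambda>t. integral {0..t} (\<lambda>s. f (s, x, apply_bcontfun w s)))" for w
  have c: "continuous_on UNIV (\<lambda>s. f (s, x, apply_bcontfun w s))" for w
    by (rule cont_along[OF x]) simp
  note z = zero_f[OF x]
  have T: "apply_bcontfun (T w) t = integral {0..t} (\<lambda>s. f (s, x, apply_bcontfun w s))" for w t
  proof -
    have "continuous_on UNIV (\<lambda>t. integral {0..t} (\<lambda>s. f (s, x, apply_bcontfun w s)))"
      using primitive_has_vector_derivative[OF c[of w] z] has_vector_derivative_continuous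
      by (intro continuous_at_imp_continuous_on) blast
    moreover have "bounded ((\<lambda>s. f (s, x, apply_bcontfun w s)) ` {0..1})"
      by (intro compact_imp_bounded compact_continuous_image continuous_on_subset[OF c]) auto
    then obtain B where "\<And>s. s \<in> {0..1} \<Longrightarrow> norm (f (s, x, apply_bcontfun w s)) \<le> B"
      unfolding bounded_iff by blast
    from primitive_bound[OF c z this]
    have "norm (integral {0..t} (\<lambda>s. f (s, x, apply_bcontfun w s))) \<le> B" for t .
    ultimately have "(\<lambda>t. integral {0..t} (\<lambda>s. f (s, x, apply_bcontfun w s))) \<in> bcontfun"
      by (rule bcontfun_normI)
    then show ?thesis by (simp add: T_def Bcontfun_inverse)
  qed
  have "dist (T w) (T w') \<le> 1/2 * dist w w'" for w w'
  proof (rule dist_bound)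
    fix t
    let ?h = "\<lambda>s. f (s, x, apply_bcontfun w s) - f (s, x, apply_bcontfun w' s)"
    have "norm (integral {0..t} ?h) \<le> 1/2 * dist w w'"
    proof (rule primitive_bound)
      show "continuous_on UNIV ?h" by (intro continuous_intros c)
      show "norm (?h s) \<le> 1/2 * dist w w'" for s
        using lip_f[OF x, of s "apply_bcontfun w s" "apply_bcontfun w' s"] dist_bounded[of w s w']
        by (simp add: dist_norm)
    qed (simp add: z)
    moreover have "integral {0..t} ?h = T w t - T w' t"
      unfolding T by (intro Henstock_Kurzweil_Integration.integral_diff integrable_continuous_real continuous_on_subset[OF c]) auto
    ultimately show "dist (T w t) (T w' t) \<le> 1/2 * dist w w'" by (simp add: dist_norm)
  qed
  then obtain w where "T w = w" using banach_fix_type[of "1/2" T] by auto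
  show ?thesis
  proof (intro exI conjI allI)
    show "apply_bcontfun w t = integral {0..t} (\<lambda>s. f (s, x, apply_bcontfun w s))" for t
      using T[of w t] unfolding \<open>T w = w\<close> .
  qed simp
qed

lemma difference_integral:
  assumes "x \<in> U" "x' \<in> U" "continuous_on UNIV w" "continuous_on UNIV w'"
    and "w t = integral {0..t} (\<lambda>s. f (s, x, w s))" "w' t = integral {0..t} (\<lambda>s. f (s, x', w' s))"
  shows "w t - w' t = integral {0..t} (\<lambda>s. f (s, x, w s) - f (s, x', w' s))"
  unfolding assms(5,6)
  by (intro Henstock_Kurzweil_Integration.integral_diff[symmetric] integrable_continuous_real
      continuous_on_subset[OF cont_along] assms) auto

lemma solution_unique:
  assumes x: "x \<in> U" and c: "continuous_on UNIV w" "continuous_on UNIV w'"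
    and "\<And>t. w t = integral {0..t} (\<lambda>s. f (s, x, w s))" "\<And>t. w' t = integral {0..t} (\<lambda>s. f (s, x, w' s))"
  shows "w t = w' t"
proof -
  have "norm (w t - w' t) \<le> 4 * 0"
  proof (rule integral_equation_bound)
    show "w t - w' t = integral {0..t} (\<lambda>s. f (s, x, w s) - f (s, x, w' s))" for t
      by (rule difference_integral[OF x x c assms(4,5)])
    show "norm (f (s, x, w s) - f (s, x, w' s)) \<le> 0 + 3/4 * norm (w s - w' s)" for s
      using lip_f[OF x, of s "w s" "w' s"] norm_ge_zero[of "w s - w' s"] by linarith
    show "continuous_on UNIV (\<lambda>s. f (s, x, w s) - f (s, x, w' s))"
      by (intro continuous_on_diff cont_along x c)
    show "f (s, x, w s) - f (s, x, w' s) = 0" if "s \<notin> {0..1}" for s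
      by (simp add: zero_f[OF x that])
  qed
  then show ?thesis by simp
qed

text \<open>
  Continuity in the parameter: two solutions differ by at most four times the difference of the
  right-hand sides along one of them, by \<open>integral_equation_bound\<close>.
\<close>

lemma solution_exists:
  obtains u where "continuous_on (UNIV \<times> U) u"
    "\<And>t x. x \<in> U \<Longrightarrow> u (t, x) = integral {0..t} (\<lambda>s. f (s, x, u (s, x)))"
proof -
  obtain v where v: "\<And>x. x \<in> U \<Longrightarrow> continuous_on UNIV (v x)"
    "\<And>x t. x \<in> U \<Longrightarrow> v x t = integral {0..t} (\<lambda>s. f (s, x, v x s))"
    using solution_at by metis
  define u where "u = (\<lambda>(t, x). v x t)"
  have "isCont u (t0, x0)" if x0: "x0 \<in> U" for t0 x0
  proof -
    have "\<exists>d>0. \<forall>p. dist p (t0, x0) < d \<longrightarrow> dist (u p) (u (t0, x0)) < e" if e: "e > 0" for e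
    proof -
      have "continuous_on (U \<times> {0..1}) (\<lambda>(x, s). f (s, x, v x0 s))"
        unfolding split_def
        by (rule continuous_on_compose2[OF cont_f])
          (auto intro!: continuous_on_Pair continuous_on_snd continuous_on_fst continuous_on_id continuous_on_compose2[OF v(1)[OF x0]])
      from continuous_on_prod_compactE[OF this compact_Icc x0, of "e/16"] e
      obtain X0 where X0: "x0 \<in> X0" "open X0"
        "\<And>x s. x \<in> X0 \<inter> U \<Longrightarrow> s \<in> {0..1} \<Longrightarrow> dist (f (s, x, v x0 s)) (f (s, x0, v x0 s)) \<le> e/16"
        by (metis (no_types, lifting) case_prod_conv divide_pos_pos zero_less_numeral)
      have 1: "norm (v x t - v x0 t) \<le> 4 * (e/16)" if x: "x \<in> X0 \<inter> U" for x t
      proof -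
        have xU: "x \<in> U" using x by simp
        show ?thesis
        proof (rule integral_equation_bound)
        show "v x t - v x0 t = integral {0..t} (\<lambda>s. f (s, x, v x s) - f (s, x0, v x0 s))" for t
          by (rule difference_integral[OF xU x0 v(1)[OF xU] v(1)[OF x0] v(2)[OF xU] v(2)[OF x0]])
        show "norm (f (s, x, v x s) - f (s, x0, v x0 s)) \<le> e/16 + 3/4 * norm (v x s - v x0 s)"
          if "s \<in> {0..1}" for s
          using X0(3)[OF x that] lip_f[OF xU, of s "v x s" "v x0 s"] norm_ge_zero[of "v x s - v x0 s"]
            norm_triangle_ineq[of "f (s, x, v x s) - f (s, x, v x0 s)" "f (s, x, v x0 s) - f (s, x0, v x0 s)"]
          unfolding dist_norm diff_add_cancel add_diff_eq by linarith
        show "continuous_on UNIV (\<lambda>s. f (s, x, v x s) - f (s, x0, v x0 s))"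
          by (intro continuous_on_diff cont_along xU x0 v(1))
        show "f (s, x, v x s) - f (s, x0, v x0 s) = 0" if "s \<notin> {0..1}" for s
          by (simp add: zero_f[OF xU that] zero_f[OF x0 that])
        qed
      qed
      have "isCont (v x0) t0" using v(1)[OF x0] by (simp add: continuous_on_eq_continuous_at)
      then obtain d1 where d1: "d1 > 0" "\<And>t. dist t t0 < d1 \<Longrightarrow> dist (v x0 t) (v x0 t0) < e/2"
        using e unfolding continuous_at_eps_delta by (metis half_gt_zero)
      obtain d2 where d2: "d2 > 0" "ball x0 d2 \<subseteq> X0 \<inter> U"
        using open_contains_ball X0(1,2) open_U x0 by (metis IntI open_Int)
      have "dist (u p) (u (t0, x0)) < e" if p: "dist p (t0, x0) < min d1 d2" for p
      proof -
        obtain t x where tx: "p = (t, x)" by force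
        have "dist t t0 < d1" "dist x x0 < d2"
          using p dist_fst_le[of p "(t0,x0)"] dist_snd_le[of p "(t0,x0)"] by (auto simp: tx)
        then have "x \<in> ball x0 d2" "dist (v x0 t) (v x0 t0) < e/2"
          by (simp add: dist_commute, intro d1(2))
        then have "x \<in> X0 \<inter> U" "dist (v x0 t) (v x0 t0) < e/2" using d2(2) by auto
        with 1[of x t] show ?thesis
          using norm_triangle_ineq[of "v x t - v x0 t" "v x0 t - v x0 t0"] e
          by (simp add: u_def tx dist_norm)
      qed
      then show ?thesis using d1(1) d2(1) by (intro exI[of _ "min d1 d2"]) auto
    qed
    then show ?thesis unfolding continuous_at_eps_delta by blast
  qed
  then have "continuous_on (UNIV \<times> U) u" by (intro continuous_at_imp_continuous_on) auto
  moreover have "u (t, x) = integral {0..t} (\<lambda>s. f (s, x, u (s, x)))" if "x \<in> U" for t x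
    unfolding u_def prod.case by (rule v(2)[OF that])
  ultimately show ?thesis by (rule that)
qed

end

text \<open>
  The remainder of a differentiable map is uniformly small along the compact curve \<open>P\<close>, since the
  derivative is uniformly continuous there.
\<close>

lemma uniform_linearization:
  fixes f :: "'a::euclidean_space \<Rightarrow> 'b::real_normed_vector" and P :: "real \<Rightarrow> 'a"
  assumes D: "open D" and f: "ck_on (Suc 0) D f" and P: "continuous_on {0..1} P" "P ` {0..1} \<subseteq> D"
    and e: "e > 0"
  obtains d where "d > 0" "\<And>s q. s \<in> {0..1} \<Longrightarrow> norm (q - P s) < d \<Longrightarrow>
     norm (f q - f (P s) - frechet_derivative f (at (P s)) (q - P s)) \<le> e * norm (q - P s)"
proof -
  have "compact (P ` {0..1})" by (intro compact_continuous_image P) simp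
  from compact_subset_open_imp_ball_epsilon_subset[OF this D P(2)]
  obtain r where r: "r > 0" "\<And>s. s \<in> {0..1} \<Longrightarrow> ball (P s) r \<subseteq> D"
    by (metis UN_subset_iff image_eqI)
  note Df = ck_on_has_derivative[OF f]
  define N where "N q s = (\<Sum>b\<in>Basis. norm (frechet_derivative f (at (P s + q)) b - frechet_derivative f (at (P s)) b))" for q s
  have cD: "continuous_on D (\<lambda>x. frechet_derivative f (at x) b)" for b using f by simp
  have "continuous_on (ball 0 r \<times> {0..1}) (\<lambda>(q, s). N q s)"
    unfolding N_def split_def
    by (intro continuous_intros continuous_on_compose2[OF cD] continuous_on_compose2[OF P(1)])
      (use r P(2) in \<open>auto simp: subset_iff image_subset_iff dist_norm\<close>)
  from continuous_on_prod_compactE[OF this compact_Icc _ e, of 0] r(1)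
  obtain X where X: "0 \<in> X" "open X" "\<And>q s. q \<in> X \<inter> ball 0 r \<Longrightarrow> s \<in> {0..1} \<Longrightarrow> dist (N q s) (N 0 s) \<le> e"
    by (metis (no_types, lifting) case_prod_conv centre_in_ball)
  obtain d where d: "d > 0" "ball 0 d \<subseteq> X \<inter> ball 0 r"
    using X(1,2) r(1) open_contains_ball by (metis IntI centre_in_ball open_Int open_ball)
  have "norm (f q - f (P s) - frechet_derivative f (at (P s)) (q - P s)) \<le> e * norm (q - P s)"
    if s: "s \<in> {0..1}" and q: "norm (q - P s) < d" for s q
  proof -
    let ?L = "frechet_derivative f (at (P s))"
    have PD: "P s \<in> D" using s P(2) by blast
    have L: "linear ?L" "bounded_linear ?L"
      using Df[OF PD] has_derivative_linear has_derivative_bounded_linear by auto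
    have xD: "x \<in> D" if "x \<in> ball (P s) d" for x
    proof -
      have "x - P s \<in> ball 0 d" using that by (simp add: dist_norm norm_minus_commute)
      then show ?thesis using d(2) r(2)[OF s] by (auto simp: dist_norm subset_iff norm_minus_commute)
    qed
    have "norm ((f q - ?L q) - (f (P s) - ?L (P s))) \<le> e * norm (q - P s)"
    proof (rule norm_diff_le_of_derivative_bound)
      show "convex (ball (P s) d)" by simp
      show "((\<lambda>x. f x - ?L x) has_derivative (\<lambda>v. frechet_derivative f (at x) v - ?L v)) (at x)"
        if "x \<in> ball (P s) d" for x
        by (intro has_derivative_diff Df xD that bounded_linear_imp_has_derivative L)
      show "norm (frechet_derivative f (at x) v - ?L v) \<le> e * norm v" if x: "x \<in> ball (P s) d" for x v
      proof -
        have l: "linear (\<lambda>v. frechet_derivative f (at x) v - ?L v)"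
          by (intro linear_compose_sub L has_derivative_linear[OF Df[OF xD[OF x]]])
        have "x - P s \<in> X \<inter> ball 0 r" using x d(2) by (auto simp: dist_norm norm_minus_commute subset_iff)
        from X(3)[OF this s] have "(\<Sum>b\<in>Basis. norm (frechet_derivative f (at x) b - ?L b)) \<le> e"
          by (simp add: N_def dist_norm)
        with linear_norm_le_sum_Basis[OF l, of v] show ?thesis
          by (meson mult_right_mono norm_ge_zero order_trans)
      qed
    qed (use q d(1) in \<open>auto simp: dist_norm norm_minus_commute\<close>)
    then show ?thesis using L(1) by (simp add: linear_diff algebra_simps)
  qed
  then show ?thesis using that d(1) by blast
qed

lemma has_derivativeI_eps:
  fixes g :: "'a::real_normed_vector \<Rightarrow> 'b::real_normed_vector"
  assumes "bounded_linear g'"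
    and "\<And>e. e > 0 \<Longrightarrow> \<exists>d>0. \<forall>x. norm (x - a) < d \<longrightarrow> norm (g x - g a - g' (x - a)) \<le> e * norm (x - a)"
  shows "(g has_derivative g') (at a)"
  unfolding has_derivative_at_alt using assms by auto

lemma has_derivative_norm_le:
  assumes "(f has_derivative f') (at p)"
    and "\<And>h. norm (f (p + h *\<^sub>R d) - f p) \<le> C * \<bar>h\<bar>"
  shows "norm (f' d) \<le> C"
proof -
  have "((\<lambda>h. f (p + h *\<^sub>R d)) has_derivative (\<lambda>h. f' (h *\<^sub>R d))) (at 0)"
    by (rule has_derivative_compose[of "\<lambda>h. p + h *\<^sub>R d" "\<lambda>h. h *\<^sub>R d" 0 UNIV f f'])
      (use assms(1) in \<open>auto intro!: derivative_eq_intros\<close>)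
  then have "((\<lambda>h. f (p + h *\<^sub>R d)) has_vector_derivative f' d) (at 0)"
    by (simp add: has_vector_derivative_def linear_cmul[OF has_derivative_linear[OF assms(1)]])
  then have lim: "((\<lambda>h. norm (f (p + h *\<^sub>R d) - f p - h *\<^sub>R f' d) / norm h) \<longlongrightarrow> 0) (at 0)"
    by (simp add: has_vector_derivative_def has_derivative_at)
  show ?thesis
  proof (rule field_le_epsilon)
    fix e :: real assume "e > 0"
    from order_tendstoD(2)[OF lim this]
    have "\<forall>\<^sub>F h in at 0. h \<noteq> 0 \<and> norm (f (p + h *\<^sub>R d) - f p - h *\<^sub>R f' d) / norm h < e"
      by (auto simp: eventually_at_filter elim: eventually_mono)
    then obtain h :: real where h: "h \<noteq> 0" "norm (f (p + h *\<^sub>R d) - f p - h *\<^sub>R f' d) / norm h < e"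
      using eventually_happens'[OF at_neq_bot] by blast
    have "norm (h *\<^sub>R f' d) \<le> norm (f (p + h *\<^sub>R d) - f p) + norm (f (p + h *\<^sub>R d) - f p - h *\<^sub>R f' d)"
      by (metis norm_triangle_sub norm_minus_commute)
    also have "\<dots> \<le> C * \<bar>h\<bar> + e * \<bar>h\<bar>"
      using h assms(2)[of h] by (intro add_mono) (auto simp: divide_simps)
    finally show "norm (f' d) \<le> C + e" using h(1) by (simp add: distrib_right[symmetric] mult.commute)
  qed
qed

context integral_equation
begin

lemma open_domain: "open (UNIV \<times> U \<times> (UNIV :: 'f set))" "open ((UNIV :: real set) \<times> U)"
  by (auto intro!: open_Times open_U)

text \<open>
  The equation satisfied by the derivative of \<open>u\<close> in the direction \<open>v\<close> of the parameter space.
\<close>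

definition linearized :: "(real \<times> 'e \<Rightarrow> 'f) \<Rightarrow> 'e \<Rightarrow> real \<times> 'e \<times> 'f \<Rightarrow> 'f" where
  "linearized u v = (\<lambda>(s, x, w). frechet_derivative f (at (s, x, u (s, x))) (0, v, w))"

context
  assumes f1: "ck_on (Suc 0) (UNIV \<times> U \<times> UNIV) f"
begin

lemma f_has_derivative:
  "x \<in> U \<Longrightarrow> (f has_derivative frechet_derivative f (at (s, x, w))) (at (s, x, w))"
  using ck_on_has_derivative[OF f1] by simp

lemma linear_Df: "x \<in> U \<Longrightarrow> linear (frechet_derivative f (at (s, x, w)))"
  using f_has_derivative has_derivative_linear by blast

lemma Df_vertical_bound:
  assumes x: "x \<in> U"
  shows "norm (frechet_derivative f (at (s, x, w)) (0, 0, w')) \<le> 1/2 * norm w'"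
proof (rule has_derivative_norm_le[OF f_has_derivative[OF x]])
  show "norm (f ((s, x, w) + h *\<^sub>R (0, 0, w')) - f (s, x, w)) \<le> 1 / 2 * norm w' * \<bar>h\<bar>" for h
    using lip_f[OF x, of s "w + h *\<^sub>R w'" w] by (simp add: mult.commute)
qed

lemma Df_outside:
  assumes x: "x \<in> U" and s: "s \<notin> {0..1}"
  shows "frechet_derivative f (at (s, x, w)) d = 0"
proof -
  have "((\<lambda>_. 0) has_derivative (\<lambda>_. 0)) (at (s, x, w))" by simp
  then have "(f has_derivative (\<lambda>_. 0)) (at (s, x, w))"
  proof (rule has_derivative_transform_within_open[of _ _ _ _ "(- {0..1}) \<times> U \<times> UNIV"])
    show "open ((- {0..1::real}) \<times> U \<times> (UNIV :: 'f set))" by (auto intro!: open_Times open_U)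
  qed (use x s zero_f in auto)
  then show ?thesis using frechet_derivative_at by metis
qed

lemma linearized_ck:
  assumes "ck_on (Suc k) (UNIV \<times> U \<times> UNIV) f" "ck_on k (UNIV \<times> U) u"
  shows "ck_on k (UNIV \<times> U \<times> UNIV) (linearized u v)"
  unfolding linearized_def split_def
proof (rule ck_on_linear_expand[OF open_domain(1),
    where f'="\<lambda>p. frechet_derivative f (at (fst p, fst (snd p), u (fst p, fst (snd p))))" and g="\<lambda>p. (0, v, snd (snd p))"])
  let ?D = "UNIV \<times> U \<times> (UNIV :: 'f set)"
  have i: "ck_on k ?D (\<lambda>p. p)" by (rule ck_on_id[OF open_domain(1)])
  note c = ck_on_fst[OF open_domain(1)] ck_on_snd[OF open_domain(1)]
  have 1: "ck_on k ?D (\<lambda>p. fst p)" "ck_on k ?D (\<lambda>p. fst (snd p))" "ck_on k ?D (\<lambda>p. snd (snd p))"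
    by (rule c(1)[OF i] c(1)[OF c(2)[OF i]] c(2)[OF c(2)[OF i]])+
  show "linear (frechet_derivative f (at (fst p, fst (snd p), u (fst p, fst (snd p)))))" if "p \<in> ?D" for p
    using that by (auto intro!: linear_Df)
  show "ck_on k ?D (\<lambda>p. (0, v, snd (snd p)))"
    by (intro ck_on_Pair open_domain ck_on_const 1)
  have 2: "ck_on k ?D (\<lambda>p. u (fst p, fst (snd p)))"
    by (rule ck_on_compose[OF open_domain(1,2) _ assms(2)]) (auto intro!: ck_on_Pair open_domain 1)
  show "ck_on k ?D (\<lambda>p. frechet_derivative f (at (fst p, fst (snd p), u (fst p, fst (snd p)))) b)" for b
  proof (rule ck_on_compose[OF open_domain(1,1)])
    show "ck_on k ?D (\<lambda>p. frechet_derivative f (at p) b)" using assms(1) unfolding ck_on.simps by blast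
    show "ck_on k ?D (\<lambda>p. (fst p, fst (snd p), u (fst p, fst (snd p))))"
      by (intro ck_on_Pair open_domain 1 2)
  qed auto
qed

text \<open>
  The vertical derivative of a map with Lipschitz constant 1/2 has norm at most 1/2, so the
  linearized equation is again of the type considered and its solution exists.
\<close>

lemma linearized_equation:
  assumes "continuous_on (UNIV \<times> U) u"
  shows "integral_equation U (linearized u v)"
proof
  show "open U" by (rule open_U)
  show "continuous_on (UNIV \<times> U \<times> UNIV) (linearized u v)"
    using linearized_ck[OF f1, of u v] assms by simp
  show "linearized u v (t, x, w) = 0" if "x \<in> U" "t \<notin> {0..1}" for t x w
    using Df_outside[OF that] by (simp add: linearized_def)
  show "norm (linearized u v (t, x, w) - linearized u v (t, x, w')) \<le> 1/2 * norm (w - w')"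
    if "x \<in> U" for t x w w'
    using Df_vertical_bound[OF that, of t "u (t, x)" "w - w'"]
      linear_diff[OF linear_Df[OF that], of t "u (t, x)" "(0, v, w)" "(0, v, w')"]
    by (simp add: linearized_def)
qed

text \<open>
  The candidate \<open>Y v\<close> for the derivative in the direction \<open>v\<close> solves the linearized equation. The
  error \<open>u (t, x) - u (t, x0) - Y (x - x0) (t, x0)\<close> satisfies the hypothesis of
  \<open>integral_equation_bound\<close> with \<open>K\<close> of the size of \<open>e * norm (x - x0)\<close>: the Lipschitz constant
  contributes 1/2, the linearization error 1/4.
\<close>

lemma solution_has_derivative:
  assumes u: "continuous_on (UNIV \<times> U) u"
    and eq: "\<And>t x. x \<in> U \<Longrightarrow> u (t, x) = integral {0..t} (\<lambda>s. f (s, x, u (s, x)))"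
  obtains Y where "\<And>v. continuous_on (UNIV \<times> U) (Y v)"
    and "\<And>v t x. x \<in> U \<Longrightarrow> Y v (t, x) = integral {0..t} (\<lambda>s. linearized u v (s, x, Y v (s, x)))"
    and "\<And>t x. x \<in> U \<Longrightarrow> (u has_derivative (\<lambda>(\<tau>, v). \<tau> *\<^sub>R f (t, x, u (t, x)) + Y v (t, x))) (at (t, x))"
proof -
  note le = linearized_equation[OF u]
  have "\<exists>Y. continuous_on (UNIV \<times> U) Y \<and>
      (\<forall>t. \<forall>x\<in>U. Y (t, x) = integral {0..t} (\<lambda>s. linearized u v (s, x, Y (s, x))))" for v
    by (rule integral_equation.solution_exists[OF le[of v]]) blast
  then have "\<exists>Y. \<forall>v. continuous_on (UNIV \<times> U) (Y v) \<and>
      (\<forall>t. \<forall>x\<in>U. Y v (t, x) = integral {0..t} (\<lambda>s. linearized u v (s, x, Y v (s, x))))"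
    by (intro choice allI)
  then obtain Y where Yc: "\<And>v. continuous_on (UNIV \<times> U) (Y v)"
    and Ye: "\<And>v t x. x \<in> U \<Longrightarrow> Y v (t, x) = integral {0..t} (\<lambda>s. linearized u v (s, x, Y v (s, x)))"
    by blast
  have cu: "continuous_on S (\<lambda>s. u (s, x))" if "x \<in> U" for x S
    by (rule continuous_on_compose2[OF u]) (use that in \<open>auto intro: continuous_on_Pair continuous_on_id continuous_on_const\<close>)
  have cY: "continuous_on S (\<lambda>s. Y v (s, x))" if "x \<in> U" for x v S
    by (rule continuous_on_compose2[OF Yc]) (use that in \<open>auto intro: continuous_on_Pair continuous_on_id continuous_on_const\<close>)
  have clin: "continuous_on S (\<lambda>s. linearized u v (s, x, Y v (s, x)))" if "x \<in> U" for x v S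
    using integral_equation.cont_along[OF le that cY[OF that]] continuous_on_subset by blast
  have linY: "linear (\<lambda>v. Y v (t, x))" if x: "x \<in> U" for t x
  proof (rule linearI)
    note unique = integral_equation.solution_unique[OF le x _ cY[OF x] _ Ye[OF x]]
    show "Y (v + v') (t, x) = Y v (t, x) + Y v' (t, x)" for v v'
    proof (rule unique[symmetric])
      show "continuous_on UNIV (\<lambda>t. Y v (t, x) + Y v' (t, x))" by (intro continuous_on_add cY x)
      fix t
      have "Y v (t, x) + Y v' (t, x) =
          integral {0..t} (\<lambda>s. linearized u v (s, x, Y v (s, x)) + linearized u v' (s, x, Y v' (s, x)))"
        unfolding Ye[OF x, of v t] Ye[OF x, of v' t]
        by (rule Henstock_Kurzweil_Integration.integral_add[symmetric]) (rule integrable_continuous_real[OF clin[OF x]])+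
      also have "\<dots> = integral {0..t} (\<lambda>s. linearized u (v + v') (s, x, Y v (s, x) + Y v' (s, x)))"
      proof (rule integral_cong)
        show "linearized u v (s, x, Y v (s, x)) + linearized u v' (s, x, Y v' (s, x)) =
          linearized u (v + v') (s, x, Y v (s, x) + Y v' (s, x))" for s
        unfolding linearized_def using linear_add[OF linear_Df[OF x], of s "u (s, x)" "(0, v, Y v (s, x))" "(0, v', Y v' (s, x))"] by simp
      qed
      finally show "Y v (t, x) + Y v' (t, x) =
          integral {0..t} (\<lambda>s. linearized u (v + v') (s, x, Y v (s, x) + Y v' (s, x)))" .
    qed
    show "Y (c *\<^sub>R v) (t, x) = c *\<^sub>R Y v (t, x)" for c v
    proof (rule unique[symmetric])
      show "continuous_on UNIV (\<lambda>t. c *\<^sub>R Y v (t, x))" by (intro continuous_on_scaleR continuous_on_const cY x)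
      fix t
      have "c *\<^sub>R Y v (t, x) = integral {0..t} (\<lambda>s. c *\<^sub>R linearized u v (s, x, Y v (s, x)))"
        unfolding Ye[OF x, of v t] by simp
      also have "\<dots> = integral {0..t} (\<lambda>s. linearized u (c *\<^sub>R v) (s, x, c *\<^sub>R Y v (s, x)))"
      proof (rule integral_cong)
        show "c *\<^sub>R linearized u v (s, x, Y v (s, x)) = linearized u (c *\<^sub>R v) (s, x, c *\<^sub>R Y v (s, x))" for s
        unfolding linearized_def using linear_cmul[OF linear_Df[OF x], of s "u (s, x)" c "(0, v, Y v (s, x))"] by simp
      qed
      finally show "c *\<^sub>R Y v (t, x) = integral {0..t} (\<lambda>s. linearized u (c *\<^sub>R v) (s, x, c *\<^sub>R Y v (s, x)))" .
    qed
  qed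
  have space: "((\<lambda>x. u (t, x)) has_derivative (\<lambda>v. Y v (t, x0))) (at x0)" if x0: "x0 \<in> U" for t x0
  proof -
    define P where "P s = (s, x0, u (s, x0))" for s
    define N where "N s = (\<Sum>b\<in>Basis. norm (Y b (s, x0)))" for s
    have "continuous_on {0..1} N" unfolding N_def by (intro continuous_on_sum continuous_on_norm cY x0)
    then have "bounded (N ` {0..1})" by (intro compact_imp_bounded compact_continuous_image) auto
    then obtain C where C: "C > 0" "\<And>s. s \<in> {0..1} \<Longrightarrow> norm (N s) \<le> C" unfolding bounded_pos by blast
    have YC: "norm (Y h (s, x0)) \<le> C * norm h" if "s \<in> {0..1}" for s h
      using linear_norm_le_sum_Basis[OF linY[OF x0], of h s] mult_right_mono[of "N s" C "norm h"] C(2)[OF that]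
      unfolding N_def by force
    show ?thesis
    proof (rule has_derivativeI_eps)
      show "bounded_linear (\<lambda>v. Y v (t, x0))" using linY[OF x0] linear_conv_bounded_linear by blast
      fix e :: real assume e: "e > 0"
      \<comment> \<open>The bound 1/4 is the part of the factor 3/4 left over by the Lipschitz constant; the other
        bound turns \<open>4 * K\<close> into \<open>e\<close>.\<close>
      define \<eta> where "\<eta> = min (1/4) (e / (4 * (1 + C)))"
      have \<eta>: "\<eta> > 0" "\<eta> \<le> 1/4" "4 * (\<eta> * (1 + C)) \<le> e"
      proof -
        show "\<eta> > 0" using e C(1) by (simp add: \<eta>_def)
        show "\<eta> \<le> 1/4" unfolding \<eta>_def by (rule min.cobounded1)
        have "\<eta> \<le> e / (4 * (1 + C))" by (simp add: \<eta>_def)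
        then have "\<eta> * (4 * (1 + C)) \<le> e" using C(1) by (simp add: pos_le_divide_eq)
        then show "4 * (\<eta> * (1 + C)) \<le> e" by (simp add: algebra_simps)
      qed
      obtain d where d: "d > 0" "\<And>s q. s \<in> {0..1} \<Longrightarrow> norm (q - P s) < d \<Longrightarrow>
          norm (f q - f (P s) - frechet_derivative f (at (P s)) (q - P s)) \<le> \<eta> * norm (q - P s)"
      proof (rule uniform_linearization[OF open_domain(1) f1 _ _ \<eta>(1)])
        show "continuous_on {0..1} P" unfolding P_def
          by (intro continuous_on_Pair continuous_on_id continuous_on_const cu x0)
        show "P ` {0..1} \<subseteq> UNIV \<times> U \<times> UNIV" using x0 by (auto simp: P_def)
      qed (rule that)
      have "continuous_on (U \<times> {0..1}) (\<lambda>(x, s). u (s, x))"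
        unfolding split_def by (rule continuous_on_compose2[OF u])
          (auto intro!: continuous_on_Pair continuous_on_fst continuous_on_snd continuous_on_id)
      from continuous_on_prod_compactE[OF this compact_Icc x0, of "d/3"] d(1)
      obtain X where X: "x0 \<in> X" "open X" "\<And>x s. x \<in> X \<inter> U \<Longrightarrow> s \<in> {0..1} \<Longrightarrow> dist (u (s, x)) (u (s, x0)) \<le> d/3"
        by (metis (no_types, lifting) case_prod_conv divide_pos_pos zero_less_numeral)
      obtain r where r: "r > 0" "ball x0 r \<subseteq> X \<inter> U"
        using open_contains_ball X(1,2) open_U x0 by (metis IntI open_Int)
      have main: "norm (u (t, x) - u (t, x0) - Y (x - x0) (t, x0)) \<le> e * norm (x - x0)"
        if x: "norm (x - x0) < min r (d/3)" for x
      proof -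
        define h where "h = x - x0"
        have "x \<in> ball x0 r" using x by (simp add: dist_norm norm_minus_commute)
        then have xX: "x \<in> X \<inter> U" and xU: "x \<in> U" using r by auto
        let ?w = "\<lambda>t. u (t, x) - u (t, x0) - Y h (t, x0)"
        let ?g = "\<lambda>s. f (s, x, u (s, x)) - f (s, x0, u (s, x0)) - linearized u h (s, x0, Y h (s, x0))"
        have cf: "continuous_on S (\<lambda>s. f (s, x, u (s, x)))" if "x \<in> U" for x S
          using continuous_on_subset[OF cont_along[OF that cu[OF that]]] by auto
        have "norm (?w t) \<le> 4 * (\<eta> * (1 + C) * norm h)"
        proof (rule integral_equation_bound)
          show "continuous_on UNIV ?g" by (intro continuous_on_diff cf clin xU x0)
          show "?g s = 0" if "s \<notin> {0..1}" for s
            using zero_f[OF xU that] zero_f[OF x0 that] integral_equation.zero_f[OF le x0 that] by simp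
          show "?w t = integral {0..t} ?g" for t
          proof (rule integral_unique[symmetric], intro has_integral_diff)
            show "((\<lambda>s. f (s, x, u (s, x))) has_integral u (t, x)) {0..t}"
              unfolding eq[OF xU, of t] by (rule integrable_integral[OF integrable_continuous_real[OF cf[OF xU]]])
            show "((\<lambda>s. f (s, x0, u (s, x0))) has_integral u (t, x0)) {0..t}"
              unfolding eq[OF x0, of t] by (rule integrable_integral[OF integrable_continuous_real[OF cf[OF x0]]])
            show "((\<lambda>s. linearized u h (s, x0, Y h (s, x0))) has_integral Y h (t, x0)) {0..t}"
              unfolding Ye[OF x0, of h t] by (rule integrable_integral[OF integrable_continuous_real[OF clin[OF x0]]])
          qed
          fix s :: real assume s: "s \<in> {0..1}"
          let ?q = "(s, x, u (s, x))" and ?d = "u (s, x) - u (s, x0)"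
          have qP: "?q - P s = (0, h, ?d)" by (simp add: P_def h_def)
          have nq: "norm (?q - P s) \<le> norm h + norm ?d"
            unfolding qP using norm_Pair_le[of "0::real" "(h, ?d)"] norm_Pair_le[of h ?d] by simp
          have "norm ?d \<le> d/3" using X(3)[OF xX s] by (simp add: dist_norm)
          then have "norm (?q - P s) < d" using nq x d(1) by (simp add: h_def)
          from d(2)[OF s this] have A: "norm (f ?q - f (P s) - frechet_derivative f (at (P s)) (0, h, ?d)) \<le> \<eta> * norm (?q - P s)"
            unfolding qP .
          have dd: "norm ?d \<le> norm (?w s) + C * norm h"
            using norm_triangle_ineq[of "?w s" "Y h (s, x0)"] YC[OF s, of h] by simp
          have "\<eta> * norm (?q - P s) \<le> \<eta> * (norm h + (norm (?w s) + C * norm h))"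
            using nq dd \<eta>(1) by (intro mult_left_mono) auto
          also have "\<dots> \<le> \<eta> * (1 + C) * norm h + 1/4 * norm (?w s)"
            using mult_right_mono[OF \<eta>(2) norm_ge_zero[of "?w s"]] by (simp add: algebra_simps)
          finally have A': "norm (f ?q - f (P s) - frechet_derivative f (at (P s)) (0, h, ?d)) \<le> \<eta> * (1 + C) * norm h + 1/4 * norm (?w s)"
            using A by linarith
          have B: "norm (frechet_derivative f (at (P s)) (0, 0, ?w s)) \<le> 1/2 * norm (?w s)"
            unfolding P_def by (rule Df_vertical_bound[OF x0])
          have "frechet_derivative f (at (P s)) (0, h, ?d) - frechet_derivative f (at (P s)) (0, h, Y h (s, x0)) =
              frechet_derivative f (at (P s)) (0, 0, ?w s)"
            unfolding P_def using linear_diff[OF linear_Df[OF x0], of s "u (s, x0)" "(0, h, ?d)" "(0, h, Y h (s, x0))"] by simp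
          then have geq: "?g s = (f ?q - f (P s) - frechet_derivative f (at (P s)) (0, h, ?d)) +
              frechet_derivative f (at (P s)) (0, 0, ?w s)"
            by (simp add: linearized_def P_def algebra_simps)
          show "norm (?g s) \<le> \<eta> * (1 + C) * norm h + 3/4 * norm (?w s)"
            unfolding geq using A' B norm_triangle_ineq[of "f ?q - f (P s) - frechet_derivative f (at (P s)) (0, h, ?d)"
              "frechet_derivative f (at (P s)) (0, 0, ?w s)"] by linarith
        qed
        also have "\<dots> \<le> e * norm h" using mult_right_mono[OF \<eta>(3) norm_ge_zero[of h]] by (simp add: mult.assoc)
        finally show ?thesis by (simp add: h_def)
      qed
      show "\<exists>d>0. \<forall>x. norm (x - x0) < d \<longrightarrow> norm (u (t, x) - u (t, x0) - Y (x - x0) (t, x0)) \<le> e * norm (x - x0)"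
        using main r(1) d(1) by (intro exI[of _ "min r (d/3)"]) auto
    qed
  qed
  have "(u has_derivative (\<lambda>(\<tau>, v). \<tau> *\<^sub>R f (t, x, u (t, x)) + Y v (t, x))) (at (t, x))" if x: "x \<in> U" for t x
  proof -
    obtain r where r: "r > 0" "ball x r \<subseteq> U" using open_U x open_contains_ball by blast
    define Z where "Z t y = Blinfun (\<lambda>v. Y v (t, y))" for t y
    have Z: "blinfun_apply (Z t y) = (\<lambda>v. Y v (t, y))" if "y \<in> U" for t y
      unfolding Z_def using linY[OF that] linear_conv_bounded_linear bounded_linear_Blinfun_apply by blast
    have "((\<lambda>(t, y). u (t, y)) has_derivative (\<lambda>(\<tau>, v). \<tau> *\<^sub>R f (t, x, u (t, x)) + Z t x v)) (at (t, x) within UNIV \<times> ball x r)"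
    proof (rule has_derivative_partialsI)
      have "(\<lambda>t. u (t, x)) = (\<lambda>t. integral {0..t} (\<lambda>s. f (s, x, u (s, x))))" using eq[OF x] by blast
      then have "((\<lambda>t. u (t, x)) has_vector_derivative f (t, x, u (t, x))) (at t)"
        using primitive_has_vector_derivative[OF cont_along[OF x cu[OF x]] zero_f[OF x]] by simp
      then show "((\<lambda>t. u (t, x)) has_derivative (\<lambda>\<tau>. \<tau> *\<^sub>R f (t, x, u (t, x)))) (at t)"
        by (simp add: has_vector_derivative_def)
      show "((\<lambda>y. u (t', y)) has_derivative blinfun_apply (Z t' y)) (at y within ball x r)"
        if "y \<in> ball x r" for t' y
        using has_derivative_at_withinI[OF space] Z r(2) that by auto
      show "continuous (at (t, x) within UNIV \<times> ball x r) (\<lambda>(t, y). Z t y)"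
      proof (rule continuous_blinfun_componentwiseI1)
        fix b :: 'e
        have "continuous (at (t, x) within UNIV \<times> ball x r) (Y b)"
        proof -
          have "continuous_on (UNIV \<times> ball x r) (Y b)" by (rule continuous_on_subset[OF Yc]) (use r in auto)
          then show ?thesis using r(1) by (simp add: continuous_on_eq_continuous_within)
        qed
        then show "continuous (at (t, x) within UNIV \<times> ball x r) (\<lambda>p. blinfun_apply (case p of (t, y) \<Rightarrow> Z t y) b)"
        proof (rule continuous_transform_within[OF _ zero_less_one])
          show "Y b p = blinfun_apply (case p of (t, y) \<Rightarrow> Z t y) b" if "p \<in> UNIV \<times> ball x r" for p
            using that r(2) Z[of "snd p" "fst p"] by (cases p) auto
        qed (use r(1) in auto)
      qed
    qed (use r in auto)
    then have "(u has_derivative (\<lambda>(\<tau>, v). \<tau> *\<^sub>R f (t, x, u (t, x)) + Y v (t, x))) (at (t, x) within UNIV \<times> ball x r)"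
      unfolding Z[OF x] by simp
    moreover have "at (t, x) within UNIV \<times> ball x r = at (t, x)"
      by (rule at_within_open) (use r(1) in \<open>auto intro!: open_Times\<close>)
    ultimately show ?thesis by simp
  qed
  then show ?thesis using that Yc Ye by blast
qed

end

end

text \<open>
  The derivatives of \<open>u\<close> are given by \<open>f\<close> itself and by solutions of the linearized equation, whose
  right-hand side is one degree less smooth than \<open>f\<close>. So the induction hypothesis applies to it,
  for which \<open>f\<close> and \<open>u\<close> have to be generalized.
\<close>

theorem integral_equation_ck:
  assumes "integral_equation U f" "ck_on (Suc k) (UNIV \<times> U \<times> UNIV) f"
    and "continuous_on (UNIV \<times> U) u"
    and "\<And>t x. x \<in> U \<Longrightarrow> u (t, x) = integral {0..t} (\<lambda>s. f (s, x, u (s, x)))"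
  shows "ck_on (Suc k) (UNIV \<times> U) u"
  using assms
proof (induction k arbitrary: f u)
  case 0
  interpret integral_equation U f by fact
  obtain Y where Y: "\<And>v. continuous_on (UNIV \<times> U) (Y v)"
    "\<And>v t x. x \<in> U \<Longrightarrow> Y v (t, x) = integral {0..t} (\<lambda>s. linearized u v (s, x, Y v (s, x)))"
    "\<And>t x. x \<in> U \<Longrightarrow> (u has_derivative (\<lambda>(\<tau>, v). \<tau> *\<^sub>R f (t, x, u (t, x)) + Y v (t, x))) (at (t, x))"
    by (rule solution_has_derivative[OF 0(2,3,4)]) blast+
  show ?case
  proof (rule ck_on_SucI[OF open_domain(2)])
    show "(u has_derivative (\<lambda>(\<tau>, v). \<tau> *\<^sub>R f (fst p, snd p, u p) + Y v p)) (at p)" if "p \<in> UNIV \<times> U" for p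
      using that Y(3)[of "snd p" "fst p"] by auto
    have "continuous_on (UNIV \<times> U) (\<lambda>p. f (fst p, snd p, u p))"
      by (rule continuous_on_compose2[OF cont_f]) (auto intro!: continuous_on_Pair continuous_on_fst continuous_on_snd continuous_on_id 0)
    then show "ck_on 0 (UNIV \<times> U) (\<lambda>p. case d of (\<tau>, v) \<Rightarrow> \<tau> *\<^sub>R f (fst p, snd p, u p) + Y v p)" for d
      using Y(1) by (cases d) (auto intro!: continuous_on_add continuous_on_scaleR continuous_on_const)
  qed
next
  case (Suc k)
  interpret integral_equation U f by fact
  have f1: "ck_on (Suc 0) (UNIV \<times> U \<times> UNIV) f" using Suc.prems(2) by (rule ck_on_mono) simp
  have fk: "ck_on (Suc k) (UNIV \<times> U \<times> UNIV) f" using Suc.prems(2) by (rule ck_on_Suc_imp)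
  obtain Y where Y: "\<And>v. continuous_on (UNIV \<times> U) (Y v)"
    "\<And>v t x. x \<in> U \<Longrightarrow> Y v (t, x) = integral {0..t} (\<lambda>s. linearized u v (s, x, Y v (s, x)))"
    "\<And>t x. x \<in> U \<Longrightarrow> (u has_derivative (\<lambda>(\<tau>, v). \<tau> *\<^sub>R f (t, x, u (t, x)) + Y v (t, x))) (at (t, x))"
    by (rule solution_has_derivative[OF f1 Suc.prems(3,4)]) blast+
  have uk: "ck_on (Suc k) (UNIV \<times> U) u" by (rule Suc.IH[OF Suc.prems(1) fk Suc.prems(3,4)])
  have Yk: "ck_on (Suc k) (UNIV \<times> U) (Y v)" for v
    by (rule Suc.IH[OF linearized_equation[OF f1 Suc.prems(3)] linearized_ck[OF f1 Suc.prems(2) uk] Y(1,2)])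
  show ?case
  proof (rule ck_on_SucI[OF open_domain(2)])
    show "(u has_derivative (\<lambda>(\<tau>, v). \<tau> *\<^sub>R f (fst p, snd p, u p) + Y v p)) (at p)" if "p \<in> UNIV \<times> U" for p
      using that Y(3)[of "snd p" "fst p"] by auto
    have i: "ck_on (Suc k) ((UNIV :: real set) \<times> U) (\<lambda>p. p)" by (rule ck_on_id[OF open_domain(2)])
    have "ck_on (Suc k) (UNIV \<times> U) (\<lambda>p. f (fst p, snd p, u p))"
      by (rule ck_on_compose[OF open_domain(2,1) _ fk])
        (auto simp del: ck_on.simps intro!: ck_on_Pair open_domain ck_on_fst[OF _ i] ck_on_snd[OF _ i] uk)
    then show "ck_on (Suc k) (UNIV \<times> U) (\<lambda>p. case d of (\<tau>, v) \<Rightarrow> \<tau> *\<^sub>R f (fst p, snd p, u p) + Y v p)" for d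
      using Yk by (cases d) (auto simp del: ck_on.simps intro!: ck_on_add ck_on_scaleR ck_on_const open_domain)
  qed
qed

text \<open>
  The form in which the theory is applied: the solution is smooth in all variables, and its
  derivative with respect to the parameter satisfies the differential equation obtained by
  differentiating the original one.
\<close>

theorem smooth_integral_equation:
  fixes U :: "'e::euclidean_space set" and f :: "real \<times> 'e \<times> 'f::euclidean_space \<Rightarrow> 'f"
  assumes U: "open U" and f: "smooth_on (UNIV \<times> U \<times> UNIV) f"
    and lip: "\<And>t x u u'. x \<in> U \<Longrightarrow> norm (f (t, x, u) - f (t, x, u')) \<le> 1/2 * norm (u - u')"
    and zero: "\<And>t x u. x \<in> U \<Longrightarrow> t \<notin> {0..1} \<Longrightarrow> f (t, x, u) = 0"
  obtains u where "smooth_on (UNIV \<times> U) u"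
    and "\<And>t x. x \<in> U \<Longrightarrow> u (t, x) = integral {0..t} (\<lambda>s. f (s, x, u (s, x)))"
    and "\<And>x. x \<in> U \<Longrightarrow> continuous_on UNIV (\<lambda>s. f (s, x, u (s, x)))"
    and "\<And>t x. x \<in> U \<Longrightarrow> ((\<lambda>t. u (t, x)) has_vector_derivative f (t, x, u (t, x))) (at t)"
    and "\<And>t x v. x \<in> U \<Longrightarrow> ((\<lambda>t. frechet_derivative u (at (t, x)) (0, v)) has_vector_derivative
        frechet_derivative f (at (t, x, u (t, x))) (0, v, frechet_derivative u (at (t, x)) (0, v))) (at t)"
    and "\<And>x v. x \<in> U \<Longrightarrow> frechet_derivative u (at (0, x)) (0, v) = 0"
proof -
  interpret integral_equation U f
    by unfold_locales (use assms smooth_on_continuous in blast)+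
  obtain u where u: "continuous_on (UNIV \<times> U) u"
    "\<And>t x. x \<in> U \<Longrightarrow> u (t, x) = integral {0..t} (\<lambda>s. f (s, x, u (s, x)))"
    by (rule solution_exists) blast
  have sm: "smooth_on (UNIV \<times> U) u"
    unfolding smooth_on_def
    using integral_equation_ck[OF integral_equation_axioms smooth_onD[OF f] u] ck_on_Suc_imp by blast
  note f1 = smooth_onD[OF f, of "Suc 0"]
  obtain Y where Y: "\<And>v. continuous_on (UNIV \<times> U) (Y v)"
    "\<And>v t x. x \<in> U \<Longrightarrow> Y v (t, x) = integral {0..t} (\<lambda>s. linearized u v (s, x, Y v (s, x)))"
    "\<And>t x. x \<in> U \<Longrightarrow> (u has_derivative (\<lambda>(\<tau>, v). \<tau> *\<^sub>R f (t, x, u (t, x)) + Y v (t, x))) (at (t, x))"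
    by (rule solution_has_derivative[OF f1 u]) blast+
  have DY: "frechet_derivative u (at (t, x)) (0, v) = Y v (t, x)" if "x \<in> U" for t x v
    unfolding frechet_derivative_at[OF Y(3)[OF that], symmetric] by simp
  have line: "continuous_on UNIV (\<lambda>s. w (s, x))" if "continuous_on (UNIV \<times> U) w" "x \<in> U" for w :: "real \<times> 'e \<Rightarrow> 'f" and x
    by (rule continuous_on_compose2[OF that(1)])
      (use that(2) in \<open>auto intro: continuous_on_Pair continuous_on_id continuous_on_const\<close>)
  show ?thesis
  proof (rule that[OF sm u(2)])
    show "continuous_on UNIV (\<lambda>s. f (s, x, u (s, x)))" if "x \<in> U" for x
      by (rule cont_along[OF that line[OF u(1) that]])
    show "((\<lambda>t. u (t, x)) has_vector_derivative f (t, x, u (t, x))) (at t)" if x: "x \<in> U" for t x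
    proof -
      have "(\<lambda>t. u (t, x)) = (\<lambda>t. integral {0..t} (\<lambda>s. f (s, x, u (s, x))))" using u(2)[OF x] by blast
      then show ?thesis
        using primitive_has_vector_derivative[OF cont_along[OF x line[OF u(1) x]] zero_f[OF x]] by simp
    qed
    show "((\<lambda>t. frechet_derivative u (at (t, x)) (0, v)) has_vector_derivative
        frechet_derivative f (at (t, x, u (t, x))) (0, v, frechet_derivative u (at (t, x)) (0, v))) (at t)"
      if x: "x \<in> U" for t x v
    proof -
      interpret L: integral_equation U "linearized u v" by (rule linearized_equation[OF f1 u(1)])
      have "(\<lambda>t. Y v (t, x)) = (\<lambda>t. integral {0..t} (\<lambda>s. linearized u v (s, x, Y v (s, x))))"
        using Y(2)[OF x] by blast
      then have "((\<lambda>t. Y v (t, x)) has_vector_derivative linearized u v (t, x, Y v (t, x))) (at t)"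
        using primitive_has_vector_derivative[OF L.cont_along[OF x line[OF Y(1) x]] L.zero_f[OF x]] by simp
      then show ?thesis unfolding DY[OF x] by (simp add: linearized_def)
    qed
    show "frechet_derivative u (at (0, x)) (0, v) = 0" if "x \<in> U" for x v
      unfolding DY[OF that] Y(2)[OF that, of v 0] by simp
  qed
qed

section \<open>The standard symplectic form and Moser's method\<close>

lemma frechet_eq: "(f has_derivative f') (at x) \<Longrightarrow> frechet_derivative f (at x) v = f' v"
  by (drule frechet_derivative_at) simp

lemma linear_complex_expand:
  fixes L :: "complex \<Rightarrow> 'a::real_vector"
  assumes "linear L"
  shows "L \<zeta> = Re \<zeta> *\<^sub>R L 1 + Im \<zeta> *\<^sub>R L \<i>"
proof -
  have "L (Re \<zeta> *\<^sub>R 1 + Im \<zeta> *\<^sub>R \<i>) = Re \<zeta> *\<^sub>R L 1 + Im \<zeta> *\<^sub>R L \<i>"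
    unfolding linear_add[OF assms] linear_cmul[OF assms] ..
  moreover have eq: "Re \<zeta> *\<^sub>R 1 + Im \<zeta> *\<^sub>R \<i> = \<zeta>" by (simp add: complex_eq_iff)
  ultimately show ?thesis unfolding eq by blast
qed

lemma bilinear_linear:
  assumes "bilinear B"
  shows "linear (B x)" "linear (\<lambda>x. B x y)"
  using assms by (auto simp: bilinear_def)

lemma bilinear_expand_Basis:
  fixes B :: "'a::euclidean_space \<Rightarrow> 'b::euclidean_space \<Rightarrow> 'c::real_normed_vector"
  assumes "bilinear B"
  shows "(\<Sum>i\<in>Basis. \<Sum>j\<in>Basis. (x \<bullet> i) *\<^sub>R (y \<bullet> j) *\<^sub>R B i j) = B x y"
proof -
  have "(\<Sum>j\<in>Basis. (x \<bullet> i) *\<^sub>R (y \<bullet> j) *\<^sub>R B i j) = (x \<bullet> i) *\<^sub>R B i y" for i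
    unfolding scaleR_sum_right[symmetric] linear_expand_Basis[OF bilinear_linear(1)[OF assms]] ..
  then show ?thesis
    using linear_expand_Basis[OF bilinear_linear(2)[OF assms]] by simp
qed

lemma smooth_on_bilinear_family:
  fixes B :: "'a::euclidean_space \<Rightarrow> 'b::euclidean_space \<Rightarrow> 'b \<Rightarrow> real" and x :: "'p::real_normed_vector \<Rightarrow> 'a"
  assumes V: "open V" and W: "open W" and bil: "\<And>y. y \<in> V \<Longrightarrow> bilinear (B y)"
    and B: "\<And>i j. smooth_on V (\<lambda>y. B y i j)"
    and sm: "smooth_on W x" "smooth_on W a" "smooth_on W b" and img: "\<And>p. p \<in> W \<Longrightarrow> x p \<in> V"
  shows "smooth_on W (\<lambda>p. B (x p) (a p) (b p))"
proof (rule smooth_on_linear_expand[OF W _ sm(3), where f'="\<lambda>p. B (x p) (a p)"])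
  show "linear (B (x p) (a p))" if "p \<in> W" for p using bilinear_linear(1)[OF bil[OF img[OF that]]] .
  fix j :: 'b
  show "smooth_on W (\<lambda>p. B (x p) (a p) j)"
  proof (rule smooth_on_linear_expand[OF W _ sm(2), where f'="\<lambda>p c. B (x p) c j"])
    show "linear (\<lambda>c. B (x p) c j)" if "p \<in> W" for p using bilinear_linear(2)[OF bil[OF img[OF that]]] .
    show "smooth_on W (\<lambda>p. B (x p) i j)" for i
      by (rule smooth_on_compose[OF B sm(1) W V img])
  qed
qed

text \<open>
  The product rule for \<open>B (x q) (a q) (b q)\<close>, where the bilinear form, too, depends on \<open>q\<close>. It is
  reduced to the entries \<open>B y i j\<close> of the matrix of the form.
\<close>

lemma bilinear_family_has_derivative:
  fixes B :: "'a::euclidean_space \<Rightarrow> 'b::euclidean_space \<Rightarrow> 'b \<Rightarrow> real"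
    and x :: "'p::real_normed_vector \<Rightarrow> 'a"
  assumes V: "open V" and bil: "\<And>y. y \<in> V \<Longrightarrow> bilinear (B y)"
    and B: "\<And>i j. smooth_on V (\<lambda>y. B y i j)" and img: "x p \<in> V"
    and x: "(x has_derivative x') (at p)" and a: "(a has_derivative a') (at p)" and b: "(b has_derivative b') (at p)"
  shows "((\<lambda>q. B (x q) (a q) (b q)) has_derivative
     (\<lambda>v. frechet_derivative (\<lambda>y. B y (a p) (b p)) (at (x p)) (x' v) + B (x p) (a' v) (b p) + B (x p) (a p) (b' v))) (at p)"
proof -
  let ?D = "\<lambda>i j. frechet_derivative (\<lambda>y. B y i j) (at (x p))"
  have DB: "((\<lambda>y. B y i j) has_derivative ?D i j) (at (x p))" for i j
    by (rule smooth_has_derivative[OF B img])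
  have bilD: "(\<Sum>i\<in>Basis. \<Sum>j\<in>Basis. (c \<bullet> i) *\<^sub>R (d \<bullet> j) *\<^sub>R ?D i j w) = ?D c d w" for c d w
  proof -
    have "((\<lambda>y. \<Sum>i\<in>Basis. \<Sum>j\<in>Basis. (c \<bullet> i) *\<^sub>R (d \<bullet> j) *\<^sub>R B y i j) has_derivative
       (\<lambda>w. \<Sum>i\<in>Basis. \<Sum>j\<in>Basis. (c \<bullet> i) *\<^sub>R (d \<bullet> j) *\<^sub>R ?D i j w)) (at (x p))"
      by (intro has_derivative_sum has_derivative_scaleR_right DB)
    then have "((\<lambda>y. B y c d) has_derivative
       (\<lambda>w. \<Sum>i\<in>Basis. \<Sum>j\<in>Basis. (c \<bullet> i) *\<^sub>R (d \<bullet> j) *\<^sub>R ?D i j w)) (at (x p))"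
      by (rule has_derivative_transform_within_open[OF _ V img]) (rule bilinear_expand_Basis[OF bil])
    from frechet_eq[OF this] show ?thesis by simp
  qed

  have "((\<lambda>q. \<Sum>i\<in>Basis. \<Sum>j\<in>Basis. (a q \<bullet> i) *\<^sub>R (b q \<bullet> j) *\<^sub>R B (x q) i j) has_derivative
     (\<lambda>v. \<Sum>i\<in>Basis. \<Sum>j\<in>Basis. (a p \<bullet> i) *\<^sub>R ((b p \<bullet> j) *\<^sub>R ?D i j (x' v) + (b' v \<bullet> j) *\<^sub>R B (x p) i j)
        + (a' v \<bullet> i) *\<^sub>R (b p \<bullet> j) *\<^sub>R B (x p) i j)) (at p)"
    by (intro has_derivative_sum has_derivative_scaleR has_derivative_inner_left a b
        has_derivative_compose[OF x DB])
  also have "(\<lambda>v. \<Sum>i\<in>Basis. \<Sum>j\<in>Basis. (a p \<bullet> i) *\<^sub>R ((b p \<bullet> j) *\<^sub>R ?D i j (x' v) + (b' v \<bullet> j) *\<^sub>R B (x p) i j)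
        + (a' v \<bullet> i) *\<^sub>R (b p \<bullet> j) *\<^sub>R B (x p) i j) =
     (\<lambda>v. ?D (a p) (b p) (x' v) + B (x p) (a' v) (b p) + B (x p) (a p) (b' v))"
    unfolding scaleR_add_right sum.distrib bilD bilinear_expand_Basis[OF bil[OF img]]
    by (simp add: algebra_simps)
  finally have D: "((\<lambda>q. \<Sum>i\<in>Basis. \<Sum>j\<in>Basis. (a q \<bullet> i) *\<^sub>R (b q \<bullet> j) *\<^sub>R B (x q) i j) has_derivative
     (\<lambda>v. ?D (a p) (b p) (x' v) + B (x p) (a' v) (b p) + B (x p) (a p) (b' v))) (at p)" .
  have "isCont x p" using has_derivative_continuous[OF x] .
  then have "\<forall>\<^sub>F q in nhds p. x q \<in> V"
    using V img by (simp add: continuous_at_open eventually_nhds)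
  then obtain N where N: "open N" "p \<in> N" "\<And>q. q \<in> N \<Longrightarrow> x q \<in> V" unfolding eventually_nhds by blast
  show ?thesis
    by (rule has_derivative_transform_within_open[OF D N(1,2)]) (rule bilinear_expand_Basis[OF bil[OF N(3)]])
qed

text \<open>
  This is \<open>(i/2) (dz \<and> d(cnj z) + dw \<and> d(cnj w))\<close>, as
  \<open>(i/2) (z cnj z' - cnj z z') = Im (cnj z z')\<close>.
\<close>

definition std_form :: "complex \<times> complex \<Rightarrow> complex \<times> complex \<Rightarrow> real" where
  "std_form u v = Im (cnj (fst u) * fst v) + Im (cnj (snd u) * snd v)"

lemma bilinear_std_form: "bilinear std_form"
  unfolding bilinear_def std_form_def
  by (auto intro!: linearI simp: algebra_simps)

lemma std_form_alternating: "std_form u u = 0"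
  by (simp add: std_form_def)

lemma norm_prod_square: "(norm (u :: complex \<times> complex))\<^sup>2 = (norm (fst u))\<^sup>2 + (norm (snd u))\<^sup>2"
  by (cases u) (simp add: norm_Pair)

text \<open>
  Multiplication by the imaginary unit is compatible with the form: together they give the
  Euclidean norm. This is how nondegeneracy is detected below.
\<close>

lemma std_form_compatible: "std_form u (\<i> * fst u, \<i> * snd u) = (norm u)\<^sup>2"
  by (simp add: norm_prod_square std_form_def cmod_power2) (simp add: power2_eq_square)

lemma norm_times_i: "norm (\<i> * fst u, \<i> * snd u) = norm (u :: complex \<times> complex)"
  by (cases u) (simp add: norm_Pair norm_mult)

lemma alternating_antisym:
  assumes "bilinear B" "\<And>u. B u u = (0::real)"
  shows "B u v = - B v u"
proof -
  have "B (u + v) (u + v) = 0" by (rule assms)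
  moreover have "B (u + v) (u + v) = B u u + B u v + (B v u + B v v)"
    by (simp add: bilinear_ladd[OF assms(1)] bilinear_radd[OF assms(1)])
  ultimately show ?thesis using assms(2)[of u] assms(2)[of v] by linarith
qed

definition riesz :: "('a::euclidean_space \<Rightarrow> real) \<Rightarrow> 'a" where
  "riesz l = (\<Sum>b\<in>Basis. l b *\<^sub>R b)"

lemma riesz_inner: "linear l \<Longrightarrow> riesz l \<bullet> v = l v"
proof -
  assume l: "linear l"
  have "riesz l \<bullet> v = (\<Sum>b\<in>Basis. (v \<bullet> b) *\<^sub>R l b)"
    unfolding riesz_def inner_sum_left by (rule sum.cong) (simp_all add: inner_commute[of _ v])
  then show ?thesis using linear_expand_Basis[OF l] by simp
qed

lemma linear_riesz: "linear (\<lambda>u. riesz (B u))" if "bilinear B" for B :: "'a::euclidean_space \<Rightarrow> 'a \<Rightarrow> real"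
  unfolding riesz_def using that
  by (auto intro!: linearI simp: bilinear_ladd bilinear_lmul sum.distrib scaleR_sum_right algebra_simps)

text \<open>
  At a maximum of \<open>norm (g t)\<close> the mean value inequality bounds this norm by half of itself.
  Applied to the distance from a plane, this shows that a flow preserves the plane.
\<close>

lemma zero_of_small_derivative:
  fixes g :: "real \<Rightarrow> 'a::real_normed_vector"
  assumes "\<And>t. t \<in> {0..1} \<Longrightarrow> (g has_vector_derivative g' t) (at t)"
    and "\<And>t. t \<in> {0..1} \<Longrightarrow> norm (g' t) \<le> 1/2 * norm (g t)"
    and "c \<in> {0..1}" "g c = 0" "t \<in> {0..1}"
  shows "g t = 0"
proof -
  have "continuous_on {0..1} (\<lambda>t. norm (g t))"
    using assms(1) has_vector_derivative_continuous
    by (intro continuous_on_norm continuous_at_imp_continuous_on) blast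
  then obtain s where s: "s \<in> {0..1}" "\<And>t. t \<in> {0..1} \<Longrightarrow> norm (g t) \<le> norm (g s)"
    using continuous_attains_sup[of "{0..1::real}" "\<lambda>t. norm (g t)"] by auto
  have "norm (g s - g c) \<le> 1/2 * norm (g s) * norm (s - c)"
  proof (rule differentiable_bound[of "{0..1}" g "\<lambda>t h. h *\<^sub>R g' t"])
    show "(g has_derivative (\<lambda>h. h *\<^sub>R g' t)) (at t within {0..1})" if "t \<in> {0..1}" for t
      using assms(1)[OF that] has_derivative_at_withinI by (auto simp: has_vector_derivative_def)
    show "onorm (\<lambda>h. h *\<^sub>R g' t) \<le> 1/2 * norm (g s)" if "t \<in> {0..1}" for t
    proof (rule onorm_le)
      fix h :: real
      have "norm (g' t) \<le> 1/2 * norm (g s)" using assms(2)[OF that] s(2)[OF that] by simp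
      from mult_right_mono[OF this abs_ge_zero[of h]]
      show "norm (h *\<^sub>R g' t) \<le> 1/2 * norm (g s) * norm h" by (simp add: mult.commute)
    qed
  qed (use s assms in auto)
  also have "\<dots> \<le> 1/2 * norm (g s) * 1"
    using s(1) assms(3) by (intro mult_left_mono) auto
  finally show ?thesis using assms(4,5) s(2)[of t] by simp
qed

lemma bilinear_add_scale:
  fixes B C :: "'a::real_vector \<Rightarrow> 'b::real_vector \<Rightarrow> real"
  assumes "bilinear B" "bilinear C"
  shows "bilinear (\<lambda>u v. B u v + c * C u v)"
  unfolding bilinear_def
  by (auto intro!: linearI simp: bilinear_ladd[OF assms(1)] bilinear_radd[OF assms(1)]
      bilinear_lmul[OF assms(1)] bilinear_rmul[OF assms(1)] bilinear_ladd[OF assms(2)]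
      bilinear_radd[OF assms(2)] bilinear_lmul[OF assms(2)] bilinear_rmul[OF assms(2)] algebra_simps)

text \<open>
  A closed 2-form on a ball that is standard at the centre and, along the plane \<open>{z = 0}\<close>, makes
  this plane orthogonal to the directions \<open>(a, 0)\<close>. The last property is what later keeps Moser's
  flow tangent to the plane. Nondegeneracy near \<open>0\<close> follows from the value at \<open>0\<close>.
\<close>

locale normalized_form =
  fixes \<rho> :: real and \<omega> :: "complex \<times> complex \<Rightarrow> complex \<times> complex \<Rightarrow> complex \<times> complex \<Rightarrow> real"
  assumes rho: "\<rho> > 0"
    and bil: "\<And>x. x \<in> ball 0 \<rho> \<Longrightarrow> bilinear (\<omega> x)"
    and alt: "\<And>x u. x \<in> ball 0 \<rho> \<Longrightarrow> \<omega> x u u = 0"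
    and smooth: "\<And>u v. smooth_on (ball 0 \<rho>) (\<lambda>x. \<omega> x u v)"
    and closed: "\<And>x u v w. x \<in> ball 0 \<rho> \<Longrightarrow>
      frechet_derivative (\<lambda>y. \<omega> y v w) (at x) u + frechet_derivative (\<lambda>y. \<omega> y w u) (at x) v
      + frechet_derivative (\<lambda>y. \<omega> y u v) (at x) w = 0"
    and standard_at_0: "\<omega> 0 = std_form"
    and mixed: "\<And>w a b. (0 :: complex, w) \<in> ball 0 \<rho> \<Longrightarrow> \<omega> (0, w) (a, 0) (0, b) = 0"
begin

definition \<sigma> where "\<sigma> x u v = \<omega> x u v - std_form u v"

abbreviation D\<sigma> where "D\<sigma> x u v \<equiv> frechet_derivative (\<lambda>y. \<sigma> y u v) (at x)"

lemma bilinear_sigma: "x \<in> ball 0 \<rho> \<Longrightarrow> bilinear (\<sigma> x)"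
  using bil[of x] bilinear_std_form unfolding bilinear_def \<sigma>_def
  by (auto intro!: linear_compose_sub)

lemma smooth_sigma: "smooth_on (ball 0 \<rho>) (\<lambda>x. \<sigma> x u v)"
  unfolding \<sigma>_def by (intro smooth_intros smooth) auto

lemma sigma_antisym: "x \<in> ball 0 \<rho> \<Longrightarrow> \<sigma> x u v = - \<sigma> x v u"
  by (rule alternating_antisym[OF bilinear_sigma]) (auto simp: \<sigma>_def alt std_form_alternating)

lemma sigma_has_derivative: "x \<in> ball 0 \<rho> \<Longrightarrow> ((\<lambda>y. \<sigma> y u v) has_derivative D\<sigma> x u v) (at x)"
  by (rule smooth_has_derivative[OF smooth_sigma])

lemma Dsigma_linear: "x \<in> ball 0 \<rho> \<Longrightarrow> linear (D\<sigma> x u v)"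
  using sigma_has_derivative has_derivative_linear by blast

lemma Dsigma_antisym: assumes "x \<in> ball 0 \<rho>" shows "D\<sigma> x u v a = - D\<sigma> x v u a"
proof -
  have "((\<lambda>y. \<sigma> y u v) has_derivative (\<lambda>a. - D\<sigma> x v u a)) (at x)"
    by (rule has_derivative_transform_within_open[OF has_derivative_minus[OF sigma_has_derivative[OF assms]] open_ball assms])
      (rule sigma_antisym[symmetric], assumption)
  from frechet_eq[OF this] show ?thesis .
qed

lemma sigma_zero: "x \<in> ball 0 \<rho> \<Longrightarrow> \<sigma> x 0 v = 0" "x \<in> ball 0 \<rho> \<Longrightarrow> \<sigma> x v 0 = 0"
  using bilinear_lzero[OF bilinear_sigma] bilinear_rzero[OF bilinear_sigma] by auto

lemma Dsigma_zero: assumes "x \<in> ball 0 \<rho>" shows "D\<sigma> x 0 v a = 0"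
proof -
  have "((\<lambda>y. \<sigma> y 0 v) has_derivative (\<lambda>a. 0)) (at x)"
    by (rule has_derivative_transform_within_open[OF has_derivative_const open_ball assms])
      (simp add: sigma_zero)
  from frechet_eq[OF this] show ?thesis by simp
qed

lemma closed_sigma:
  assumes "x \<in> ball 0 \<rho>"
  shows "D\<sigma> x v w u + D\<sigma> x w u v + D\<sigma> x u v w = 0"
proof -
  have "D\<sigma> x u v = frechet_derivative (\<lambda>y. \<omega> y u v) (at x)" for u v
  proof -
    have "((\<lambda>y. \<sigma> y u v) has_derivative (\<lambda>a. frechet_derivative (\<lambda>y. \<omega> y u v) (at x) a - 0)) (at x)"
      unfolding \<sigma>_def by (intro has_derivative_diff has_derivative_const smooth_has_derivative[OF smooth assms])
    then have "D\<sigma> x u v a = frechet_derivative (\<lambda>y. \<omega> y u v) (at x) a" for a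
      using frechet_eq by fastforce
    then show ?thesis by (rule ext)
  qed
  then show ?thesis using closed[OF assms] by simp
qed

lemma sigma_0: "\<sigma> 0 u v = 0"
  by (simp add: \<sigma>_def standard_at_0)

lemma sigma_mixed: "(0 :: complex, w) \<in> ball 0 \<rho> \<Longrightarrow> \<sigma> (0, w) (a, 0) (0, b) = 0"
  using mixed[of w a b] by (simp add: \<sigma>_def std_form_def)

lemma step_scale_in_ball: "(x :: complex \<times> complex) \<in> ball 0 \<rho> \<Longrightarrow> smooth_step t *\<^sub>R x \<in> ball 0 \<rho>"
  using mult_right_mono[OF smooth_step_le_1 norm_ge_zero[of x], of t] smooth_step_nonneg[of t] by simp

text \<open>
  The Poincare lemma: the radial primitive is \<open>\<Lambda> x \<bullet> b = \<integral> s \<sigma>(s x)(x, b) ds\<close> over \<open>0 \<le> s \<le> 1\<close>.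
  Along \<open>{z = 0}\<close> both \<open>s x\<close> and \<open>x\<close> lie in that plane, hence \<open>\<Lambda>\<close> annihilates the directions
  \<open>(a, 0)\<close> there; and as \<open>\<sigma>\<close> vanishes at \<open>0\<close>, the integrand and \<open>\<Lambda>\<close> vanish to second order at \<open>0\<close>.
  Substituting \<open>s = smooth_step t\<close> turns the integral into a (trivial) instance of the integral
  equations above, which provides smoothness and differentiation under the integral.
\<close>

lemma primitive:
  obtains \<Lambda> where "smooth_on (ball 0 \<rho>) \<Lambda>"
    "\<And>x a b. x \<in> ball 0 \<rho> \<Longrightarrow> frechet_derivative \<Lambda> (at x) a \<bullet> b - frechet_derivative \<Lambda> (at x) b \<bullet> a = \<sigma> x a b"
    "\<Lambda> 0 = 0" "\<And>a. frechet_derivative \<Lambda> (at 0) a = 0"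
    "\<And>w a. (0 :: complex, w) \<in> ball 0 \<rho> \<Longrightarrow> \<Lambda> (0, w) \<bullet> (a, 0) = 0"
proof -
  let ?U = "ball 0 \<rho> :: (complex \<times> complex) set"
  let ?\<theta> = smooth_step and ?\<theta>' = smooth_step'
  define f :: "real \<times> (complex \<times> complex) \<times> (complex \<times> complex) \<Rightarrow> complex \<times> complex"
    where "f = (\<lambda>p. (?\<theta>' (fst p) * ?\<theta> (fst p)) *\<^sub>R riesz (\<sigma> (?\<theta> (fst p) *\<^sub>R fst (snd p)) (fst (snd p))))"
  have oW: "open (UNIV \<times> ?U \<times> (UNIV :: (complex \<times> complex) set) :: (real \<times> _) set)"
    by (intro open_Times) auto
  have smf: "smooth_on (UNIV \<times> ?U \<times> UNIV) f"
  proof -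
    have "smooth_on (UNIV \<times> ?U \<times> UNIV)
        (\<lambda>p :: real \<times> (complex \<times> complex) \<times> (complex \<times> complex). \<sigma> (?\<theta> (fst p) *\<^sub>R fst (snd p)) (fst (snd p)) b)" for b
    proof (rule smooth_on_bilinear_family[OF open_ball oW bilinear_sigma smooth_sigma])
      show "?\<theta> (fst p) *\<^sub>R fst (snd p) \<in> ?U"
        if "p \<in> UNIV \<times> ?U \<times> (UNIV :: (complex \<times> complex) set)" for p :: "real \<times> _"
        by (rule step_scale_in_ball) (use that in auto)
    qed (assumption | intro smooth_intros oW)+
    then show ?thesis unfolding f_def riesz_def by (intro smooth_intros oW) auto
  qed
  have f_inner: "f (t, x, w) \<bullet> b = ?\<theta>' t * ?\<theta> t * \<sigma> (?\<theta> t *\<^sub>R x) x b" if "x \<in> ?U" for t x w b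
    using riesz_inner[OF bilinear_linear(1)[OF bilinear_sigma[OF step_scale_in_ball[OF that]]]]
    by (simp add: f_def)
  obtain u where u: "smooth_on (UNIV \<times> ?U) u"
    "\<And>t x. x \<in> ?U \<Longrightarrow> u (t, x) = integral {0..t} (\<lambda>s. f (s, x, u (s, x)))"
    "\<And>t x. x \<in> ?U \<Longrightarrow> ((\<lambda>t. u (t, x)) has_vector_derivative f (t, x, u (t, x))) (at t)"
    "\<And>t x v. x \<in> ?U \<Longrightarrow> ((\<lambda>t. frechet_derivative u (at (t, x)) (0, v)) has_vector_derivative
        frechet_derivative f (at (t, x, u (t, x))) (0, v, frechet_derivative u (at (t, x)) (0, v))) (at t)"
    "\<And>x v. x \<in> ?U \<Longrightarrow> frechet_derivative u (at (0, x)) (0, v) = 0"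
  proof (rule smooth_integral_equation[OF open_ball smf])
    show "norm (f (t, x, u) - f (t, x, u')) \<le> 1/2 * norm (u - u')" for t x u u' by (simp add: f_def)
    show "f (t, x, u) = 0" if "t \<notin> {0..1}" for t x u by (simp add: f_def smooth_step'_outside[OF that])
  qed (rule that, assumption+)
  have Df: "frechet_derivative f (at (t, x, w)) (0, a, c) \<bullet> b =
      ?\<theta>' t * ?\<theta> t * (?\<theta> t * D\<sigma> (?\<theta> t *\<^sub>R x) x b a + \<sigma> (?\<theta> t *\<^sub>R x) a b)" if x: "x \<in> ?U" for t x w a b c
  proof -
    let ?y = "?\<theta> t *\<^sub>R x"
    have y: "?y \<in> ?U" by (rule step_scale_in_ball[OF x])
    have Dff: "(f has_derivative frechet_derivative f (at (t, x, w))) (at (t, x, w))"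
      by (rule smooth_has_derivative[OF smf]) (use x in auto)
    have line: "((\<lambda>h. (t, x + h *\<^sub>R a, w + h *\<^sub>R c)) has_derivative (\<lambda>h. h *\<^sub>R (0, a, c))) (at 0)"
      by (auto intro!: derivative_eq_intros simp: scaleR_prod_def)
    have "((\<lambda>h. f (t, x + h *\<^sub>R a, w + h *\<^sub>R c)) has_derivative (\<lambda>h. frechet_derivative f (at (t, x, w)) (h *\<^sub>R (0, a, c)))) (at 0)"
      using has_derivative_compose[OF line, of f "frechet_derivative f (at (t, x, w))"] Dff by simp
    then have 1: "((\<lambda>h. f (t, x + h *\<^sub>R a, w + h *\<^sub>R c) \<bullet> b) has_derivative
        (\<lambda>h. frechet_derivative f (at (t, x, w)) (h *\<^sub>R (0, a, c)) \<bullet> b)) (at 0)"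
      by (rule has_derivative_inner_left)
    have "((\<lambda>h. \<sigma> (?\<theta> t *\<^sub>R (x + h *\<^sub>R a)) (x + h *\<^sub>R a) b) has_derivative
        (\<lambda>h. frechet_derivative (\<lambda>y. \<sigma> y (x + 0 *\<^sub>R a) b) (at (?\<theta> t *\<^sub>R (x + 0 *\<^sub>R a))) (?\<theta> t *\<^sub>R h *\<^sub>R a)
          + \<sigma> (?\<theta> t *\<^sub>R (x + 0 *\<^sub>R a)) (h *\<^sub>R a) b + \<sigma> (?\<theta> t *\<^sub>R (x + 0 *\<^sub>R a)) (x + 0 *\<^sub>R a) 0)) (at (0 :: real))"
      by (rule bilinear_family_has_derivative[OF open_ball bilinear_sigma smooth_sigma])
        (use y in \<open>auto intro!: derivative_eq_intros\<close>)
    then have "((\<lambda>h. \<sigma> (?\<theta> t *\<^sub>R (x + h *\<^sub>R a)) (x + h *\<^sub>R a) b) has_derivative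
        (\<lambda>h. h * (?\<theta> t * D\<sigma> ?y x b a + \<sigma> ?y a b))) (at 0)"
      using sigma_zero[OF y] linear_cmul[OF Dsigma_linear[OF y]] bilinear_lmul[OF bilinear_sigma[OF y]]
      by (simp add: algebra_simps)
    then have "((\<lambda>h. ?\<theta>' t * ?\<theta> t * \<sigma> (?\<theta> t *\<^sub>R (x + h *\<^sub>R a)) (x + h *\<^sub>R a) b) has_derivative
        (\<lambda>h. ?\<theta>' t * ?\<theta> t * (h * (?\<theta> t * D\<sigma> ?y x b a + \<sigma> ?y a b)))) (at 0)"
      by (rule has_derivative_mult_right)
    moreover obtain e where e: "e > 0" "\<And>h. \<bar>h\<bar> < e \<Longrightarrow> x + h *\<^sub>R a \<in> ?U"
    proof -
      have "open ((\<lambda>h :: real. x + h *\<^sub>R a) -` ?U)" by (intro open_vimage continuous_intros) auto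
      moreover have "0 \<in> (\<lambda>h :: real. x + h *\<^sub>R a) -` ?U" using x by simp
      ultimately obtain e where "e > 0" "ball 0 e \<subseteq> (\<lambda>h :: real. x + h *\<^sub>R a) -` ?U"
        using open_contains_ball by blast
      then show ?thesis using that[of e] by (auto simp: subset_iff)
    qed
    ultimately have 2: "((\<lambda>h. f (t, x + h *\<^sub>R a, w + h *\<^sub>R c) \<bullet> b) has_derivative
        (\<lambda>h. ?\<theta>' t * ?\<theta> t * (h * (?\<theta> t * D\<sigma> ?y x b a + \<sigma> ?y a b)))) (at 0)"
      by (elim has_derivative_transform_within_open[of _ _ _ _ "ball 0 e"]) (auto simp: f_inner)
    from fun_cong[OF has_derivative_unique[OF 1 2], of 1] show ?thesis by simp
  qed
  define \<Lambda> where "\<Lambda> x = u (1, x)" for x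
  have D\<Lambda>: "(\<Lambda> has_derivative (\<lambda>a. frechet_derivative u (at (1, x)) (0, a))) (at x)" if "x \<in> ?U" for x
    unfolding \<Lambda>_def
    by (rule has_derivative_compose[of "\<lambda>x. (1, x)" "\<lambda>a. (0, a)" x UNIV u])
      (use smooth_has_derivative[OF u(1)] that in \<open>auto intro!: derivative_eq_intros\<close>)
  have D\<Lambda>': "frechet_derivative \<Lambda> (at x) a = frechet_derivative u (at (1, x)) (0, a)" if "x \<in> ?U" for x a
    using frechet_eq[OF D\<Lambda>[OF that]] .
  define y where "y x a t = frechet_derivative u (at (t, x)) (0, a)" for x a t
  have y': "((\<lambda>t. y x a t \<bullet> b) has_real_derivative
      ?\<theta>' t * ?\<theta> t * (?\<theta> t * D\<sigma> (?\<theta> t *\<^sub>R x) x b a + \<sigma> (?\<theta> t *\<^sub>R x) a b)) (at t)" if x: "x \<in> ?U" for x a b t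
    using has_derivative_inner_left[OF u(4)[OF x, of a t, unfolded has_vector_derivative_def], of b]
    by (simp add: y_def has_field_derivative_def Df[OF x] mult_commute_abs)
  have y0: "y x a 0 = 0" if "x \<in> ?U" for x a using u(5)[OF that] by (simp add: y_def)
  have d\<Lambda>: "frechet_derivative \<Lambda> (at x) a \<bullet> b - frechet_derivative \<Lambda> (at x) b \<bullet> a = \<sigma> x a b" if x: "x \<in> ?U" for x a b
  proof -
    define G where "G t = y x a t \<bullet> b - y x b t \<bullet> a - ?\<theta> t * ?\<theta> t * \<sigma> (?\<theta> t *\<^sub>R x) a b" for t
    have "(G has_real_derivative 0) (at t)" for t
    proof -
      let ?x = "?\<theta> t *\<^sub>R x"
      have xt: "?x \<in> ?U" by (rule step_scale_in_ball[OF x])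
      have "((\<lambda>t. \<sigma> (?\<theta> t *\<^sub>R x) a b) has_derivative (\<lambda>h. D\<sigma> ?x a b ((h * ?\<theta>' t) *\<^sub>R x))) (at t)"
        by (rule has_derivative_compose[of "\<lambda>t. ?\<theta> t *\<^sub>R x" "\<lambda>h. (h * ?\<theta>' t) *\<^sub>R x" t UNIV "\<lambda>y. \<sigma> y a b"])
          (auto intro!: has_derivative_scaleR_left smooth_step_has_derivative sigma_has_derivative[OF xt])
      then have "((\<lambda>t. \<sigma> (?\<theta> t *\<^sub>R x) a b) has_real_derivative ?\<theta>' t * D\<sigma> ?x a b x) (at t)"
        unfolding linear_cmul[OF Dsigma_linear[OF xt]] by (simp add: has_field_derivative_def mult.assoc mult_commute_abs)
      from DERIV_mult[OF DERIV_mult[OF smooth_step_has_real_derivative smooth_step_has_real_derivative] this]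
      have "((\<lambda>t. ?\<theta> t * ?\<theta> t * \<sigma> (?\<theta> t *\<^sub>R x) a b) has_real_derivative
          (?\<theta>' t * ?\<theta> t + ?\<theta>' t * ?\<theta> t) * \<sigma> ?x a b + (?\<theta>' t * D\<sigma> ?x a b x) * (?\<theta> t * ?\<theta> t)) (at t)" .
      from DERIV_diff[OF DERIV_diff[OF y'[OF x, of a b] y'[OF x, of b a]] this]
      show ?thesis unfolding G_def
      proof (rule DERIV_cong)
        have e1: "D\<sigma> ?x x b a = D\<sigma> ?x x a b + D\<sigma> ?x a b x"
          using closed_sigma[OF xt, of x a b] Dsigma_antisym[OF xt, of x b a] by linarith
        have e2: "\<sigma> ?x b a = - \<sigma> ?x a b" by (rule sigma_antisym[OF xt])
        show "?\<theta>' t * ?\<theta> t * (?\<theta> t * D\<sigma> ?x x b a + \<sigma> ?x a b) -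
            ?\<theta>' t * ?\<theta> t * (?\<theta> t * D\<sigma> ?x x a b + \<sigma> ?x b a) -
            ((?\<theta>' t * ?\<theta> t + ?\<theta>' t * ?\<theta> t) * \<sigma> ?x a b + ?\<theta>' t * D\<sigma> ?x a b x * (?\<theta> t * ?\<theta> t)) = 0"
          unfolding e1 e2 by (simp add: algebra_simps)
      qed
    qed
    then have "G 1 = G 0" using DERIV_isconst_all by blast
    then show ?thesis using x y0 by (simp add: G_def D\<Lambda>' y_def[symmetric] smooth_step_nonpos smooth_step_ge_1)
  qed
  have z: "(0 :: complex \<times> complex) \<in> ?U" using rho by simp
  show ?thesis
  proof (rule that[OF _ d\<Lambda>])
    show "smooth_on ?U \<Lambda>" unfolding \<Lambda>_def
      by (rule smooth_on_compose[OF u(1)]) (auto intro!: smooth_intros open_Times)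
    have "f (t, 0, w) = 0" for t w by (simp add: f_def sigma_0 riesz_def)
    then show "\<Lambda> 0 = 0" using u(2)[OF z, of 1] by (simp add: \<Lambda>_def)
    show "frechet_derivative \<Lambda> (at 0) a = 0" for a
    proof -
      have "((\<lambda>t. y 0 a t \<bullet> b) has_real_derivative 0) (at t)" for b t
        using y'[OF z, of a b t] by (simp add: sigma_0 Dsigma_zero[OF z])
      then have "y 0 a 1 \<bullet> b = y 0 a 0 \<bullet> b" for b using DERIV_isconst_all by metis
      then have "y 0 a 1 \<bullet> y 0 a 1 = 0" using y0[OF z] by simp
      then show ?thesis using D\<Lambda>'[OF z] by (simp add: y_def)
    qed
    show "\<Lambda> (0, w) \<bullet> (a, 0) = 0" if w: "(0, w) \<in> ?U" for w a
    proof -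
      have "((\<lambda>t. u (t, (0, w)) \<bullet> (a, 0)) has_real_derivative f (t, (0, w), u (t, (0, w))) \<bullet> (a, 0)) (at t)" for t
        using has_derivative_inner_left[OF u(3)[OF w, of t, unfolded has_vector_derivative_def], of "(a, 0)"]
        by (simp add: has_field_derivative_def mult_commute_abs)
      moreover have "f (t, (0, w), u') \<bullet> (a, 0) = 0" for t u'
        using step_scale_in_ball[OF w, of t] sigma_antisym[of "(0, smooth_step t *\<^sub>R w)" "(0, w)" "(a, 0)"]
          sigma_mixed[of "smooth_step t *\<^sub>R w" a w] by (simp add: f_inner[OF w])
      ultimately have "((\<lambda>t. u (t, (0, w)) \<bullet> (a, 0)) has_real_derivative 0) (at t)" for t by metis
      then have "u (1, (0, w)) \<bullet> (a, 0) = u (0, (0, w)) \<bullet> (a, 0)" using DERIV_isconst_all by blast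
      then show ?thesis using u(2)[OF w, of 0] by (simp add: \<Lambda>_def)
    qed
  qed
qed

text \<open>
  Moser's path from the standard form to \<open>\<omega>\<close>. The reparametrization by \<open>smooth_step\<close> makes its
  velocity vanish for times outside the unit interval.
\<close>

definition moser_form :: "real \<Rightarrow> complex \<times> complex \<Rightarrow> complex \<times> complex \<Rightarrow> complex \<times> complex \<Rightarrow> real" where
  "moser_form t x u v = std_form u v + smooth_step t * \<sigma> x u v"

lemma bilinear_moser_form: "x \<in> ball 0 \<rho> \<Longrightarrow> bilinear (moser_form t x)"
  unfolding moser_form_def by (rule bilinear_add_scale[OF bilinear_std_form bilinear_sigma])

lemma sigma_bound:
  assumes "x \<in> ball 0 \<rho>"
  shows "\<bar>\<sigma> x u v\<bar> \<le> (\<Sum>i\<in>Basis. \<Sum>j\<in>Basis. \<bar>\<sigma> x i j\<bar>) * (norm u * norm v)"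
proof -
  have "\<bar>\<sigma> x u v\<bar> \<le> (\<Sum>i\<in>Basis. \<bar>\<Sum>j\<in>Basis. (u \<bullet> i) *\<^sub>R (v \<bullet> j) *\<^sub>R \<sigma> x i j\<bar>)"
    unfolding bilinear_expand_Basis[OF bilinear_sigma[OF assms], of u v, symmetric] by (rule sum_abs)
  also have "\<dots> \<le> (\<Sum>i\<in>Basis. \<Sum>j\<in>Basis. \<bar>\<sigma> x i j\<bar> * (norm u * norm v))"
  proof (rule sum_mono)
    fix i :: "complex \<times> complex" assume i: "i \<in> Basis"
    have "\<bar>\<Sum>j\<in>Basis. (u \<bullet> i) *\<^sub>R (v \<bullet> j) *\<^sub>R \<sigma> x i j\<bar> \<le> (\<Sum>j\<in>Basis. \<bar>(u \<bullet> i) *\<^sub>R (v \<bullet> j) *\<^sub>R \<sigma> x i j\<bar>)"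
      by (rule sum_abs)
    also have "\<dots> \<le> (\<Sum>j\<in>Basis. \<bar>\<sigma> x i j\<bar> * (norm u * norm v))"
    proof (rule sum_mono)
      fix j :: "complex \<times> complex" assume j: "j \<in> Basis"
      have "\<bar>u \<bullet> i\<bar> * \<bar>v \<bullet> j\<bar> \<le> norm u * norm v"
        using Basis_le_norm i j by (intro mult_mono) auto
      from mult_left_mono[OF this abs_ge_zero[of "\<sigma> x i j"]]
      show "\<bar>(u \<bullet> i) *\<^sub>R (v \<bullet> j) *\<^sub>R \<sigma> x i j\<bar> \<le> \<bar>\<sigma> x i j\<bar> * (norm u * norm v)"
        by (simp add: abs_mult mult_ac)
    qed
    finally show "\<bar>\<Sum>j\<in>Basis. (u \<bullet> i) *\<^sub>R (v \<bullet> j) *\<^sub>R \<sigma> x i j\<bar> \<le> (\<Sum>j\<in>Basis. \<bar>\<sigma> x i j\<bar> * (norm u * norm v))" .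
  qed
  finally show ?thesis by (simp add: sum_distrib_right)
qed

text \<open>
  For \<open>v = i e\<close> the standard form equals the square of \<open>norm e\<close>, which dominates the small
  contribution of \<open>\<sigma>\<close>.
\<close>

lemma nondegenerate_radius:
  obtains R where "0 < R" "R \<le> \<rho>" "\<And>t x e. x \<in> ball 0 R \<Longrightarrow> (\<And>v. moser_form t x e v = 0) \<Longrightarrow> e = 0"
proof -
  define N where "N x = (\<Sum>i\<in>Basis. \<Sum>j\<in>Basis. \<bar>\<sigma> x i j\<bar>)" for x
  have "continuous_on (ball 0 \<rho>) N" unfolding N_def
    by (intro continuous_on_sum continuous_on_rabs smooth_on_continuous[OF smooth_sigma])
  then have "isCont N 0" using rho by (simp add: continuous_on_eq_continuous_at)
  moreover have "N 0 = 0" by (simp add: N_def sigma_0)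
  ultimately obtain d where d: "d > 0" "\<And>x. norm x < d \<Longrightarrow> \<bar>N x\<bar> < 1/2"
    unfolding continuous_at_eps_delta by (metis dist_0_norm dist_commute dist_real_def diff_zero half_gt_zero zero_less_one)
  show ?thesis
  proof (rule that[of "min d \<rho>"])
    fix t x e assume x: "x \<in> ball 0 (min d \<rho>)" and e: "\<And>v. moser_form t x e v = 0"
    let ?J = "(\<i> * fst e, \<i> * snd e)"
    have "\<bar>\<sigma> x e ?J\<bar> \<le> N x * (norm e * norm ?J)" using sigma_bound[of x e ?J] x by (simp add: N_def)
    also have "\<dots> \<le> 1/2 * (norm e)\<^sup>2"
    proof -
      have "N x \<le> 1/2" using d(2)[of x] x by auto
      from mult_right_mono[OF this zero_le_power2[of "norm e"]]
      show ?thesis unfolding norm_times_i by (simp add: power2_eq_square)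
    qed
    finally have s: "\<bar>\<sigma> x e ?J\<bar> \<le> 1/2 * (norm e)\<^sup>2" .
    have "\<bar>smooth_step t * \<sigma> x e ?J\<bar> \<le> 1 * \<bar>\<sigma> x e ?J\<bar>"
      unfolding abs_mult using smooth_step_nonneg[of t] smooth_step_le_1[of t] by (intro mult_right_mono) auto
    moreover have "(norm e)\<^sup>2 + smooth_step t * \<sigma> x e ?J = 0"
      using e[of ?J] by (simp add: moser_form_def std_form_compatible)
    ultimately have "(norm e)\<^sup>2 \<le> 0" using s zero_le_power2[of "norm e"] by linarith
    then show "e = 0" by simp
  qed (use d rho in auto)
qed

text \<open>
  Moser's vector field \<open>F\<close> is defined by \<open>\<iota>\<^sub>F \<omega>\<^sub>t = - \<theta>' \<Lambda>\<close>, where \<open>\<omega>\<^sub>t\<close> is \<open>moser_form t\<close> and \<open>\<theta>\<close>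
  is \<open>smooth_step\<close>. It is smooth because it solves a nondegenerate linear system with smooth
  coefficients. Like \<open>\<Lambda>\<close>, it vanishes at \<open>0\<close> together with its derivative. Along \<open>{z = 0}\<close>, both
  \<open>\<Lambda>\<close> and \<open>\<omega>\<^sub>t\<close> respect the splitting into the \<open>z\<close>- and the \<open>w\<close>-plane, so \<open>F\<close> has no \<open>z\<close>-component
  there.
\<close>

lemma moser_field:
  assumes L: "smooth_on (ball 0 \<rho>) \<Lambda>" and L0: "\<Lambda> 0 = 0" and DL0: "\<And>a. frechet_derivative \<Lambda> (at 0) a = 0"
    and Lm: "\<And>w a. (0 :: complex, w) \<in> ball 0 \<rho> \<Longrightarrow> \<Lambda> (0, w) \<bullet> (a, 0) = 0"
  obtains R F where "0 < R" "R \<le> \<rho>" "smooth_on (UNIV \<times> ball 0 R) F"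
    "\<And>t x v. x \<in> ball 0 R \<Longrightarrow> moser_form t x (F (t, x)) v = - smooth_step' t * (\<Lambda> x \<bullet> v)"
    "\<And>t x. t \<notin> {0..1} \<Longrightarrow> F (t, x) = 0" "\<And>t. F (t, 0) = 0"
    "\<And>t d. frechet_derivative F (at (t, 0)) d = 0"
    "\<And>t w. (0 :: complex, w) \<in> ball 0 R \<Longrightarrow> fst (F (t, (0, w))) = 0"
proof -
  obtain R where R: "0 < R" "R \<le> \<rho>" and nd: "\<And>t x e. x \<in> ball 0 R \<Longrightarrow> (\<And>v. moser_form t x e v = 0) \<Longrightarrow> e = 0"
    by (rule nondegenerate_radius) blast
  let ?W = "UNIV \<times> ball 0 R :: (real \<times> complex \<times> complex) set"
  have oW: "open ?W" by (intro open_Times) auto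
  have inb: "x \<in> ball 0 \<rho>" if "x \<in> ball 0 R" for x :: "complex \<times> complex" using that R by auto
  define T where "T p e = riesz (moser_form (fst p) (snd p) e)" for p e
  have T_inner: "T p e \<bullet> v = moser_form (fst p) (snd p) e v" if "p \<in> ?W" for p e v
    unfolding T_def by (rule riesz_inner[OF bilinear_linear(1)[OF bilinear_moser_form]]) (use that inb in auto)
  have linT: "linear (T p)" if "p \<in> ?W" for p
    unfolding T_def by (rule linear_riesz[OF bilinear_moser_form]) (use that inb in auto)
  have injT: "inj (T p)" if p: "p \<in> ?W" for p
  proof -
    have "e = 0" if "T p e = 0" for e
      by (rule nd[of "snd p" "fst p"]) (use p that T_inner[OF p, of e] in auto)
    then show ?thesis using linear_injective_0[OF linT[OF p]] by blast
  qed
  have "\<exists>K. \<forall>p. p \<in> ?W \<longrightarrow> (\<forall>b. T p (K p b) = b)"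
  proof (intro choice allI)
    fix p
    show "\<exists>k. p \<in> ?W \<longrightarrow> (\<forall>b. T p (k b) = b)"
    proof (cases "p \<in> ?W")
      case True
      show ?thesis by (rule linear_inj_left_inverse[OF linT[OF True] injT[OF True]]) blast
    qed auto
  qed
  then obtain K where K: "\<And>p b. p \<in> ?W \<Longrightarrow> T p (K p b) = b" by blast
  have smT: "smooth_on ?W (\<lambda>p. T p e)" for e
  proof -
    have "smooth_on ?W (\<lambda>p. \<sigma> (snd p) e b)" for b
      by (rule smooth_on_compose[OF smooth_sigma smooth_on_snd[OF oW smooth_on_id[OF oW]] oW]) (use R in auto)
    then show ?thesis unfolding T_def riesz_def moser_form_def by (intro smooth_intros oW) auto
  qed
  have smK: "smooth_on ?W (\<lambda>p. K p b)" for b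
    by (rule smooth_on_linear_solve[OF oW linT injT smT smooth_on_const[of _ b] K])
  define F where "F p = (\<Sum>b\<in>Basis. (- smooth_step' (fst p) * (\<Lambda> (snd p) \<bullet> b)) *\<^sub>R K p b)" for p
  have smL: "smooth_on ?W (\<lambda>p. \<Lambda> (snd p))"
    by (rule smooth_on_compose[OF L smooth_on_snd[OF oW smooth_on_id[OF oW]] oW]) (use R in auto)
  have smF: "smooth_on ?W F" unfolding F_def by (intro smooth_intros oW smL smK)
  have TF: "T p (F p) = - smooth_step' (fst p) *\<^sub>R \<Lambda> (snd p)" if p: "p \<in> ?W" for p
  proof -
    have "T p (F p) = (\<Sum>b\<in>Basis. (- smooth_step' (fst p)) *\<^sub>R (\<Lambda> (snd p) \<bullet> b) *\<^sub>R b)"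
      unfolding F_def linear_sum[OF linT[OF p]] linear_cmul[OF linT[OF p]] K[OF p] by simp
    then show ?thesis unfolding scaleR_sum_right[symmetric] euclidean_representation .
  qed
  have eqn: "moser_form t x (F (t, x)) v = - smooth_step' t * (\<Lambda> x \<bullet> v)" if "x \<in> ball 0 R" for t x v
    using T_inner[of "(t, x)" "F (t, x)" v] TF[of "(t, x)"] that by simp
  have DF0: "frechet_derivative F (at (t, 0)) d = 0" for t d
  proof -
    have p: "(t, 0) \<in> ?W" using R by simp
    have "(\<Lambda> has_derivative (\<lambda>a. 0)) (at 0)"
      using smooth_has_derivative[OF L, of 0] rho unfolding fun_eq_iff[THEN iffD2, OF allI, OF DL0] by simp
    from has_derivative_compose[OF bounded_linear_imp_has_derivative[OF bounded_linear_snd], of \<Lambda> "\<lambda>a. 0" "(t, 0)"] this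
    have "((\<lambda>p. \<Lambda> (snd p)) has_derivative (\<lambda>a. 0)) (at (t, 0))" by simp
    from has_derivative_inner_left[OF this]
    have DLb: "((\<lambda>p. \<Lambda> (snd p) \<bullet> b) has_derivative (\<lambda>a. 0)) (at (t, 0))" for b by simp
    have sms: "smooth_on ?W (\<lambda>p. - smooth_step' (fst p))" by (intro smooth_intros oW)
    have "(F has_derivative (\<lambda>d. \<Sum>b\<in>Basis. ((- smooth_step' (fst (t, 0 :: complex \<times> complex))) * (\<Lambda> (snd (t, 0 :: complex \<times> complex)) \<bullet> b)) *\<^sub>R frechet_derivative (\<lambda>p. K p b) (at (t, 0)) d
        + ((- smooth_step' (fst (t, 0 :: complex \<times> complex))) * 0 + frechet_derivative (\<lambda>p. - smooth_step' (fst p)) (at (t, 0 :: complex \<times> complex)) d * (\<Lambda> (snd (t, 0 :: complex \<times> complex)) \<bullet> b)) *\<^sub>R K (t, 0) b)) (at (t, 0))"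
      unfolding F_def
      by (intro has_derivative_sum has_derivative_scaleR has_derivative_mult DLb
          smooth_has_derivative[OF smK p] smooth_has_derivative[OF sms p])
    from frechet_eq[OF this] show ?thesis by (simp add: L0)
  qed
  have fstF: "fst (F (t, (0, w))) = 0" if w: "(0 :: complex, w) \<in> ball 0 R" for t w
  proof -
    let ?x = "(0 :: complex, w)" and ?f = "F (t, (0, w))"
    have xb: "?x \<in> ball 0 \<rho>" by (rule inb[OF w])
    note bl = bilinear_moser_form[OF xb, of t]
    have mix: "moser_form t ?x (a, 0) (0, b) = 0" "moser_form t ?x (0, b) (a, 0) = 0" for a b
      using sigma_mixed[OF xb, of a b] sigma_antisym[OF xb, of "(0, b)" "(a, 0)"]
      by (auto simp: moser_form_def std_form_def)
    have "(fst ?f, 0 :: complex) = 0"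
    proof (rule nd[OF w, of t])
      fix v :: "complex \<times> complex"
      have "moser_form t ?x ?f (fst v, 0) = 0"
        using eqn[OF w, of t "(fst v, 0)"] Lm[OF xb] by simp
      moreover have "?f = (fst ?f, 0) + (0, snd ?f)" "v = (fst v, 0) + (0, snd v)" by simp_all
      ultimately show "moser_form t ?x (fst ?f, 0) v = 0"
        using mix by (metis add.right_neutral bilinear_ladd[OF bl] bilinear_radd[OF bl])
    qed
    then show ?thesis by (simp add: prod_eq_iff)
  qed
  show ?thesis
    by (rule that[OF R smF eqn _ _ DF0 fstF]) (simp_all add: F_def smooth_step'_outside L0)
qed

text \<open>
  \<open>\<Psi>\<close> is the time-one map of the flow of Moser's field. The field has a small Lipschitz constant
  near \<open>0\<close>, so after cutting it off the flow exists for all times and all initial values. The flow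
  pulls \<open>moser_form t\<close> back to a form that does not depend on \<open>t\<close>, and it preserves \<open>{z = 0}\<close>
  because the field is tangent to that plane.
\<close>

theorem darboux_normal_form:
  obtains r \<Psi> where "0 < r" "smooth_on (ball 0 r) \<Psi>" "\<And>x. x \<in> ball 0 r \<Longrightarrow> \<Psi> x \<in> ball 0 \<rho>"
    "inj_on \<Psi> (ball 0 r)" "\<Psi> 0 = 0"
    "\<And>x. x \<in> ball 0 r \<Longrightarrow> inj (frechet_derivative \<Psi> (at x))"
    "\<And>x u v. x \<in> ball 0 r \<Longrightarrow> \<omega> (\<Psi> x) (frechet_derivative \<Psi> (at x) u) (frechet_derivative \<Psi> (at x) v) = std_form u v"
    "\<And>x. x \<in> ball 0 r \<Longrightarrow> fst (\<Psi> x) = 0 \<longleftrightarrow> fst x = 0"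
proof -
  obtain \<Lambda> where L: "smooth_on (ball 0 \<rho>) \<Lambda>"
    "\<And>x a b. x \<in> ball 0 \<rho> \<Longrightarrow> frechet_derivative \<Lambda> (at x) a \<bullet> b - frechet_derivative \<Lambda> (at x) b \<bullet> a = \<sigma> x a b"
    "\<Lambda> 0 = 0" "\<And>a. frechet_derivative \<Lambda> (at 0) a = 0"
    "\<And>w a. (0 :: complex, w) \<in> ball 0 \<rho> \<Longrightarrow> \<Lambda> (0, w) \<bullet> (a, 0) = 0"
    by (rule primitive) (rule that)
  obtain R F where R: "0 < R" "R \<le> \<rho>" and smF: "smooth_on (UNIV \<times> ball 0 R) F"
    and eqn: "\<And>t x v. x \<in> ball 0 R \<Longrightarrow> moser_form t x (F (t, x)) v = - smooth_step' t * (\<Lambda> x \<bullet> v)"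
    and F_out: "\<And>t x. t \<notin> {0..1} \<Longrightarrow> F (t, x) = 0" and F0: "\<And>t. F (t, 0) = 0"
    and DF0: "\<And>t d. frechet_derivative F (at (t, 0)) d = 0"
    and fstF: "\<And>t w. (0 :: complex, w) \<in> ball 0 R \<Longrightarrow> fst (F (t, (0, w))) = 0"
    by (rule moser_field[OF L(1,3,4,5)]) (assumption, rule that)
  let ?W = "UNIV \<times> ball 0 R :: (real \<times> complex \<times> complex) set"
  have oW: "open ?W" by (intro open_Times) auto
  have inb: "x \<in> ball 0 \<rho>" if "x \<in> ball 0 R" for x :: "complex \<times> complex" using that R by auto
  have DF: "(F has_derivative frechet_derivative F (at (t, x))) (at (t, x))" if "x \<in> ball 0 R" for t x
    by (rule smooth_has_derivative[OF smF]) (use that in auto)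
  have DFx: "((\<lambda>x. F (t, x)) has_derivative (\<lambda>a. frechet_derivative F (at (t, x)) (0, a))) (at x)" if "x \<in> ball 0 R" for t x
    by (rule has_derivative_compose[of "\<lambda>x. (t, x)" "\<lambda>a. (0, a)" x UNIV F])
      (use DF[OF that] in \<open>auto intro!: derivative_eq_intros\<close>)
  obtain C where C: "C > 0" "\<And>r (x :: complex \<times> complex) y. r > 0 \<Longrightarrow> norm (radial_cutoff r x - radial_cutoff r y) \<le> C * norm (x - y)"
    by (rule radial_cutoff_lipschitz) (rule that)
  \<comment> \<open>Composition with the cut-off multiplies the Lipschitz constant by \<open>C\<close>, and it has to end up
    at 1/2.\<close>
  define \<eta> where "\<eta> = min (1/2) (1 / (2 * C))"
  have eta: "\<eta> > 0" "\<eta> \<le> 1/2" using C(1) unfolding \<eta>_def by auto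
  have etaC: "\<eta> * (C * z) \<le> 1/2 * z" if "z \<ge> 0" for z
  proof -
    have "\<eta> \<le> 1 / (2 * C)" by (simp add: \<eta>_def)
    then have "\<eta> * C \<le> 1/2" using C(1) by (simp add: field_simps)
    from mult_right_mono[OF this that] show ?thesis by (simp add: mult.assoc)
  qed
  define N where "N x t = (\<Sum>b\<in>Basis. norm (frechet_derivative F (at (t, x)) (0, b)))" for x :: "complex \<times> complex" and t
  have "continuous_on (ball 0 R \<times> {0..1}) (\<lambda>(x, t). N x t)"
  proof -
    have "continuous_on ?W (\<lambda>p. frechet_derivative F (at p) d)" for d
      by (rule smooth_on_continuous[OF smooth_frechet[OF smF]])
    then have "continuous_on (ball 0 R \<times> {0..1}) (\<lambda>q :: (complex \<times> complex) \<times> real. frechet_derivative F (at (snd q, fst q)) d)" for d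
      by (rule continuous_on_compose2) (auto intro!: continuous_on_Pair continuous_on_fst continuous_on_snd continuous_on_id)
    then show ?thesis unfolding N_def split_def by (intro continuous_on_sum continuous_on_norm)
  qed
  from continuous_on_prod_compactE[OF this compact_Icc _ eta(1), of 0] R(1)
  obtain X where X: "0 \<in> X" "open X" "\<And>x t. x \<in> X \<inter> ball 0 R \<Longrightarrow> t \<in> {0..1} \<Longrightarrow> dist (N x t) (N 0 t) \<le> \<eta>"
    by (metis (no_types, lifting) case_prod_conv centre_in_ball)
  obtain d where d: "d > 0" "ball 0 d \<subseteq> X \<inter> ball 0 R"
    using X(1,2) R(1) open_contains_ball by (metis IntI centre_in_ball open_Int open_ball)
  define r where "r = d / 2"
  have r: "r > 0" "ball 0 (2 * r) \<subseteq> X \<inter> ball 0 R" using d by (auto simp: r_def)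
  have FL: "norm (F (t, y) - F (t, y')) \<le> \<eta> * norm (y - y')"
    if y: "y \<in> ball 0 (2 * r)" "y' \<in> ball 0 (2 * r)" for t y y'
  proof (cases "t \<in> {0..1}")
    case True
    show ?thesis
    proof (rule norm_diff_le_of_derivative_bound[OF convex_ball DFx _ y])
      show "x \<in> ball 0 R" if "x \<in> ball 0 (2 * r)" for x :: "complex \<times> complex" using that r(2) by blast
      show "norm (frechet_derivative F (at (t, x)) (0, v)) \<le> \<eta> * norm v" if x: "x \<in> ball 0 (2 * r)" for x v
      proof -
        have xR: "x \<in> X \<inter> ball 0 R" using x r(2) by blast
        have "linear (\<lambda>v. frechet_derivative F (at (t, x)) (0, v))"
          by (rule has_derivative_linear[OF DFx]) (use xR in blast)
        from linear_norm_le_sum_Basis[OF this, of v]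
        have "norm (frechet_derivative F (at (t, x)) (0, v)) \<le> N x t * norm v" by (simp add: N_def)
        moreover have "N x t \<le> \<eta>" using X(3)[OF xR True] by (simp add: N_def DF0 dist_norm)
        ultimately show ?thesis using mult_right_mono[of "N x t" \<eta> "norm v"] by simp
      qed
    qed
  next
    case False
    then show ?thesis using eta(1) by (simp add: F_out)
  qed
  define f :: "real \<times> (complex \<times> complex) \<times> (complex \<times> complex) \<Rightarrow> complex \<times> complex"
    where "f p = F (fst p, radial_cutoff r (fst (snd p) + snd (snd p)))" for p
  have cut2r: "radial_cutoff r y \<in> ball 0 (2 * r)" for y :: "complex \<times> complex"
    using radial_cutoff_norm[OF r(1), of y] by simp
  have smf: "smooth_on (UNIV \<times> UNIV \<times> UNIV) f"
  proof -
    have "smooth_on UNIV (\<lambda>p :: real \<times> (complex \<times> complex) \<times> (complex \<times> complex). radial_cutoff r (fst (snd p) + snd (snd p)))"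
      by (rule smooth_on_compose[OF smooth_radial_cutoff[OF r(1)]]) (intro smooth_intros open_UNIV UNIV_I)+
    then have "smooth_on UNIV (\<lambda>p :: real \<times> (complex \<times> complex) \<times> (complex \<times> complex). (fst p, radial_cutoff r (fst (snd p) + snd (snd p))))"
      by (intro smooth_intros open_UNIV)
    then have "smooth_on UNIV f" unfolding f_def
      by (rule smooth_on_compose[OF smF _ open_UNIV oW]) (use cut2r r(2) in blast)
    then show ?thesis by (simp add: UNIV_Times_UNIV)
  qed
  have f_diff: "norm (f (t, x, u) - f (t, x', u')) \<le> 1/2 * norm (x + u - (x' + u'))" for t x u x' u'
  proof -
    have "norm (f (t, x, u) - f (t, x', u')) \<le> \<eta> * norm (radial_cutoff r (x + u) - radial_cutoff r (x' + u'))"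
      unfolding f_def using FL[OF cut2r cut2r] by simp
    also have "\<dots> \<le> \<eta> * (C * norm (x + u - (x' + u')))"
      using C(2)[OF r(1)] eta(1) by (intro mult_left_mono) auto
    also have "\<dots> \<le> 1/2 * norm (x + u - (x' + u'))" by (rule etaC) simp
    finally show ?thesis .
  qed
  obtain u where u0: "smooth_on (UNIV \<times> UNIV) u"
    "\<And>t x. x \<in> UNIV \<Longrightarrow> u (t, x) = integral {0..t} (\<lambda>s. f (s, x, u (s, x)))"
    "\<And>x. x \<in> UNIV \<Longrightarrow> continuous_on UNIV (\<lambda>s. f (s, x, u (s, x)))"
    "\<And>t x. x \<in> UNIV \<Longrightarrow> ((\<lambda>t. u (t, x)) has_vector_derivative f (t, x, u (t, x))) (at t)"
    "\<And>t x v. x \<in> UNIV \<Longrightarrow> ((\<lambda>t. frechet_derivative u (at (t, x)) (0, v)) has_vector_derivative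
        frechet_derivative f (at (t, x, u (t, x))) (0, v, frechet_derivative u (at (t, x)) (0, v))) (at t)"
    "\<And>x v. x \<in> UNIV \<Longrightarrow> frechet_derivative u (at (0, x)) (0, v) = 0"
  proof (rule smooth_integral_equation[OF open_UNIV smf])
    show "norm (f (t, x, u) - f (t, x, u')) \<le> 1/2 * norm (u - u')" for t x u u'
      using f_diff[of t x u x u'] by simp
    show "f (t, x, u) = 0" if "t \<notin> {0..1}" for t x u by (simp add: f_def F_out[OF that])
  qed (rule that, assumption+)
  have u3: "continuous_on UNIV (\<lambda>s. f (s, x, u (s, x)))" for x using u0(3)[of x] by simp
  note u = u0(1) u0(2)[OF UNIV_I] u3 u0(4)[OF UNIV_I] u0(5)[OF UNIV_I] u0(6)[OF UNIV_I]
  have smu: "smooth_on UNIV u" using u(1) by (simp add: UNIV_Times_UNIV)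
  define \<phi> where "\<phi> t x = x + u (t, x)" for t x
  \<comment> \<open>A solution moves by at most twice the norm of the initial value. So it stays in the ball of
    radius \<open>r\<close>, where the cut-off is the identity, if it starts in the ball of radius \<open>r / 3\<close>.\<close>
  have u_bound: "norm (u (t, x)) \<le> 4 * (1/2 * norm x)" for t x
  proof (rule integral_equation_bound[OF u(3) _ u(2)])
    show "f (s, x, u (s, x)) = 0" if "s \<notin> {0..1}" for s by (simp add: f_def F_out[OF that])
    have "f (s, 0, 0) = 0" for s using r(1) by (simp add: f_def radial_cutoff_id F0)
    then have half: "norm (f (s, x, u (s, x))) \<le> 1/2 * norm (x + u (s, x))" for s
      using f_diff[of s x "u (s, x)" 0 0] by simp
    show "norm (f (s, x, u (s, x))) \<le> 1/2 * norm x + 3/4 * norm (u (s, x))" for s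
      using norm_triangle_ineq[of x "u (s, x)"] norm_ge_zero[of "u (s, x)"] half[of s]
      by linarith
  qed
  have phi_ball: "norm (\<phi> t x) < r" if "norm x < r / 3" for t x
    using u_bound[of t x] norm_triangle_ineq[of x "u (t, x)"] that by (simp add: \<phi>_def)
  have phiR: "\<phi> t x \<in> ball 0 R" "\<phi> t x \<in> ball 0 (2 * r)" if "norm x < r / 3" for t x
  proof -
    show "\<phi> t x \<in> ball 0 (2 * r)" using phi_ball[OF that, of t] r(1) by simp
    then show "\<phi> t x \<in> ball 0 R" using r(2) by blast
  qed
  have phi': "((\<lambda>t. \<phi> t x) has_vector_derivative F (t, \<phi> t x)) (at t)" if x: "norm x < r / 3" for t x
  proof -
    have "f (t, x, u (t, x)) = F (t, \<phi> t x)"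
      using phi_ball[OF x, of t] r(1) by (simp add: f_def \<phi>_def radial_cutoff_id)
    then show ?thesis using u(4)[where x=x and t=t] unfolding \<phi>_def
      by (auto intro!: derivative_eq_intros)
  qed
  \<comment> \<open>\<open>Z x v t\<close> is the derivative of the flow \<open>\<phi> t\<close> at \<open>x\<close> in the direction \<open>v\<close>.\<close>
  define Z where "Z x v t = v + frechet_derivative u (at (t, x)) (0, v)" for x v t
  have Z': "(Z x v has_vector_derivative frechet_derivative F (at (t, \<phi> t x)) (0, Z x v t)) (at t)"
    if x: "norm x < r / 3" for x v t
  proof -
    let ?p = "(t, x, u (t, x))" and ?c = "frechet_derivative u (at (t, x)) (0, v)"
    have "((\<lambda>p. (fst p, fst (snd p) + snd (snd p))) has_derivative (\<lambda>d. (fst d, fst (snd d) + snd (snd d)))) (at ?p)"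
      by (auto intro!: derivative_eq_intros)
    from has_derivative_compose[OF this, of F "frechet_derivative F (at (t, \<phi> t x))"] DF[OF phiR(1)[OF x]]
    have "((\<lambda>p. F (fst p, fst (snd p) + snd (snd p))) has_derivative
        (\<lambda>d. frechet_derivative F (at (t, \<phi> t x)) (fst d, fst (snd d) + snd (snd d)))) (at ?p)"
      by (simp add: \<phi>_def)
    then have "(f has_derivative
        (\<lambda>d. frechet_derivative F (at (t, \<phi> t x)) (fst d, fst (snd d) + snd (snd d)))) (at ?p)"
    proof (rule has_derivative_transform_within_open[of _ _ _ _ "(\<lambda>p. fst (snd p) + snd (snd p)) -` ball 0 r"])
      show "open ((\<lambda>p :: real \<times> (complex \<times> complex) \<times> (complex \<times> complex). fst (snd p) + snd (snd p)) -` ball 0 r)"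
        by (intro open_vimage open_ball continuous_on_add continuous_on_fst continuous_on_snd continuous_on_id)
      show "?p \<in> (\<lambda>p. fst (snd p) + snd (snd p)) -` ball 0 r" using phi_ball[OF x, of t] by (simp add: \<phi>_def)
    qed (use r(1) in \<open>auto simp: f_def radial_cutoff_id\<close>)
    from frechet_eq[OF this, of "(0, v, ?c)"]
    have "frechet_derivative f (at ?p) (0, v, ?c) = frechet_derivative F (at (t, \<phi> t x)) (0, Z x v t)"
      by (simp add: Z_def)
    then show ?thesis using u(5)[where x=x and t=t and v=v] unfolding Z_def
      by (auto intro!: derivative_eq_intros)
  qed
  have Z0: "Z x v 0 = v" for x v by (simp add: Z_def u(6))
  \<comment> \<open>The equation that defines \<open>F\<close>, differentiated in the direction \<open>a\<close>.\<close>
  have lin_eq: "std_form (frechet_derivative F (at (t, y)) (0, a)) v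
      + smooth_step t * (D\<sigma> y (F (t, y)) v a + \<sigma> y (frechet_derivative F (at (t, y)) (0, a)) v)
      = - smooth_step' t * (frechet_derivative \<Lambda> (at y) a \<bullet> v)" if y: "y \<in> ball 0 R" for t y a v
  proof -
    have bl: "bounded_linear (\<lambda>z. std_form z v)"
      using bilinear_linear(2)[OF bilinear_std_form] linear_conv_bounded_linear by blast
    have D1: "((\<lambda>x. \<sigma> x (F (t, x)) v) has_derivative (\<lambda>a. D\<sigma> y (F (t, y)) v a +
        \<sigma> y (frechet_derivative F (at (t, y)) (0, a)) v + \<sigma> y (F (t, y)) 0)) (at y)"
      by (rule bilinear_family_has_derivative[OF open_ball bilinear_sigma smooth_sigma inb[OF y] has_derivative_ident DFx[OF y] has_derivative_const])
    have "((\<lambda>x. moser_form t x (F (t, x)) v) has_derivative (\<lambda>a. std_form (frechet_derivative F (at (t, y)) (0, a)) v +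
       smooth_step t * (D\<sigma> y (F (t, y)) v a + \<sigma> y (frechet_derivative F (at (t, y)) (0, a)) v + \<sigma> y (F (t, y)) 0))) (at y)"
      unfolding moser_form_def
      by (intro has_derivative_add bounded_linear.has_derivative[OF bl] DFx[OF y] has_derivative_mult_right D1)
    moreover have "((\<lambda>x. moser_form t x (F (t, x)) v) has_derivative (\<lambda>a. - smooth_step' t * (frechet_derivative \<Lambda> (at y) a \<bullet> v))) (at y)"
      by (rule has_derivative_transform_within_open[OF has_derivative_mult_right[OF has_derivative_inner_left[OF smooth_has_derivative[OF L(1) inb[OF y]]]] open_ball y])
        (simp add: eqn)
    ultimately have "std_form (frechet_derivative F (at (t, y)) (0, a)) v +
       smooth_step t * (D\<sigma> y (F (t, y)) v a + \<sigma> y (frechet_derivative F (at (t, y)) (0, a)) v + \<sigma> y (F (t, y)) 0)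
       = - smooth_step' t * (frechet_derivative \<Lambda> (at y) a \<bullet> v)"
      by (rule has_derivative_unique[THEN fun_cong])
    then show ?thesis using sigma_zero(2)[OF inb[OF y]] by simp
  qed
  have pullback: "moser_form 1 (\<phi> 1 x) (Z x a 1) (Z x b 1) = std_form a b" if x: "norm x < r / 3" for x a b
  proof -
    define P where "P t = moser_form t (\<phi> t x) (Z x a t) (Z x b t)" for t
    have "(P has_real_derivative 0) (at t)" for t
    proof -
      let ?y = "\<phi> t x" and ?A = "Z x a t" and ?B = "Z x b t"
      let ?F = "F (t, ?y)"
      let ?A' = "frechet_derivative F (at (t, ?y)) (0, ?A)" and ?B' = "frechet_derivative F (at (t, ?y)) (0, ?B)"
      have yR: "?y \<in> ball 0 R" by (rule phiR(1)[OF x])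
      note y = inb[OF yR]
      note dA = Z'[OF x, of a t, unfolded has_vector_derivative_def]
      note dB = Z'[OF x, of b t, unfolded has_vector_derivative_def]
      have D1: "((\<lambda>t. std_form (Z x a t) (Z x b t)) has_derivative
          (\<lambda>h. frechet_derivative (\<lambda>y :: real. std_form ?A ?B) (at t) h + std_form (h *\<^sub>R ?A') ?B + std_form ?A (h *\<^sub>R ?B'))) (at t)"
        by (rule bilinear_family_has_derivative[OF open_UNIV bilinear_std_form _ UNIV_I has_derivative_ident dA dB]) simp
      have D2: "((\<lambda>t. \<sigma> (\<phi> t x) (Z x a t) (Z x b t)) has_derivative
          (\<lambda>h. D\<sigma> ?y ?A ?B (h *\<^sub>R ?F) + \<sigma> ?y (h *\<^sub>R ?A') ?B + \<sigma> ?y ?A (h *\<^sub>R ?B'))) (at t)"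
        by (rule bilinear_family_has_derivative[OF open_ball bilinear_sigma smooth_sigma y
              phi'[OF x, of t, unfolded has_vector_derivative_def] dA dB])
      have D1': "((\<lambda>t. std_form (Z x a t) (Z x b t)) has_real_derivative std_form ?A' ?B + std_form ?A ?B') (at t)"
        using D1 by (simp add: has_field_derivative_def bilinear_lmul[OF bilinear_std_form]
            bilinear_rmul[OF bilinear_std_form] distrib_left[symmetric] mult_commute_abs frechet_derivative_const)
      have D2': "((\<lambda>t. \<sigma> (\<phi> t x) (Z x a t) (Z x b t)) has_real_derivative
          D\<sigma> ?y ?A ?B ?F + \<sigma> ?y ?A' ?B + \<sigma> ?y ?A ?B') (at t)"
        using D2 by (simp add: has_field_derivative_def bilinear_lmul[OF bilinear_sigma[OF y]]
            bilinear_rmul[OF bilinear_sigma[OF y]] linear_cmul[OF Dsigma_linear[OF y]] distrib_left[symmetric] mult_commute_abs)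
      from DERIV_add[OF D1' DERIV_mult[OF smooth_step_has_real_derivative D2']]
      show ?thesis unfolding P_def moser_form_def
      proof (rule DERIV_cong)
        \<comment> \<open>Moser's computation: the Lie derivative of \<open>moser_form t\<close> along \<open>F\<close> cancels its time
          derivative.\<close>
        have e1: "std_form ?A' ?B = - smooth_step' t * (frechet_derivative \<Lambda> (at ?y) ?A \<bullet> ?B) - smooth_step t * (D\<sigma> ?y ?F ?B ?A + \<sigma> ?y ?A' ?B)"
          using lin_eq[OF yR, of t ?A ?B] by linarith
        have e2: "std_form ?A ?B' = smooth_step' t * (frechet_derivative \<Lambda> (at ?y) ?B \<bullet> ?A) + smooth_step t * (D\<sigma> ?y ?F ?A ?B + \<sigma> ?y ?B' ?A)"
          using lin_eq[OF yR, of t ?B ?A] alternating_antisym[OF bilinear_std_form std_form_alternating, of ?A ?B'] by linarith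
        have e3: "\<sigma> ?y ?B' ?A = - \<sigma> ?y ?A ?B'" by (rule sigma_antisym[OF y])
        have e4: "D\<sigma> ?y ?A ?B ?F = D\<sigma> ?y ?F ?B ?A - D\<sigma> ?y ?F ?A ?B"
          using closed_sigma[OF y, of ?A ?B ?F] Dsigma_antisym[OF y, of ?B ?F ?A] by linarith
        have e5: "\<sigma> ?y ?A ?B = frechet_derivative \<Lambda> (at ?y) ?A \<bullet> ?B - frechet_derivative \<Lambda> (at ?y) ?B \<bullet> ?A"
          using L(2)[OF y, of ?A ?B] by simp
        show "std_form ?A' ?B + std_form ?A ?B' + (smooth_step' t * \<sigma> ?y ?A ?B +
            (D\<sigma> ?y ?A ?B ?F + \<sigma> ?y ?A' ?B + \<sigma> ?y ?A ?B') * smooth_step t) = 0"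
          unfolding e1 e2 e3 e4 e5 by (simp add: algebra_simps)
      qed
    qed
    then have "P 1 = P 0" using DERIV_isconst_all by blast
    then show ?thesis by (simp add: P_def Z0 moser_form_def smooth_step_nonpos)
  qed
  define \<Psi> where "\<Psi> x = x + u (1, x)" for x
  have Psi_phi: "\<Psi> = \<phi> 1" by (simp add: \<Psi>_def \<phi>_def fun_eq_iff)
  have smu1: "smooth_on UNIV (\<lambda>x. u (1, x))"
    by (rule smooth_on_compose[OF smu]) (intro smooth_intros open_UNIV UNIV_I)+
  have smPsi: "smooth_on S \<Psi>" for S
  proof (rule smooth_on_subset[OF _ subset_UNIV])
    show "smooth_on UNIV \<Psi>" unfolding \<Psi>_def by (intro smooth_intros open_UNIV smu1)
  qed
  have DPsi: "frechet_derivative \<Psi> (at x) v = Z x v 1" for x v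
  proof -
    have "((\<lambda>x. u (1, x)) has_derivative (\<lambda>a. frechet_derivative u (at (1, x)) (0, a))) (at x)"
      by (rule has_derivative_compose[of "\<lambda>x. (1, x)" "\<lambda>a. (0, a)" x UNIV u])
        (use smooth_has_derivative[OF smu] in \<open>auto intro!: derivative_eq_intros\<close>)
    from has_derivative_add[OF has_derivative_ident this]
    show ?thesis unfolding \<Psi>_def Z_def by (rule frechet_eq)
  qed
  have form: "\<omega> (\<Psi> x) (frechet_derivative \<Psi> (at x) a) (frechet_derivative \<Psi> (at x) b) = std_form a b"
    if "norm x < r / 3" for x a b
    unfolding DPsi unfolding Psi_phi
    using pullback[OF that, of a b] by (simp add: moser_form_def \<sigma>_def smooth_step_ge_1)
  have injD: "inj (frechet_derivative \<Psi> (at x))" if x: "norm x < r / 3" for x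
  proof -
    have lin: "linear (frechet_derivative \<Psi> (at x))"
      using has_derivative_linear[OF smooth_has_derivative[OF smPsi[of UNIV]]] by simp
    have "v = 0" if "frechet_derivative \<Psi> (at x) v = 0" for v
    proof -
      have "\<Psi> x \<in> ball 0 \<rho>" unfolding Psi_phi by (rule inb[OF phiR(1)[OF x]])
      then have "std_form v (\<i> * fst v, \<i> * snd v) = 0"
        using form[OF x, of v "(\<i> * fst v, \<i> * snd v)"] that bilinear_lzero[OF bil] by simp
      then show ?thesis by (simp add: std_form_compatible)
    qed
    then show ?thesis using linear_injective_0[OF lin] by blast
  qed
  obtain r0 where r0: "r0 > 0" "ball (0 :: complex \<times> complex) r0 \<subseteq> ball 0 (r / 3)" "inj_on \<Psi> (ball 0 r0)"
    "\<And>x. x \<in> ball 0 r0 \<Longrightarrow> inj (frechet_derivative \<Psi> (at x))"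
  proof (rule smooth_local_diffeo[OF open_ball smPsi[of "ball 0 (r / 3)"], of 0])
    show "0 \<in> ball 0 (r / 3)" using r(1) by simp
    show "inj (frechet_derivative \<Psi> (at 0))" by (rule injD) (use r(1) in simp)
  qed (rule that)
  have small: "norm x < r / 3" if "x \<in> ball 0 r0" for x :: "complex \<times> complex"
  proof -
    have "x \<in> ball 0 (r / 3)" using that r0(2) by blast
    then show ?thesis by simp
  qed
  show ?thesis
  proof (rule that[OF r0(1) smPsi _ r0(3) _ r0(4)])
    show "\<Psi> x \<in> ball 0 \<rho>" if "x \<in> ball 0 r0" for x
      unfolding Psi_phi by (rule inb[OF phiR(1)[OF small[OF that]]])
    show "\<Psi> 0 = 0" using u_bound[of 1 0] by (simp add: \<Psi>_def)
    show "\<omega> (\<Psi> x) (frechet_derivative \<Psi> (at x) a) (frechet_derivative \<Psi> (at x) b) = std_form a b"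
      if "x \<in> ball 0 r0" for x a b by (rule form[OF small[OF that]])
    show "fst (\<Psi> x) = 0 \<longleftrightarrow> fst x = 0" if x: "x \<in> ball 0 r0" for x
    proof -
      note xs = small[OF x]
      have d: "((\<lambda>t. fst (\<phi> t x)) has_vector_derivative fst (F (t, \<phi> t x))) (at t)" for t
        using bounded_linear.has_vector_derivative[OF bounded_linear_fst phi'[OF xs]] by simp
      have b: "norm (fst (F (t, \<phi> t x))) \<le> 1/2 * norm (fst (\<phi> t x))" for t
      proof -
        let ?y = "\<phi> t x" and ?yz = "(0 :: complex, snd (\<phi> t x))"
        have n: "norm ?yz \<le> norm ?y" using norm_snd_le[of "snd ?y" "fst ?y"] by (simp add: norm_Pair)
        have y0: "?yz \<in> ball 0 (2 * r)"
          using n phiR(2)[OF xs, of t] unfolding mem_ball_0 by linarith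
        have "fst (F (t, ?yz)) = 0" by (rule fstF) (use y0 r(2) in blast)
        then have "norm (fst (F (t, ?y))) \<le> norm (F (t, ?y) - F (t, ?yz))"
          using norm_fst_le[of "fst (F (t, ?y) - F (t, ?yz))" "snd (F (t, ?y) - F (t, ?yz))", unfolded prod.collapse]
          by simp
        also have "\<dots> \<le> \<eta> * norm (?y - ?yz)" by (rule FL[OF phiR(2)[OF xs] y0])
        also have "norm (?y - ?yz) = norm (fst ?y)" by (cases ?y) (simp add: norm_Pair)
        also have "\<eta> * norm (fst ?y) \<le> 1/2 * norm (fst ?y)" using eta(2) by (intro mult_right_mono) auto
        finally show ?thesis .
      qed
      have p0: "\<phi> 0 x = x" using u(2)[of 0 x] by (simp add: \<phi>_def)
      show ?thesis
        using zero_of_small_derivative[OF d b, of 0 1] zero_of_small_derivative[OF d b, of 1 0]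
        unfolding Psi_phi p0 by auto
    qed
  qed
qed

end

section \<open>Charts and tangent spaces of a smooth manifold\<close>

type_synonym c2 = "complex \<times> complex"

locale smooth_manifold =
  fixes A :: "('a::topological_space) chart set"
  assumes smooth_atlas: "smooth_structure A"
begin

lemma chart: "c \<in> A \<Longrightarrow> is_chart c"
  using smooth_atlas by (auto simp: smooth_structure_def)

lemma chart_compatible: "c \<in> A \<Longrightarrow> c' \<in> A \<Longrightarrow> compatible c c'"
  using smooth_atlas by (auto simp: smooth_structure_def)

lemma chart_maximal: "is_chart c \<Longrightarrow> (\<And>c'. c' \<in> A \<Longrightarrow> compatible c c') \<Longrightarrow> c \<in> A"
  using smooth_atlas unfolding smooth_structure_def by blast

lemma open_dom: "c \<in> A \<Longrightarrow> open (chart_dom c)"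
  and open_image: "c \<in> A \<Longrightarrow> open (coord c ` chart_dom c)"
  using chart by (auto simp: is_chart_def)

lemma chart_inv_coord [simp]: "c \<in> A \<Longrightarrow> q \<in> chart_dom c \<Longrightarrow> chart_inv c (coord c q) = q"
  using chart by (auto simp: is_chart_def homeomorphism_def)

lemma coord_chart_inv [simp]: "c \<in> A \<Longrightarrow> x \<in> coord c ` chart_dom c \<Longrightarrow> coord c (chart_inv c x) = x"
  using chart by (auto simp: is_chart_def homeomorphism_def)

lemma chart_inv_dom [simp]: "c \<in> A \<Longrightarrow> x \<in> coord c ` chart_dom c \<Longrightarrow> chart_inv c x \<in> chart_dom c"
  using chart by (auto simp: is_chart_def homeomorphism_def)

lemma continuous_coord: "c \<in> A \<Longrightarrow> continuous_on (chart_dom c) (coord c)"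
  and continuous_chart_inv: "c \<in> A \<Longrightarrow> continuous_on (coord c ` chart_dom c) (chart_inv c)"
  using chart by (auto simp: is_chart_def homeomorphism_def)

lemma inj_on_coord: "c \<in> A \<Longrightarrow> inj_on (coord c) (chart_dom c)"
  by (rule inj_on_inverseI[of _ "chart_inv c"]) auto

lemma open_coord_image:
  assumes "c \<in> A" "open W" "W \<subseteq> chart_dom c" shows "open (coord c ` W)"
proof -
  have "coord c ` W = coord c ` chart_dom c \<inter> chart_inv c -` W"
    using assms by (force simp: image_iff)
  then show ?thesis
    using continuous_open_preimage[OF continuous_chart_inv[OF assms(1)] open_image[OF assms(1)] assms(2)] by simp
qed

lemma open_chart_inv_image:
  assumes "c \<in> A" "open V" "V \<subseteq> coord c ` chart_dom c" shows "open (chart_inv c ` V)"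
proof -
  have "chart_inv c ` V = chart_dom c \<inter> coord c -` V"
  proof (intro equalityI subsetI)
    fix q assume "q \<in> chart_dom c \<inter> coord c -` V"
    then have "q = chart_inv c (coord c q)" "coord c q \<in> V" using assms(1) by auto
    then show "q \<in> chart_inv c ` V" by (rule image_eqI)
  qed (use assms in auto)
  then show ?thesis
    using continuous_open_preimage[OF continuous_coord[OF assms(1)] open_dom[OF assms(1)] assms(2)] by simp
qed

lemma open_overlap:
  assumes "c \<in> A" "c' \<in> A" shows "open (coord c ` (chart_dom c \<inter> chart_dom c'))"
  using assms by (intro open_coord_image open_Int open_dom) auto

lemma smooth_transition:
  "c \<in> A \<Longrightarrow> c' \<in> A \<Longrightarrow> smooth_on (coord c ` (chart_dom c \<inter> chart_dom c')) (transition c c')"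
  using chart_compatible by (auto simp: compatible_def)

lemma transition_coord [simp]: "c \<in> A \<Longrightarrow> q \<in> chart_dom c \<Longrightarrow> transition c c' (coord c q) = coord c' q"
  by (simp add: transition_def)

lemma transition_has_derivative:
  assumes "c \<in> A" "c' \<in> A" "q \<in> chart_dom c" "q \<in> chart_dom c'"
  shows "(transition c c' has_derivative frechet_derivative (transition c c') (at (coord c q))) (at (coord c q))"
  by (rule smooth_has_derivative[OF smooth_transition[OF assms(1,2)]]) (use assms in auto)

lemma transition_inverse:
  assumes "c \<in> A" "c' \<in> A" "q \<in> chart_dom c" "q \<in> chart_dom c'"
  shows "frechet_derivative (transition c' c) (at (coord c' q)) (frechet_derivative (transition c c') (at (coord c q)) u) = u"
proof -
  have "((\<lambda>x. transition c' c (transition c c' x)) has_derivative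
      (\<lambda>u. frechet_derivative (transition c' c) (at (coord c' q)) (frechet_derivative (transition c c') (at (coord c q)) u))) (at (coord c q))"
    by (rule has_derivative_compose[OF transition_has_derivative[OF assms]])
      (use transition_has_derivative[OF assms(2,1,4,3)] assms in simp)
  moreover have "((\<lambda>x. transition c' c (transition c c' x)) has_derivative (\<lambda>u. u)) (at (coord c q))"
    by (rule has_derivative_transform_within_open[OF has_derivative_ident open_overlap[OF assms(1,2)]])
      (use assms in auto)
  ultimately show ?thesis by (rule has_derivative_unique[THEN fun_cong])
qed

text \<open>
  By maximality of the atlas, new coordinates \<open>x\<close> may be introduced in a chart through any
  injective smooth immersion \<open>\<Psi>\<close> between open sets: \<open>d\<close> is the chart with \<open>coord c = \<Psi> (coord d)\<close>.
\<close>

lemma parametrized_chart: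
  assumes c: "c \<in> A" and W: "open W" and sm: "smooth_on W \<Psi>" and inj: "inj_on \<Psi> W"
    and injD: "\<And>x. x \<in> W \<Longrightarrow> inj (frechet_derivative \<Psi> (at x))"
    and img: "\<And>x. x \<in> W \<Longrightarrow> \<Psi> x \<in> coord c ` chart_dom c"
  obtains d where "d \<in> A" "coord d ` chart_dom d = W" "chart_dom d \<subseteq> chart_dom c"
    "\<And>q. q \<in> chart_dom d \<Longrightarrow> coord c q = \<Psi> (coord d q)"
    "\<And>x. x \<in> W \<Longrightarrow> chart_inv d x = chart_inv c (\<Psi> x)"
    "chart_dom d = chart_inv c ` \<Psi> ` W"
proof -
  define d where "d = (chart_inv c ` \<Psi> ` W, inv_into W \<Psi> \<circ> coord c)"
  note inv = smooth_inverse[OF W sm inj injD]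
  have imgW: "\<Psi> ` W \<subseteq> coord c ` chart_dom c" using img by auto
  have co: "coord d (chart_inv c (\<Psi> x)) = x" if "x \<in> W" for x
    using that img c inj by (simp add: d_def)
  have dom: "chart_dom d = chart_inv c ` \<Psi> ` W" by (simp add: d_def)
  have dsub: "chart_dom d \<subseteq> chart_dom c" unfolding dom using img c by auto
  have image: "coord d ` chart_dom d = W"
    unfolding dom by (force simp: co image_iff)
  have cd: "coord c q = \<Psi> (coord d q)" if "q \<in> chart_dom d" for q
    using that co img c unfolding dom by auto
  have injd: "inj_on (coord d) (chart_dom d)" unfolding dom by (auto simp: inj_on_def co)
  have ci: "chart_inv d x = chart_inv c (\<Psi> x)" if "x \<in> W" for x
  proof -
    have "chart_inv c (\<Psi> x) \<in> chart_dom d" unfolding dom using that by auto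
    then show ?thesis using inv_into_f_f[OF injd, of "chart_inv c (\<Psi> x)"] co[OF that] by (simp add: chart_inv_def)
  qed
  have od: "open (chart_dom d)" unfolding dom by (rule open_chart_inv_image[OF c inv(1) imgW])
  have "is_chart d"
    unfolding is_chart_def image homeomorphism_def
  proof (intro conjI od W)
    show "\<forall>x\<in>chart_dom d. chart_inv d (coord d x) = x" unfolding dom by (auto simp: co ci)
    show "\<forall>y\<in>W. coord d (chart_inv d y) = y" by (simp add: co ci)
    show "chart_inv d ` W = chart_dom d" unfolding dom image_image by (rule image_cong) (auto simp: ci)
    show "continuous_on (chart_dom d) (coord d)"
    proof -
      have "continuous_on (chart_dom d) (\<lambda>q. inv_into W \<Psi> (coord c q))"
        by (rule continuous_on_compose2[OF smooth_on_continuous[OF inv(2)] continuous_on_subset[OF continuous_coord[OF c] dsub]])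
          (use dom img c in auto)
      then show ?thesis by (simp add: d_def o_def)
    qed
    have "continuous_on W (\<lambda>x. chart_inv c (\<Psi> x))"
      by (rule continuous_on_compose2[OF continuous_chart_inv[OF c] smooth_on_continuous[OF sm] imgW])
    then show "continuous_on W (chart_inv d)" using ci by (simp cong: continuous_on_cong)
  qed (use image in auto)
  moreover have "compatible d c'" if c': "c' \<in> A" for c'
    unfolding compatible_def
  proof
    let ?V = "chart_dom d \<inter> chart_dom c'"
    have oV: "open ?V" using od open_dom[OF c'] by blast
    have eqV: "coord d ` ?V = W \<inter> \<Psi> -` (coord c ` ?V)"
    proof (intro equalityI subsetI)
      fix x assume "x \<in> W \<inter> \<Psi> -` (coord c ` ?V)"
      then obtain q where q: "q \<in> ?V" "\<Psi> x = coord c q" "x \<in> W" by auto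
      then have "x = coord d q" using cd[of q] inj image by (auto simp: inj_on_def)
      then show "x \<in> coord d ` ?V" using q by auto
    qed (use cd image in auto)
    have ocV: "open (coord c ` ?V)" by (rule open_coord_image[OF c oV]) (use dsub in auto)
    have o1: "open (coord d ` ?V)"
      unfolding eqV by (rule continuous_open_preimage[OF smooth_on_continuous[OF sm] W ocV])
    have o2: "open (coord c' ` ?V)" by (rule open_coord_image[OF c' oV]) auto
    show "smooth_on (coord d ` ?V) (transition d c')"
    proof (rule smooth_on_cong[OF o1])
      show "smooth_on (coord d ` ?V) (\<lambda>x. transition c c' (\<Psi> x))"
        by (rule smooth_on_compose[OF smooth_transition[OF c c'] smooth_on_subset[OF sm] o1 open_overlap[OF c c']])
          (use image cd dsub in \<open>auto simp flip: cd\<close>)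
      show "transition c c' (\<Psi> x) = transition d c' x" if "x \<in> coord d ` ?V" for x
      proof -
        have "x \<in> W" using that image by auto
        then show ?thesis by (simp add: transition_def ci)
      qed
    qed
    show "smooth_on (coord c' ` ?V) (transition c' d)"
    proof (rule smooth_on_cong[OF o2])
      show "smooth_on (coord c' ` ?V) (\<lambda>x. inv_into W \<Psi> (transition c' c x))"
      proof (rule smooth_on_compose[OF inv(2) smooth_on_subset[OF smooth_transition[OF c' c]] o2 inv(1)])
        show "coord c' ` ?V \<subseteq> coord c' ` (chart_dom c' \<inter> chart_dom c)" using dsub by auto
        show "transition c' c x \<in> \<Psi> ` W" if x: "x \<in> coord c' ` ?V" for x
        proof -
          obtain q where q: "q \<in> ?V" "x = coord c' q" using x by auto
          then show ?thesis using c' cd[of q] image by auto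
        qed
      qed
      show "inv_into W \<Psi> (transition c' c x) = transition c' d x" for x
        by (simp add: transition_def d_def)
    qed
  qed
  ultimately have "d \<in> A" by (rule chart_maximal)
  then show ?thesis using that image dsub cd ci dom by blast
qed

lemma restricted_chart:
  assumes c: "c \<in> A" and W: "open W" "W \<subseteq> coord c ` chart_dom c"
  obtains d where "d \<in> A" "coord d ` chart_dom d = W" "chart_dom d = chart_inv c ` W"
    "\<And>q. q \<in> chart_dom d \<Longrightarrow> coord d q = coord c q" "\<And>x. x \<in> W \<Longrightarrow> chart_inv d x = chart_inv c x"
    "chart_dom d \<subseteq> chart_dom c"
proof (rule parametrized_chart[OF c W(1), of "\<lambda>x. x"])
  show "inj (frechet_derivative (\<lambda>x. x) (at x))" for x :: c2
    by (simp add: frechet_derivative_ident)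
qed (use W that in \<open>auto intro: smooth_on_id\<close>)

lemma curve_restrict:
  assumes c: "c \<in> A" and e: "0 < (e :: real)" "\<gamma> ` {-e<..<e} \<subseteq> S \<inter> chart_dom c"
    and sm: "smooth_on {-e<..<e} (coord c \<circ> \<gamma>)" and W: "open W" "\<gamma> 0 \<in> W"
  obtains e' where "0 < e'" "e' \<le> e" "\<gamma> ` {-e'<..<e'} \<subseteq> W"
proof -
  have "continuous_on {-e<..<e} (\<lambda>s. chart_inv c ((coord c \<circ> \<gamma>) s))"
    by (rule continuous_on_compose2[OF continuous_chart_inv[OF c] smooth_on_continuous[OF sm]]) (use e(2) in auto)
  then have "continuous_on {-e<..<e} \<gamma>"
  proof (rule continuous_on_eq)
    fix s assume "s \<in> {-e<..<e}"
    then have "\<gamma> s \<in> chart_dom c" using e(2) by blast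
    then show "chart_inv c ((coord c \<circ> \<gamma>) s) = \<gamma> s" using c by simp
  qed
  then have "open ({-e<..<e} \<inter> \<gamma> -` W)" using continuous_open_preimage W(1) open_greaterThanLessThan by blast
  moreover have "0 \<in> {-e<..<e} \<inter> \<gamma> -` W" using e(1) W(2) by auto
  ultimately obtain r where r: "r > 0" "ball 0 r \<subseteq> {-e<..<e} \<inter> \<gamma> -` W"
    using open_contains_ball by blast
  show ?thesis
  proof (rule that[of "min r e"])
    have "s \<in> ball 0 r" if "s \<in> {-min r e<..<min r e}" for s using that by (auto simp: dist_real_def)
    then show "\<gamma> ` {- min r e<..<min r e} \<subseteq> W" using r(2) by blast
  qed (use r e in auto)
qed

lemma tangent_spaceE:
  assumes "u \<in> tangent_space c S q"
  obtains \<gamma> e where "0 < (e :: real)" "\<gamma> ` {-e<..<e} \<subseteq> S \<inter> chart_dom c" "\<gamma> 0 = q"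
    "smooth_on {-e<..<e} (coord c \<circ> \<gamma>)" "((coord c \<circ> \<gamma>) has_vector_derivative u) (at 0)"
  using assms unfolding tangent_space_def by blast

lemma tangent_space_local:
  assumes c: "c \<in> A" and W: "open W" "q \<in> W" "S \<inter> W \<subseteq> S'" and u: "u \<in> tangent_space c S q"
  shows "u \<in> tangent_space c S' q"
proof -
  obtain \<gamma> e where g: "0 < (e :: real)" "\<gamma> ` {-e<..<e} \<subseteq> S \<inter> chart_dom c" "\<gamma> 0 = q"
    "smooth_on {-e<..<e} (coord c \<circ> \<gamma>)" "((coord c \<circ> \<gamma>) has_vector_derivative u) (at 0)"
    by (rule tangent_spaceE[OF u])
  obtain e' where e': "0 < e'" "e' \<le> e" "\<gamma> ` {-e'<..<e'} \<subseteq> W"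
    by (rule curve_restrict[OF c g(1,2,4) W(1)]) (use g(3) W(2) in auto)
  have sub: "{-e'<..<e'} \<subseteq> {-e<..<e}" using e'(2) by auto
  have "\<gamma> ` {-e'<..<e'} \<subseteq> S' \<inter> chart_dom c" using sub e'(3) g(2) W(3) by blast
  then show ?thesis unfolding tangent_space_def
    using e'(1) g(3,5) smooth_on_subset[OF g(4) sub] by blast
qed

text \<open>
  Tangent vectors transform by the derivative of the coordinate change, since the same curve serves
  in both charts.
\<close>

lemma tangent_space_transform:
  assumes c: "c \<in> A" "c' \<in> A" and q: "q \<in> chart_dom c" "q \<in> chart_dom c'" and u: "u \<in> tangent_space c S q"
  shows "frechet_derivative (transition c c') (at (coord c q)) u \<in> tangent_space c' S q"
proof -
  let ?D = "frechet_derivative (transition c c') (at (coord c q))"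
  obtain \<gamma> e where g: "0 < (e :: real)" "\<gamma> ` {-e<..<e} \<subseteq> S \<inter> chart_dom c" "\<gamma> 0 = q"
    "smooth_on {-e<..<e} (coord c \<circ> \<gamma>)" "((coord c \<circ> \<gamma>) has_vector_derivative u) (at 0)"
    by (rule tangent_spaceE[OF u])
  obtain e' where e': "0 < e'" "e' \<le> e" "\<gamma> ` {-e'<..<e'} \<subseteq> chart_dom c'"
    by (rule curve_restrict[OF c(1) g(1,2,4) open_dom[OF c(2)]]) (use g(3) q in auto)
  have sub: "{-e'<..<e'} \<subseteq> {-e<..<e}" using e'(2) by auto
  have dom: "\<gamma> s \<in> chart_dom c" "\<gamma> s \<in> chart_dom c'" if "s \<in> {-e'<..<e'}" for s
  proof -
    have "s \<in> {-e<..<e}" using that sub by blast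
    then show "\<gamma> s \<in> chart_dom c" using g(2) by blast
    show "\<gamma> s \<in> chart_dom c'" using that e'(3) by blast
  qed
  have eq: "transition c c' ((coord c \<circ> \<gamma>) s) = (coord c' \<circ> \<gamma>) s" if "s \<in> {-e'<..<e'}" for s
    using dom[OF that] c by simp
  have sm: "smooth_on {-e'<..<e'} (coord c' \<circ> \<gamma>)"
  proof (rule smooth_on_cong[OF open_greaterThanLessThan eq])
    show "smooth_on {-e'<..<e'} (\<lambda>s. transition c c' ((coord c \<circ> \<gamma>) s))"
      by (rule smooth_on_compose[OF smooth_transition[OF c] smooth_on_subset[OF g(4) sub] _ open_overlap[OF c]])
        (use dom in auto)
  qed
  have lin: "linear ?D" using transition_has_derivative[OF c q] has_derivative_linear by blast
  have "((\<lambda>s. transition c c' ((coord c \<circ> \<gamma>) s)) has_derivative (\<lambda>h. ?D (h *\<^sub>R u))) (at 0)"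
    by (rule has_derivative_compose[OF g(5)[unfolded has_vector_derivative_def]])
      (use transition_has_derivative[OF c q] g(3) in simp)
  then have "((coord c' \<circ> \<gamma>) has_derivative (\<lambda>h. ?D (h *\<^sub>R u))) (at 0)"
    by (rule has_derivative_transform_within_open[of _ _ _ _ "{-e'<..<e'}"]) (use e'(1) eq in auto)

  then have "((coord c' \<circ> \<gamma>) has_vector_derivative ?D u) (at 0)"
    by (simp add: has_vector_derivative_def linear_cmul[OF lin])
  moreover have "\<gamma> ` {-e'<..<e'} \<subseteq> S \<inter> chart_dom c'" using sub e'(3) g(2) by blast
  ultimately show ?thesis unfolding tangent_space_def using e'(1) g(3) sm by blast
qed

text \<open>
  Near \<open>q\<close> the set \<open>S\<close> is the image of the section \<open>\<tau>\<close> of a linear projection \<open>\<pi>\<close>. For \<open>\<pi> = fst\<close>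
  this covers graphs over the \<open>z\<close>-plane, for \<open>\<pi> = snd\<close> the vertical plane. A curve in \<open>S\<close> is \<open>\<tau>\<close> of
  its projection, which gives one inclusion; \<open>\<tau>\<close> of a straight line is a curve in \<open>S\<close>, which gives
  the other.
\<close>

lemma tangent_space_parametrized:
  fixes \<pi> :: "c2 \<Rightarrow> complex" and \<tau> :: "complex \<Rightarrow> c2"
  assumes c: "c \<in> A" and q: "q \<in> chart_dom c"
    and N: "open N" "coord c q \<in> N" "N \<subseteq> coord c ` chart_dom c"
    and \<pi>: "bounded_linear \<pi>" and D: "open D" "\<And>x. x \<in> N \<Longrightarrow> \<pi> x \<in> D"
    and \<tau>: "smooth_on D \<tau>" "\<And>z. z \<in> D \<Longrightarrow> \<pi> (\<tau> z) = z"
    and S: "\<And>x. x \<in> N \<Longrightarrow> chart_inv c x \<in> S \<longleftrightarrow> x = \<tau> (\<pi> x)" and qS: "q \<in> S"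
  shows "tangent_space c S q = range (frechet_derivative \<tau> (at (\<pi> (coord c q))))"
proof (intro equalityI subsetI)
  let ?z = "\<pi> (coord c q)"
  have x0: "\<tau> ?z = coord c q" using S[OF N(2)] qS q c by simp
  have zD: "?z \<in> D" by (rule D(2)[OF N(2)])
  note Dt = smooth_has_derivative[OF \<tau>(1) zD]
  {
    fix u assume "u \<in> tangent_space c S q"
    then obtain \<gamma> e where g: "0 < (e :: real)" "\<gamma> ` {-e<..<e} \<subseteq> S \<inter> chart_dom c" "\<gamma> 0 = q"
      "smooth_on {-e<..<e} (coord c \<circ> \<gamma>)" "((coord c \<circ> \<gamma>) has_vector_derivative u) (at 0)"
      by (rule tangent_spaceE)
    have oN: "open (chart_inv c ` N)" by (rule open_chart_inv_image[OF c N(1,3)])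
    have qN: "q \<in> chart_inv c ` N" using N(2) q c by (metis chart_inv_coord imageI)
    obtain e' where e': "0 < e'" "e' \<le> e" "\<gamma> ` {-e'<..<e'} \<subseteq> chart_inv c ` N"
      by (rule curve_restrict[OF c g(1,2,4) oN]) (use g(3) qN in auto)
    have eq: "\<tau> (\<pi> ((coord c \<circ> \<gamma>) s)) = (coord c \<circ> \<gamma>) s" if s: "s \<in> {-e'<..<e'}" for s
    proof -
      obtain x where x: "x \<in> N" "\<gamma> s = chart_inv c x" using e'(3) s  by blast
      have "\<gamma> s \<in> S" using g(2) s e'(2) by auto
      then have "x = \<tau> (\<pi> x)" using S[OF x(1)] x(2) by simp
      then show ?thesis using x N(3) c by auto
    qed
    have "((\<lambda>s. \<tau> (\<pi> ((coord c \<circ> \<gamma>) s))) has_derivative (\<lambda>h. frechet_derivative \<tau> (at ?z) (\<pi> (h *\<^sub>R u)))) (at 0)"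
      by (rule has_derivative_compose[OF bounded_linear.has_derivative[OF \<pi> g(5)[unfolded has_vector_derivative_def]]])
        (use Dt g(3) in simp)
    then have "((coord c \<circ> \<gamma>) has_derivative (\<lambda>h. frechet_derivative \<tau> (at ?z) (\<pi> (h *\<^sub>R u)))) (at 0)"
      by (rule has_derivative_transform_within_open[of _ _ _ _ "{-e'<..<e'}"]) (use e'(1) eq in auto)

    from has_derivative_unique[OF this g(5)[unfolded has_vector_derivative_def], THEN fun_cong, of 1]
    have "u = frechet_derivative \<tau> (at ?z) (\<pi> u)" by simp
    then show "u \<in> range (frechet_derivative \<tau> (at ?z))" by blast
  }
  {
    fix u assume "u \<in> range (frechet_derivative \<tau> (at ?z))"
    then obtain \<zeta> where u: "u = frechet_derivative \<tau> (at ?z) \<zeta>" by blast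
    define l where "l s = ?z + s *\<^sub>R \<zeta>" for s :: real
    have sml: "smooth_on T l" if "open T" for T unfolding l_def by (intro smooth_intros that)
    have "open (D \<inter> \<tau> -` N)" by (rule continuous_open_preimage[OF smooth_on_continuous[OF \<tau>(1)] D(1) N(1)])
    then have "open (l -` (D \<inter> \<tau> -` N))"
      by (rule open_vimage) (auto intro: smooth_on_continuous[OF sml])
    moreover have "0 \<in> l -` (D \<inter> \<tau> -` N)" using zD x0 N(2) by (simp add: l_def)
    ultimately obtain e where e: "e > 0" "ball 0 e \<subseteq> l -` (D \<inter> \<tau> -` N)" using open_contains_ball by blast
    have le: "l s \<in> D" "\<tau> (l s) \<in> N" if "s \<in> {-e<..<e}" for s
      using e(2) that by (auto simp: subset_iff dist_real_def)
    define \<gamma> where "\<gamma> s = chart_inv c (\<tau> (l s))" for s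
    have cg: "\<tau> (l s) = (coord c \<circ> \<gamma>) s" if "s \<in> {-e<..<e}" for s
      using le[OF that] N(3) c by (auto simp: \<gamma>_def)
    have "smooth_on {-e<..<e} (\<lambda>s. \<tau> (l s))"
      by (rule smooth_on_compose[OF \<tau>(1) sml _ D(1) le(1)]) auto
    then have sm: "smooth_on {-e<..<e} (coord c \<circ> \<gamma>)"
      by (rule smooth_on_cong[where f="\<lambda>s. \<tau> (l s)", rotated 2]) (auto simp: cg)
    have "(l has_derivative (\<lambda>s. s *\<^sub>R \<zeta>)) (at 0)" unfolding l_def by (auto intro!: derivative_eq_intros)
    from has_derivative_compose[OF this, of \<tau>] Dt
    have "((\<lambda>s. \<tau> (l s)) has_derivative (\<lambda>s. frechet_derivative \<tau> (at ?z) (s *\<^sub>R \<zeta>))) (at 0)"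
      by (simp add: l_def)
    then have "((coord c \<circ> \<gamma>) has_derivative (\<lambda>s. frechet_derivative \<tau> (at ?z) (s *\<^sub>R \<zeta>))) (at 0)"
      by (rule has_derivative_transform_within_open[of _ _ _ _ "{-e<..<e}"]) (use e(1) cg in auto)

    then have "((coord c \<circ> \<gamma>) has_vector_derivative u) (at 0)"
      by (simp add: has_vector_derivative_def u linear_cmul[OF has_derivative_linear[OF Dt]])
    moreover have "\<gamma> ` {-e<..<e} \<subseteq> S \<inter> chart_dom c"
    proof
      fix y assume "y \<in> \<gamma> ` {-e<..<e}"
      then obtain s where s: "s \<in> {-e<..<e}" "y = \<gamma> s" by blast
      have "chart_inv c (\<tau> (l s)) \<in> S" using S[OF le(2)[OF s(1)]] \<tau>(2)[OF le(1)[OF s(1)]] by simp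
      then show "y \<in> S \<inter> chart_dom c" using le(2)[OF s(1)] N(3) c s(2) by (auto simp: \<gamma>_def)
    qed
    moreover have "\<gamma> 0 = q" using x0 q c by (simp add: \<gamma>_def l_def)
    ultimately show "u \<in> tangent_space c S q" unfolding tangent_space_def using e(1) sm by blast
  }
qed

end

section \<open>Darboux charts adapted to a symplectic surface\<close>

locale symplectic =
  fixes A :: "('a::{t2_space,second_countable_topology}) chart set" and \<omega> :: "'a form2"
  assumes manifold: "symplectic_manifold A \<omega>"
begin

sublocale smooth_manifold A
  using manifold by unfold_locales (simp add: symplectic_manifold_def)

lemma two_form: "two_form A \<omega>" and closed: "closed_form A \<omega>" and nondeg: "nondegenerate A \<omega>"
  using manifold by (auto simp: symplectic_manifold_def)

lemma form_bilinear: "c \<in> A \<Longrightarrow> q \<in> chart_dom c \<Longrightarrow> bilinear (\<omega> c q)"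
  and form_alternating: "c \<in> A \<Longrightarrow> q \<in> chart_dom c \<Longrightarrow> \<omega> c q u u = 0"
  and form_smooth: "c \<in> A \<Longrightarrow> smooth_on (coord c ` chart_dom c) (\<lambda>x. \<omega> c (chart_inv c x) u v)"
  using two_form unfolding two_form_def by blast+

lemma form_transform:
  "c \<in> A \<Longrightarrow> c' \<in> A \<Longrightarrow> q \<in> chart_dom c \<Longrightarrow> q \<in> chart_dom c' \<Longrightarrow>
    \<omega> c q u v = \<omega> c' q (frechet_derivative (transition c c') (at (coord c q)) u)
      (frechet_derivative (transition c c') (at (coord c q)) v)"
  using two_form unfolding two_form_def by blast

lemma form_nondegenerate: "c \<in> A \<Longrightarrow> q \<in> chart_dom c \<Longrightarrow> u \<noteq> 0 \<Longrightarrow> \<exists>v. \<omega> c q u v \<noteq> 0"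
  using nondeg unfolding nondegenerate_def by blast

lemma form_closed:
  assumes "c \<in> A" "x \<in> coord c ` chart_dom c"
  shows "frechet_derivative (\<lambda>x. \<omega> c (chart_inv c x) v w) (at x) u +
    frechet_derivative (\<lambda>x. \<omega> c (chart_inv c x) w u) (at x) v +
    frechet_derivative (\<lambda>x. \<omega> c (chart_inv c x) u v) (at x) w = 0"
  using closed assms unfolding closed_form_def by (metis coord_chart_inv chart_inv_dom)

text \<open>
  The coordinate change from \<open>d\<close> to \<open>c\<close> is \<open>\<Psi>\<close>, so this is the transformation law of the form.
\<close>

lemma parametrized_form:
  assumes c: "c \<in> A" "d \<in> A" and W: "open W" "coord d ` chart_dom d = W" "chart_dom d \<subseteq> chart_dom c"
    and ci: "\<And>x. x \<in> W \<Longrightarrow> chart_inv d x = chart_inv c (\<Psi> x)"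
    and img: "\<And>x. x \<in> W \<Longrightarrow> \<Psi> x \<in> coord c ` chart_dom c"
    and sm: "smooth_on W \<Psi>" and x: "x \<in> W"
  shows "\<omega> d (chart_inv d x) u v =
    \<omega> c (chart_inv c (\<Psi> x)) (frechet_derivative \<Psi> (at x) u) (frechet_derivative \<Psi> (at x) v)"
proof -
  have q: "chart_inv d x \<in> chart_dom d" "coord d (chart_inv d x) = x"
    using x c(2) W(2) by auto
  have "(transition d c has_derivative frechet_derivative \<Psi> (at x)) (at x)"
    by (rule has_derivative_transform_within_open[OF smooth_has_derivative[OF sm x] W(1) x])
      (simp add: transition_def ci img c)
  from frechet_eq[OF this] form_transform[OF c(2,1) q(1), of u v] W(3) q(1)
  show ?thesis by (simp add: q(2) ci[OF x, symmetric] subset_iff)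
qed

lemma surface_tangent_in_adapted_chart:
  assumes c: "c \<in> A" and q: "q \<in> chart_dom c" "q \<in> S"
    and S: "coord c ` (S \<inter> chart_dom c) = coord c ` chart_dom c \<inter> {x. snd x = 0}"
  shows "tangent_space c S q = {(\<zeta>, 0) |\<zeta>. True}"
    and "\<And>x. x \<in> coord c ` chart_dom c \<Longrightarrow> chart_inv c x \<in> S \<longleftrightarrow> snd x = 0"
proof -
  show iff: "chart_inv c x \<in> S \<longleftrightarrow> snd x = 0" if "x \<in> coord c ` chart_dom c" for x
  proof
    assume "chart_inv c x \<in> S"
    then have "chart_inv c x \<in> S \<inter> chart_dom c" using that c by simp
    then have "coord c (chart_inv c x) \<in> coord c ` (S \<inter> chart_dom c)" by (rule imageI)
    then show "snd x = 0" unfolding S using that c by simp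
  next
    assume "snd x = 0"
    then have "x \<in> coord c ` (S \<inter> chart_dom c)" unfolding S using that by simp
    then show "chart_inv c x \<in> S" using c by auto
  qed
  have D: "frechet_derivative (\<lambda>\<xi>. (\<xi>, 0 :: complex)) (at z) v = (v, 0)" for z v :: complex
    by (rule frechet_eq) (auto intro!: derivative_eq_intros)
  have "tangent_space c S q = range (frechet_derivative (\<lambda>\<xi>. (\<xi>, 0)) (at (fst (coord c q))))"
  proof (rule tangent_space_parametrized[OF c q(1) open_image[OF c] _ subset_refl bounded_linear_fst open_UNIV UNIV_I])
    show "smooth_on UNIV (\<lambda>\<xi>. (\<xi>, 0 :: complex))" for \<xi> :: complex by (intro smooth_intros open_UNIV)
    show "chart_inv c x \<in> S \<longleftrightarrow> x = (fst x, 0)" if "x \<in> coord c ` chart_dom c" for x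
      using iff[OF that] by (auto simp: prod_eq_iff)
  qed (use q in auto)
  then show "tangent_space c S q = {(\<zeta>, 0) |\<zeta>. True}" by (auto simp: D)
qed

end

lemma nonzero_on_tangent_plane:
  fixes B :: "complex \<times> complex \<Rightarrow> complex \<times> complex \<Rightarrow> real"
  assumes B: "bilinear B" "\<And>u. B u u = 0" and v: "B (1, 0) (a, 0) \<noteq> 0"
  shows "B (1, 0) (\<i>, 0) \<noteq> 0"
proof
  assume "B (1, 0) (\<i>, 0) = 0"
  moreover have "(a, 0) = Re a *\<^sub>R (1, 0) + Im a *\<^sub>R (\<i>, 0 :: complex)" by (simp add: complex_eq_iff)
  ultimately show False using v
    by (simp only: bilinear_radd[OF B(1)] bilinear_rmul[OF B(1)] B(2)) simp
qed

text \<open>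
  The projection onto the \<open>B\<close>-orthogonal complement of the plane spanned by \<open>(1, 0)\<close> and \<open>(i, 0)\<close>,
  along this plane. It is meaningful if \<open>B\<close> is nondegenerate on the plane.
\<close>

definition symplectic_projection ::
  "(complex \<times> complex \<Rightarrow> complex \<times> complex \<Rightarrow> real) \<Rightarrow> complex \<times> complex \<Rightarrow> complex \<times> complex" where
  "symplectic_projection B e = e + (- B e (\<i>, 0) / B (1, 0) (\<i>, 0)) *\<^sub>R (1, 0) + (B e (1, 0) / B (1, 0) (\<i>, 0)) *\<^sub>R (\<i>, 0)"

lemma symplectic_projection:
  assumes B: "bilinear B" "\<And>u. B u u = 0" and g: "B (1, 0) (\<i>, 0) \<noteq> 0"
  shows "B (symplectic_projection B e) (1, 0) = 0" "B (symplectic_projection B e) (\<i>, 0) = 0"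
    "snd (symplectic_projection B e) = snd e"
proof -
  note s = bilinear_ladd[OF B(1)] bilinear_lmul[OF B(1)] B(2)
  have a: "B (\<i>, 0) (1, 0) = - B (1, 0) (\<i>, 0)" by (rule alternating_antisym[OF B])
  show "B (symplectic_projection B e) (1, 0) = 0" "B (symplectic_projection B e) (\<i>, 0) = 0"
    using g unfolding symplectic_projection_def s by (simp_all add: a)
  show "snd (symplectic_projection B e) = snd e" by (simp add: symplectic_projection_def)
qed

context symplectic
begin

text \<open>
  Start from a chart in which \<open>S\<close> is \<open>{snd x = 0}\<close>. Move along \<open>S\<close> by \<open>w\<close>, and then from the point
  reached in a direction that is symplectically orthogonal to \<open>S\<close> and depends linearly on \<open>z\<close>. This
  makes the two coordinate directions orthogonal along \<open>S\<close>; suitable scale factors make the form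
  standard at \<open>p\<close>. Orthogonal complements exist since \<open>S\<close> is symplectic.
\<close>

lemma normalized_chart:
  assumes S: "symplectic_surface A \<omega> S" and p: "p \<in> S"
  obtains c r where "c \<in> A" "r > 0" "p \<in> chart_dom c" "coord c p = 0" "coord c ` chart_dom c = ball 0 r"
    "normalized_form r (\<lambda>x. \<omega> c (chart_inv c x))"
    "\<And>q. q \<in> chart_dom c \<Longrightarrow> q \<in> S \<longleftrightarrow> fst (coord c q) = 0"
proof -
  obtain c0 where c0: "c0 \<in> A" "p \<in> chart_dom c0"
    and S0: "coord c0 ` (S \<inter> chart_dom c0) = coord c0 ` chart_dom c0 \<inter> {x. snd x = 0}"
    using S p unfolding symplectic_surface_def embedded_surface_def by blast
  note T = surface_tangent_in_adapted_chart[OF c0 p S0]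
  let ?O = "coord c0 ` chart_dom c0"
  note oO = open_image[OF c0(1)]
  define B where "B x = \<omega> c0 (chart_inv c0 x)" for x
  have bil: "bilinear (B x)" and alt: "B x u u = 0" if "x \<in> ?O" for x u
    using form_bilinear[OF c0(1)] form_alternating[OF c0(1)] chart_inv_dom[OF c0(1) that] by (auto simp: B_def)
  have smB: "smooth_on ?O (\<lambda>x. B x u v)" for u v unfolding B_def by (rule form_smooth[OF c0(1)])
  define x0 where "x0 = coord c0 p"
  have x0: "x0 \<in> ?O" "chart_inv c0 x0 = p" using c0 by (auto simp: x0_def)
  have sndx0: "snd x0 = 0" using T(2)[OF x0(1)] p x0(2) by simp
  define g where "g x = B x (1, 0) (\<i>, 0)" for x
  have g0: "g x0 \<noteq> 0"
  proof -
    have "(1, 0) \<in> tangent_space c0 S p" unfolding T(1) by blast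
    moreover have "(1 :: complex, 0 :: complex) \<noteq> 0" by (simp add: prod_eq_iff)
    ultimately obtain v where v: "v \<in> tangent_space c0 S p" "\<omega> c0 p (1, 0) v \<noteq> 0"
      using S c0 p unfolding symplectic_surface_def by blast
    then obtain a where "v = (a, 0)" unfolding T(1) by blast
    then show ?thesis
      using nonzero_on_tangent_plane[OF bil[OF x0(1)] alt[OF x0(1)], of a] v(2) by (simp add: g_def B_def x0(2))
  qed
  let ?P = "\<lambda>x. symplectic_projection (B x)"
  \<comment> \<open>The value of the form on a basis of the orthogonal complement of the tangent plane at \<open>p\<close>.
    Dividing \<open>Re z\<close> by it makes the form standard at \<open>p\<close>.\<close>
  define k where "k = B x0 (?P x0 (0, 1)) (?P x0 (0, \<i>))"
  note proj0 = symplectic_projection[OF bil[OF x0(1)] alt[OF x0(1)] g0[unfolded g_def]]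
  have k: "k \<noteq> 0"
  proof
    assume k0: "k = 0"
    let ?F1 = "?P x0 (0, 1)" and ?F2 = "?P x0 (0, \<i>)"
    have "B x0 ?F1 v = 0" for v
    proof -
      define w where "w = v - Re (snd v) *\<^sub>R ?F1 - Im (snd v) *\<^sub>R ?F2"
      have sw: "snd w = 0" unfolding w_def by (simp add: proj0(3) complex_eq_iff)
      have "v = Re (snd v) *\<^sub>R ?F1 + Im (snd v) *\<^sub>R ?F2 + (Re (fst w) *\<^sub>R (1, 0) + Im (fst w) *\<^sub>R (\<i>, 0))"
      proof -
        have "w = Re (fst w) *\<^sub>R (1, 0) + Im (fst w) *\<^sub>R (\<i>, 0)" using sw by (simp add: prod_eq_iff complex_eq_iff)
        then show ?thesis unfolding w_def by (metis (no_types, lifting) add.commute diff_add_cancel diff_diff_add)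
      qed
      moreover have "B x0 ?F1 (Re (snd v) *\<^sub>R ?F1 + Im (snd v) *\<^sub>R ?F2 + (Re (fst w) *\<^sub>R (1, 0) + Im (fst w) *\<^sub>R (\<i>, 0))) = 0"
        unfolding bilinear_radd[OF bil[OF x0(1)]] bilinear_rmul[OF bil[OF x0(1)]] proj0 alt[OF x0(1)] k0[unfolded k_def] by simp
      ultimately show ?thesis by metis
    qed
    moreover have "?F1 \<noteq> 0" using proj0(3)[of "(0, 1)"] by auto
    ultimately show False using form_nondegenerate[OF c0, of ?F1] by (auto simp: B_def x0(2))
  qed
  define O1 where "O1 = {x \<in> ?O. g x \<noteq> 0}"
  have "O1 = ?O \<inter> g -` (- {0})" by (auto simp: O1_def)
  moreover have cg: "continuous_on ?O g" unfolding g_def by (rule smooth_on_continuous[OF smB])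
  moreover have "open (- {0 :: real})" by auto
  ultimately have oO1: "open O1" using continuous_open_preimage[OF cg oO, of "- {0}"] by simp
  have O1: "x \<in> ?O" "g x \<noteq> 0" if "x \<in> O1" for x using that by (auto simp: O1_def)
  have smP: "smooth_on O1 (\<lambda>x. ?P x e)" for e
  proof -
    have "smooth_on O1 (\<lambda>x. B x u v)" for u v by (rule smooth_on_subset[OF smB]) (auto simp: O1_def)
    then show ?thesis unfolding symplectic_projection_def
      by (intro smooth_intros oO1) (use O1(2) in \<open>auto simp: g_def\<close>)
  qed
  define y where "y w = x0 + (Re w / g x0) *\<^sub>R (1, 0) + Im w *\<^sub>R (\<i>, 0 :: complex)" for w
  have y0: "y 0 = x0" by (simp add: y_def zero_prod_def[symmetric])
  have smy: "smooth_on T (\<lambda>v :: complex \<times> complex. y (snd v))" if "open T" for T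
    unfolding y_def by (intro smooth_intros that) (simp add: g0)
  define \<Psi> where "\<Psi> v = y (snd v) + (Re (fst v) / k) *\<^sub>R ?P (y (snd v)) (0, 1) + Im (fst v) *\<^sub>R ?P (y (snd v)) (0, \<i>)" for v
  define O2 where "O2 = (\<lambda>v :: complex \<times> complex. y (snd v)) -` O1"
  have oO2: "open O2" unfolding O2_def
    by (rule open_vimage[OF oO1]) (rule smooth_on_continuous[OF smy[OF open_UNIV]])
  have smPy: "smooth_on O2 (\<lambda>v. ?P (y (snd v)) e)" for e
    by (rule smooth_on_compose[OF smP smy[OF oO2] oO2 oO1]) (simp add: O2_def)
  have smPsi: "smooth_on O2 \<Psi>" unfolding \<Psi>_def
    by (intro smooth_intros oO2 smy smPy) (simp add: k)
  define O3 where "O3 = O2 \<inter> \<Psi> -` ?O"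
  have oO3: "open O3" unfolding O3_def
    by (rule continuous_open_preimage[OF smooth_on_continuous[OF smPsi] oO2 oO])
  have Psi0w: "\<Psi> (0, w) = y w" for w by (simp add: \<Psi>_def)
  have z2: "(0 :: complex, 0 :: complex) = 0" by (simp add: prod_eq_iff)
  have zO3: "0 \<in> O3" using x0 g0 Psi0w[of 0] y0 by (simp add: O3_def O2_def O1_def z2)
  have DPsi: "frechet_derivative \<Psi> (at (0, w)) (\<zeta>, \<eta>) = ((Re \<eta> / g x0) *\<^sub>R (1, 0) + Im \<eta> *\<^sub>R (\<i>, 0))
      + ((Re \<zeta> / k) *\<^sub>R ?P (y w) (0, 1) + Im \<zeta> *\<^sub>R ?P (y w) (0, \<i>))" if w: "(0, w) \<in> O2" for w \<zeta> \<eta>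
  proof -
    note DP = smooth_has_derivative[OF smPy w]
    have 1: "((\<lambda>v. y (snd v)) has_derivative (\<lambda>d. (Re (snd d) / g x0) *\<^sub>R (1, 0) + Im (snd d) *\<^sub>R (\<i>, 0))) (at (0 :: complex, w))"
      unfolding y_def by (auto intro!: derivative_eq_intros simp: g0)
    have 2: "((\<lambda>v. (Re (fst v) / k) *\<^sub>R ?P (y (snd v)) (0, 1)) has_derivative
        (\<lambda>d. (Re (fst (0 :: complex, w)) / k) *\<^sub>R frechet_derivative (\<lambda>v. ?P (y (snd v)) (0, 1)) (at (0, w)) d
          + (Re (fst d) / k) *\<^sub>R ?P (y (snd (0 :: complex, w))) (0, 1))) (at (0, w))"
      by (rule has_derivative_scaleR[OF _ DP]) (auto intro!: derivative_eq_intros simp: k)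
    have 3: "((\<lambda>v. Im (fst v) *\<^sub>R ?P (y (snd v)) (0, \<i>)) has_derivative
        (\<lambda>d. Im (fst (0 :: complex, w)) *\<^sub>R frechet_derivative (\<lambda>v. ?P (y (snd v)) (0, \<i>)) (at (0, w)) d
          + Im (fst d) *\<^sub>R ?P (y (snd (0 :: complex, w))) (0, \<i>))) (at (0, w))"
      by (rule has_derivative_scaleR[OF _ DP]) (auto intro!: derivative_eq_intros)
    from frechet_eq[OF has_derivative_add[OF has_derivative_add[OF 1 2] 3], of "(\<zeta>, \<eta>)"]
    show ?thesis unfolding \<Psi>_def by simp
  qed
  have pull: "B (y w) (frechet_derivative \<Psi> (at (0, w)) (\<zeta>, \<eta>)) (frechet_derivative \<Psi> (at (0, w)) (\<zeta>', \<eta>')) =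
      (Re \<eta> * Im \<eta>' - Im \<eta> * Re \<eta>') / g x0 * g (y w)
      + (Re \<zeta> * Im \<zeta>' - Im \<zeta> * Re \<zeta>') / k * B (y w) (?P (y w) (0, 1)) (?P (y w) (0, \<i>))"
    if w: "(0, w) \<in> O2" for w \<zeta> \<eta> \<zeta>' \<eta>'
  proof -
    have yO: "y w \<in> ?O" and gy: "B (y w) (1, 0) (\<i>, 0) \<noteq> 0" using w O1[of "y w"] by (auto simp: O2_def g_def)
    note pr = symplectic_projection[OF bil[OF yO] alt[OF yO] gy]
    note anti = alternating_antisym[OF bil[OF yO] alt[OF yO]]
    have pr': "B (y w) (1, 0) (?P (y w) e) = 0" "B (y w) (\<i>, 0) (?P (y w) e) = 0" for e
      using anti[of "(1, 0)" "?P (y w) e"] anti[of "(\<i>, 0)" "?P (y w) e"] pr by auto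
    have a1: "B (y w) (\<i>, 0) (1, 0) = - g (y w)" using anti[of "(\<i>, 0)" "(1, 0)"] by (simp add: g_def)
    have a2: "B (y w) (?P (y w) (0, \<i>)) (?P (y w) (0, 1)) = - B (y w) (?P (y w) (0, 1)) (?P (y w) (0, \<i>))"
      by (rule anti)
    show ?thesis
      unfolding DPsi[OF w] bilinear_ladd[OF bil[OF yO]] bilinear_radd[OF bil[OF yO]]
        bilinear_lmul[OF bil[OF yO]] bilinear_rmul[OF bil[OF yO]] pr pr' a1 a2 alt[OF yO] g_def[symmetric]
      by (simp add: algebra_simps diff_divide_distrib)
  qed
  have std0: "B x0 (frechet_derivative \<Psi> (at 0) u) (frechet_derivative \<Psi> (at 0) v) = std_form u v" for u v
  proof -
    have "(0 :: complex, 0) \<in> O2" using zO3 by (simp add: O3_def z2)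
    from pull[OF this, of "fst u" "snd u" "fst v" "snd v"] show ?thesis
      using g0 k by (simp add: y0 z2 k_def[symmetric] std_form_def)
  qed
  have smPsi3: "smooth_on O3 \<Psi>" by (rule smooth_on_subset[OF smPsi]) (simp add: O3_def)
  have injD0: "inj (frechet_derivative \<Psi> (at 0))"
  proof -
    have lin: "linear (frechet_derivative \<Psi> (at 0))"
      by (rule has_derivative_linear[OF smooth_has_derivative[OF smPsi3 zO3]])
    have "v = 0" if "frechet_derivative \<Psi> (at 0) v = 0" for v
      using std0[of v "(\<i> * fst v, \<i> * snd v)"] that bilinear_lzero[OF bil[OF x0(1)]] by (simp add: std_form_compatible)
    then show ?thesis using linear_injective_0[OF lin] by blast
  qed
  obtain r where r: "r > 0" "ball 0 r \<subseteq> O3" "inj_on \<Psi> (ball 0 r)"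
    "\<And>x. x \<in> ball 0 r \<Longrightarrow> inj (frechet_derivative \<Psi> (at x))"
    by (rule smooth_local_diffeo[OF oO3 smPsi3 zO3 injD0]) (rule that)
  have smr: "smooth_on (ball 0 r) \<Psi>" by (rule smooth_on_subset[OF smPsi3 r(2)])
  have img: "\<Psi> x \<in> ?O" if "x \<in> ball 0 r" for x using that r(2) by (auto simp: O3_def)
  obtain c where c: "c \<in> A" "coord c ` chart_dom c = ball 0 r" "chart_dom c \<subseteq> chart_dom c0"
    "\<And>q. q \<in> chart_dom c \<Longrightarrow> coord c0 q = \<Psi> (coord c q)"
    "\<And>x. x \<in> ball 0 r \<Longrightarrow> chart_inv c x = chart_inv c0 (\<Psi> x)" "chart_dom c = chart_inv c0 ` \<Psi> ` ball 0 r"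
    by (rule parametrized_chart[OF c0(1) open_ball smr r(3,4) img]) (assumption | rule that)+
  have z: "(0 :: c2) \<in> ball 0 r" using r(1) by simp
  have ci0: "chart_inv c 0 = p" using c(5)[OF z] Psi0w[of 0] by (simp add: y0 z2 x0(2))
  have form: "\<omega> c (chart_inv c x) u v = B (\<Psi> x) (frechet_derivative \<Psi> (at x) u) (frechet_derivative \<Psi> (at x) v)"
    if "x \<in> ball 0 r" for x u v
    unfolding B_def by (rule parametrized_form[OF c0(1) c(1) open_ball c(2,3,5) img smr that])
  show ?thesis
  proof (rule that[OF c(1) r(1) _ _ c(2)])
    show "p \<in> chart_dom c" using chart_inv_dom[OF c(1), of 0] z unfolding c(2) ci0 by blast
    show "coord c p = 0" using coord_chart_inv[OF c(1), of 0] z unfolding c(2) ci0 by blast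
    show "normalized_form r (\<lambda>x. \<omega> c (chart_inv c x))"
    proof
      show "r > 0" by (rule r(1))
      show "bilinear (\<omega> c (chart_inv c x))" "\<omega> c (chart_inv c x) u u = 0" if "x \<in> ball 0 r" for x u
        using form_bilinear[OF c(1)] form_alternating[OF c(1)] chart_inv_dom[OF c(1), of x] that c(2) by auto
      show "smooth_on (ball 0 r) (\<lambda>x. \<omega> c (chart_inv c x) u v)" for u v using form_smooth[OF c(1)] c(2) by simp
      show "frechet_derivative (\<lambda>y. \<omega> c (chart_inv c y) v w) (at x) u + frechet_derivative (\<lambda>y. \<omega> c (chart_inv c y) w u) (at x) v
        + frechet_derivative (\<lambda>y. \<omega> c (chart_inv c y) u v) (at x) w = 0" if "x \<in> ball 0 r" for x u v w
        using form_closed[OF c(1), of x] that c(2) by simp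
      show "\<omega> c (chart_inv c 0) = std_form"
        using form[OF z] std0 Psi0w[of 0] by (simp add: fun_eq_iff y0 z2)
      show "\<omega> c (chart_inv c (0, w)) (a, 0) (0, b) = 0" if w: "(0 :: complex, w) \<in> ball 0 r" for w a b
      proof -
        have "(0, w) \<in> O2" using w r(2) by (auto simp: O3_def)
        from pull[OF this, of a 0 0 b] show ?thesis using form[OF w] by (simp add: Psi0w)
      qed
    qed
    show "q \<in> S \<longleftrightarrow> fst (coord c q) = 0" if q: "q \<in> chart_dom c" for q
    proof -
      let ?v = "coord c q"
      have v: "?v \<in> ball 0 r" using q c(2) by blast
      have q0: "q \<in> chart_dom c0" using q c(3) by blast
      have "q \<in> S \<longleftrightarrow> snd (coord c0 q) = 0" using T(2)[of "coord c0 q"] q0 c0(1) by simp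
      also have "coord c0 q = \<Psi> ?v" by (rule c(4)[OF q])
      also have "snd (\<Psi> ?v) = (Re (fst ?v) / k) *\<^sub>R 1 + Im (fst ?v) *\<^sub>R \<i>"
        by (simp add: \<Psi>_def y_def symplectic_projection_def sndx0)
      also have "\<dots> = 0 \<longleftrightarrow> fst ?v = 0" using k by (simp add: complex_eq_iff)
      finally show ?thesis .
    qed
  qed
qed

text \<open>
  The coordinates of \<open>normalized_chart\<close> composed with the map of \<open>darboux_normal_form\<close>. As this map
  preserves \<open>{z = 0}\<close>, the equation of the surface remains \<open>z = 0\<close>.
\<close>

lemma adapted_darboux_chart:
  assumes S: "symplectic_surface A \<omega> S" and p: "p \<in> S" and V: "open V" "p \<in> V"
  obtains d where "d \<in> A" "p \<in> chart_dom d" "chart_dom d \<subseteq> V" "coord d p = 0"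
    "\<And>q. q \<in> chart_dom d \<Longrightarrow> \<omega> d q = std_form"
    "\<And>q. q \<in> chart_dom d \<Longrightarrow> q \<in> S \<longleftrightarrow> fst (coord d q) = 0"
proof -
  obtain c r where c: "c \<in> A" "r > 0" "p \<in> chart_dom c" "coord c p = 0" "coord c ` chart_dom c = ball 0 r"
    and nf: "normalized_form r (\<lambda>x. \<omega> c (chart_inv c x))"
    and cS: "\<And>q. q \<in> chart_dom c \<Longrightarrow> q \<in> S \<longleftrightarrow> fst (coord c q) = 0"
    by (rule normalized_chart[OF S p]) (rule that)
  obtain s \<Psi> where s: "0 < s" "smooth_on (ball 0 s) \<Psi>" "\<And>x. x \<in> ball 0 s \<Longrightarrow> \<Psi> x \<in> ball 0 r"
    "inj_on \<Psi> (ball 0 s)" "\<Psi> 0 = 0" "\<And>x. x \<in> ball 0 s \<Longrightarrow> inj (frechet_derivative \<Psi> (at x))"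
    "\<And>x u v. x \<in> ball 0 s \<Longrightarrow> \<omega> c (chart_inv c (\<Psi> x)) (frechet_derivative \<Psi> (at x) u) (frechet_derivative \<Psi> (at x) v) = std_form u v"
    "\<And>x. x \<in> ball 0 s \<Longrightarrow> fst (\<Psi> x) = 0 \<longleftrightarrow> fst x = 0"
    by (rule normalized_form.darboux_normal_form[OF nf]) (rule that)
  define W where "W = ball 0 s \<inter> \<Psi> -` (coord c ` (V \<inter> chart_dom c))"
  have oV: "open (coord c ` (V \<inter> chart_dom c))"
    by (rule open_coord_image[OF c(1) open_Int[OF V(1) open_dom[OF c(1)]]]) auto
  have oW: "open W" unfolding W_def
    by (rule continuous_open_preimage[OF smooth_on_continuous[OF s(2)] open_ball oV])
  have Ws: "x \<in> ball 0 s" "\<Psi> x \<in> coord c ` (V \<inter> chart_dom c)" if "x \<in> W" for x using that by (auto simp: W_def)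
  have img: "\<Psi> x \<in> coord c ` chart_dom c" if "x \<in> W" for x using Ws(2)[OF that] by blast
  have W0: "0 \<in> W" using s(1,5) c(3,4) V(2) by (auto simp: W_def image_iff intro!: bexI[of _ p])
  have smW: "smooth_on W \<Psi>" by (rule smooth_on_subset[OF s(2)]) (auto simp: W_def)
  have injW: "inj_on \<Psi> W" by (rule inj_on_subset[OF s(4)]) (auto simp: W_def)
  obtain d where d: "d \<in> A" "coord d ` chart_dom d = W" "chart_dom d \<subseteq> chart_dom c"
    "\<And>q. q \<in> chart_dom d \<Longrightarrow> coord c q = \<Psi> (coord d q)"
    "\<And>x. x \<in> W \<Longrightarrow> chart_inv d x = chart_inv c (\<Psi> x)" "chart_dom d = chart_inv c ` \<Psi> ` W"
    by (rule parametrized_chart[OF c(1) oW smW injW s(6)[OF Ws(1)] img]) (assumption | rule that)+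
  have ci0: "chart_inv d 0 = p" using d(5)[OF W0] s(5) chart_inv_coord[OF c(1,3)] c(4) by simp
  show ?thesis
  proof (rule that[OF d(1)])
    show "p \<in> chart_dom d" using chart_inv_dom[OF d(1), of 0] W0 unfolding d(2) ci0 by blast
    show "coord d p = 0" using coord_chart_inv[OF d(1), of 0] W0 unfolding d(2) ci0 by blast
    show "chart_dom d \<subseteq> V" unfolding d(6) using Ws(2) c(1) by force
    show "\<omega> d q = std_form" if q: "q \<in> chart_dom d" for q
    proof (intro ext)
      fix u v
      have x: "coord d q \<in> W" using q d(2) by blast
      show "\<omega> d q u v = std_form u v"
        using parametrized_form[OF c(1) d(1) oW d(2,3,5) img smW x, of u v] s(7)[OF Ws(1)[OF x]]
        by (simp add: chart_inv_coord[OF d(1) q])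
    qed
    show "q \<in> S \<longleftrightarrow> fst (coord d q) = 0" if q: "q \<in> chart_dom d" for q
    proof -
      have x: "coord d q \<in> W" using q d(2) by blast
      show ?thesis using cS[of q] d(3,4) q s(8)[OF Ws(1)[OF x]] by auto
    qed
  qed
qed

section \<open>Surfaces that are graphs, and their deformations\<close>

lemma restricted_form:
  assumes c: "c \<in> A" and d: "d \<in> A" "chart_dom d \<subseteq> chart_dom c" "\<And>q. q \<in> chart_dom d \<Longrightarrow> coord d q = coord c q"
    and q: "q \<in> chart_dom d"
  shows "\<omega> d q = \<omega> c q"
proof (intro ext)
  fix u v
  have x: "coord d q \<in> coord d ` chart_dom d" using q by blast
  have ci: "chart_inv d x = chart_inv c x" if "x \<in> coord d ` chart_dom d" for x
    using that c d by (metis (no_types, lifting) chart_inv_coord image_iff subsetD)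
  have "\<omega> d (chart_inv d (coord d q)) u v = \<omega> c (chart_inv c (coord d q))
      (frechet_derivative (\<lambda>x. x) (at (coord d q)) u) (frechet_derivative (\<lambda>x. x) (at (coord d q)) v)"
    by (rule parametrized_form[OF c d(1) open_image[OF d(1)] refl d(2) ci _ smooth_on_id[OF open_image[OF d(1)]] x])
      (use d in auto)
  moreover have "chart_inv c (coord d q) = q" using ci[OF x] d(1) q by simp
  ultimately show "\<omega> d q u v = \<omega> c q u v" using d(1) q by (simp add: frechet_derivative_ident)
qed

lemma graph_tangent:
  assumes d: "d \<in> A" and q: "q \<in> chart_dom d" "q \<in> S"
    and N: "open N" "coord d q \<in> N" "N \<subseteq> coord d ` chart_dom d"
    and D: "open D" "\<And>x. x \<in> N \<Longrightarrow> fst x \<in> D" and F: "smooth_on D F"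
    and S: "\<And>x. x \<in> N \<Longrightarrow> chart_inv d x \<in> S \<longleftrightarrow> snd x = F (fst x)"
  shows "tangent_space d S q = range (\<lambda>\<zeta>. (\<zeta>, frechet_derivative F (at (fst (coord d q))) \<zeta>))"
proof -
  let ?z = "fst (coord d q)"
  have "frechet_derivative (\<lambda>z. (z, F z)) (at ?z) \<zeta> = (\<zeta>, frechet_derivative F (at ?z) \<zeta>)" for \<zeta>
    by (rule frechet_eq) (intro has_derivative_Pair has_derivative_ident smooth_has_derivative[OF F] D(2) N(2))
  moreover have "tangent_space d S q = range (frechet_derivative (\<lambda>z. (z, F z)) (at ?z))"
  proof (rule tangent_space_parametrized[OF d q(1) N bounded_linear_fst D])
    show "smooth_on D (\<lambda>z. (z, F z))" by (intro smooth_intros D(1) F)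
    show "chart_inv d x \<in> S \<longleftrightarrow> x = (fst x, F (fst x))" if "x \<in> N" for x
      using S[OF that] by (auto simp: prod_eq_iff)
  qed (use q in auto)
  ultimately show ?thesis by simp
qed

lemma vertical_tangent:
  assumes d: "d \<in> A" and q: "q \<in> chart_dom d" "q \<in> S"
    and S: "\<And>q. q \<in> chart_dom d \<Longrightarrow> q \<in> S \<longleftrightarrow> fst (coord d q) = 0"
  shows "tangent_space d S q = range (\<lambda>\<eta>. (0, \<eta>))"
proof -
  let ?z = "snd (coord d q)"
  have "frechet_derivative (\<lambda>z :: complex. (0 :: complex, z)) (at ?z) \<zeta> = (0, \<zeta>)" for \<zeta>
    by (rule frechet_eq) (intro has_derivative_Pair has_derivative_ident has_derivative_const)
  moreover have "tangent_space d S q = range (frechet_derivative (\<lambda>z. (0, z)) (at ?z))"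
  proof (rule tangent_space_parametrized[OF d q(1) open_image[OF d] _ subset_refl bounded_linear_snd open_UNIV UNIV_I])
    show "smooth_on UNIV (\<lambda>z :: complex. (0 :: complex, z))" by (intro smooth_intros open_UNIV)
    show "chart_inv d x \<in> S \<longleftrightarrow> x = (0, snd x)" if "x \<in> coord d ` chart_dom d" for x
      using S[of "chart_inv d x"] that d by (auto simp: prod_eq_iff)
  qed (use q in auto)
  ultimately show ?thesis by simp
qed

text \<open>
  The implicit function theorem: \<open>S\<close> is locally the zero set of the second component of some chart,
  and by hypothesis the derivative of this component is injective on the vertical directions.
\<close>

lemma implicit_graph:
  assumes d: "d \<in> A" "p \<in> chart_dom d" "coord d p = 0"
    and S: "embedded_surface A S" "p \<in> S"
    and trans: "\<And>\<eta>. (0, \<eta>) \<in> tangent_space d S p \<Longrightarrow> \<eta> = 0"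
  obtains R F where "R > 0" "smooth_on (ball 0 R) F" "F 0 = 0"
    "\<And>z w. z \<in> ball 0 R \<Longrightarrow> w \<in> ball 0 R \<Longrightarrow> (z, w) \<in> coord d ` chart_dom d"
    "\<And>z w. z \<in> ball 0 R \<Longrightarrow> w \<in> ball 0 R \<Longrightarrow> chart_inv d (z, w) \<in> S \<longleftrightarrow> w = F z"
proof -
  obtain c where c: "c \<in> A" "p \<in> chart_dom c" and S0: "coord c ` (S \<inter> chart_dom c) = coord c ` chart_dom c \<inter> {x. snd x = 0}"
    using S unfolding embedded_surface_def by blast
  note T = surface_tangent_in_adapted_chart[OF c S(2) S0]
  let ?O = "coord d ` (chart_dom d \<inter> chart_dom c)" and ?t = "transition d c"
  note oO = open_overlap[OF d(1) c(1)] and smt = smooth_transition[OF d(1) c(1)]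
  have zO: "0 \<in> ?O" using d c by (metis IntI imageI)
  \<comment> \<open>In the coordinates \<open>K\<close> the surface is \<open>{snd = 0}\<close>, while the first coordinate is still \<open>z\<close>.\<close>
  define K where "K x = (fst x, snd (?t x))" for x
  have smK: "smooth_on ?O K" unfolding K_def by (intro smooth_intros oO smt)
  note Dt = smooth_has_derivative[OF smt zO]
  have DK: "frechet_derivative K (at 0) v = (fst v, snd (frechet_derivative ?t (at 0) v))" for v
    unfolding K_def by (rule frechet_eq) (intro has_derivative_Pair has_derivative_fst has_derivative_snd has_derivative_ident Dt)
  have injK: "inj (frechet_derivative K (at 0))"
  proof -
    have lin: "linear (frechet_derivative K (at 0))" by (rule has_derivative_linear[OF smooth_has_derivative[OF smK zO]])
    have "v = 0" if v: "frechet_derivative K (at 0) v = 0" for v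
    proof -
      have v0: "fst v = 0" "snd (frechet_derivative ?t (at 0) v) = 0" using v by (simp_all add: DK prod_eq_iff)
      then have "frechet_derivative ?t (at 0) v \<in> tangent_space c S p" unfolding T(1) by (auto simp: prod_eq_iff)
      from tangent_space_transform[OF c(1) d(1) c(2) d(2) this]
      have "v \<in> tangent_space d S p" using transition_inverse[OF d(1) c(1) d(2) c(2), of v] d(3) by simp
      then have "snd v = 0" using trans[of "snd v"] v0(1) by (metis prod.collapse)
      then show ?thesis using v0(1) by (simp add: prod_eq_iff)
    qed
    then show ?thesis using linear_injective_0[OF lin] by blast
  qed
  obtain r where r: "r > 0" "ball 0 r \<subseteq> ?O" "inj_on K (ball 0 r)" "\<And>x. x \<in> ball 0 r \<Longrightarrow> inj (frechet_derivative K (at x))"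
    by (rule smooth_local_diffeo[OF oO smK zO injK]) (rule that)
  have smKr: "smooth_on (ball 0 r) K" by (rule smooth_on_subset[OF smK r(2)])
  have inv: "open (K ` ball 0 r)" "smooth_on (K ` ball 0 r) (inv_into (ball 0 r) K)"
    by (rule smooth_inverse[OF open_ball smKr r(3)], rule r(4), assumption)+
  let ?I = "inv_into (ball 0 r) K"
  have tin: "?t x = coord c (chart_inv d x)" "chart_inv d x \<in> chart_dom c" "x \<in> coord d ` chart_dom d"
    if "x \<in> ball 0 r" for x
  proof -
    have "x \<in> ?O" using that r(2) by blast
    then show "?t x = coord c (chart_inv d x)" "chart_inv d x \<in> chart_dom c" "x \<in> coord d ` chart_dom d"
      using d(1) by (auto simp: transition_def)
  qed
  have inS: "chart_inv d x \<in> S \<longleftrightarrow> K x = (fst x, 0)" if x: "x \<in> ball 0 r" for x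
    using T(2)[of "?t x"] tin[OF x] c(1) by (simp add: K_def)
  have K0: "K 0 = 0" using inS[of 0] r(1) S(2) d by (metis chart_inv_coord centre_in_ball fst_zero zero_prod_def)
  have "open ((\<lambda>z :: complex. (z, 0 :: complex)) -` (K ` ball 0 r))"
    by (rule open_vimage[OF inv(1)]) (intro continuous_on_Pair continuous_on_id continuous_on_const)
  moreover have "0 \<in> (\<lambda>z :: complex. (z, 0 :: complex)) -` (K ` ball 0 r)"
    using K0 r(1) by (auto simp: zero_prod_def[symmetric] image_iff intro!: bexI[of _ 0])
  ultimately obtain R1 where R1: "R1 > 0" "ball 0 R1 \<subseteq> (\<lambda>z :: complex. (z, 0 :: complex)) -` (K ` ball 0 r)"
    using open_contains_ball by blast
  define R where "R = min R1 (r / 2)"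
  define F where "F z = snd (?I (z, 0))" for z
  have Rpos: "R > 0" using R1 r by (simp add: R_def)
  have inK: "(z, 0) \<in> K ` ball 0 r" if "z \<in> ball 0 R" for z using that R1(2) by (auto simp: R_def)
  have zw: "(z, w) \<in> ball 0 r" if "z \<in> ball 0 R" "w \<in> ball 0 R" for z w :: complex
    using norm_Pair_le[of z w] that by (auto simp: R_def)
  have Iz: "?I (z, 0) = (z, F z)" "?I (z, 0) \<in> ball 0 r" "K (?I (z, 0)) = (z, 0)" if "z \<in> ball 0 R" for z
  proof -
    show 1: "K (?I (z, 0)) = (z, 0)" by (rule f_inv_into_f[OF inK[OF that]])
    show "?I (z, 0) \<in> ball 0 r" by (rule inv_into_into[OF inK[OF that]])
    have "fst (?I (z, 0)) = z" using 1 by (simp add: K_def)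
    then show "?I (z, 0) = (z, F z)" by (simp add: F_def prod_eq_iff)
  qed
  show ?thesis
  proof (rule that[OF Rpos])
    have "smooth_on (ball 0 R) (\<lambda>z. ?I (z, 0))"
      by (rule smooth_on_compose[OF inv(2) _ open_ball inv(1)]) (auto intro!: smooth_intros inK)
    then show "smooth_on (ball 0 R) F" unfolding F_def by (rule smooth_on_snd[OF open_ball])
    show "(z, w) \<in> coord d ` chart_dom d" if "z \<in> ball 0 R" "w \<in> ball 0 R" for z w
      by (rule tin(3)[OF zw[OF that]])
    show iff: "chart_inv d (z, w) \<in> S \<longleftrightarrow> w = F z" if z: "z \<in> ball 0 R" and w: "w \<in> ball 0 R" for z w
    proof -
      have "chart_inv d (z, w) \<in> S \<longleftrightarrow> K (z, w) = (z, 0)" using inS[OF zw[OF z w]] by simp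
      also have "\<dots> \<longleftrightarrow> (z, w) = ?I (z, 0)"
        using Iz(2,3)[OF z] zw[OF z w] r(3) unfolding inj_on_def by metis
      also have "\<dots> \<longleftrightarrow> w = F z" using Iz(1)[OF z] by simp
      finally show ?thesis .
    qed
    have "chart_inv d (0, 0) \<in> S" using S(2) d by (metis chart_inv_coord zero_prod_def)
    then show "F 0 = 0" using iff[of 0 0] Rpos by simp
  qed
qed

end

text \<open>
  In the box \<open>ball 0 R \<times> ball 0 \<rho>\<close> the surface \<open>S\<close> is the graph of \<open>F\<close>, and it is to be moved
  through the graphs of \<open>F + t H\<close>. As \<open>H\<close> vanishes for \<open>norm z \<ge> R'\<close> and the graphs stay below the
  height \<open>\<rho>' < \<rho>\<close>, all the motion takes place in a compact part of the box.
\<close>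

locale graph_deformation = symplectic A \<omega>
  for A :: "('a::{t2_space,second_countable_topology}) chart set" and \<omega> :: "'a form2" +
  fixes b :: "'a chart" and R R' \<rho> \<rho>' :: real and S :: "'a set" and F H :: "complex \<Rightarrow> complex"
  assumes b: "b \<in> A" and image: "coord b ` chart_dom b = ball 0 R \<times> ball 0 \<rho>"
    and radii: "R' < R" "\<rho>' < \<rho>"
    and embedded: "embedded_surface A S"
    and graph: "\<And>z w. z \<in> ball 0 R \<Longrightarrow> w \<in> ball 0 \<rho> \<Longrightarrow> chart_inv b (z, w) \<in> S \<longleftrightarrow> w = F z"
    and smF: "smooth_on (ball 0 R) F" and smH: "smooth_on (ball 0 R) H"
    and H_outside: "\<And>z. R' \<le> norm z \<Longrightarrow> H z = 0"
    and bound: "\<And>z t. z \<in> ball 0 R \<Longrightarrow> t \<in> {0..1} \<Longrightarrow> norm (F z + t *\<^sub>R H z) \<le> \<rho>'"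
begin

definition G where "G t z = F z + t *\<^sub>R H z"

definition \<Phi> where "\<Phi> t q = (if q \<in> chart_dom b then chart_inv b (fst (coord b q), G t (fst (coord b q))) else q)"

definition K where "K = chart_inv b ` (cball 0 R' \<times> cball 0 \<rho>')"

lemma coord_in: "q \<in> chart_dom b \<Longrightarrow> fst (coord b q) \<in> ball 0 R \<and> snd (coord b q) \<in> ball 0 \<rho>"
  using image by (metis imageI mem_Times_iff)

lemma box_in: "z \<in> ball 0 R \<Longrightarrow> w \<in> ball 0 \<rho> \<Longrightarrow> (z, w) \<in> coord b ` chart_dom b"
  using image by simp

lemma G_in: "z \<in> ball 0 R \<Longrightarrow> t \<in> {0..1} \<Longrightarrow> G t z \<in> ball 0 \<rho>"
  using bound[of z t] radii by (auto simp: G_def)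

lemma smG: "smooth_on (ball 0 R) (G t)"
  unfolding G_def by (intro smooth_intros open_ball smF smH)

lemma box_facts:
  assumes "z \<in> ball 0 R" "w \<in> ball 0 \<rho>"
  shows "chart_inv b (z, w) \<in> chart_dom b" "coord b (chart_inv b (z, w)) = (z, w)"
  using box_in[OF assms] b by auto

lemma S_iff: assumes "q \<in> chart_dom b" shows "q \<in> S \<longleftrightarrow> snd (coord b q) = F (fst (coord b q))"
  using graph[of "fst (coord b q)" "snd (coord b q)"] coord_in[OF assms] b assms by simp

lemma Phi_in: assumes "q \<in> chart_dom b" "t \<in> {0..1}"
  shows "\<Phi> t q \<in> chart_dom b" "coord b (\<Phi> t q) = (fst (coord b q), G t (fst (coord b q)))"
  using box_facts[OF _ G_in] coord_in assms by (auto simp: \<Phi>_def)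

lemma image_iff_in: assumes q: "q \<in> chart_dom b" and t: "t \<in> {0..1}"
  shows "q \<in> \<Phi> t ` S \<longleftrightarrow> snd (coord b q) = G t (fst (coord b q))"
proof
  assume "q \<in> \<Phi> t ` S"
  then obtain s where s: "s \<in> S" "q = \<Phi> t s" by blast
  then have "s \<in> chart_dom b" using q by (auto simp: \<Phi>_def split: if_splits)
  then show "snd (coord b q) = G t (fst (coord b q))" using Phi_in(2)[OF _ t] s(2) by simp
next
  assume e: "snd (coord b q) = G t (fst (coord b q))"
  let ?z = "fst (coord b q)"
  have z: "?z \<in> ball 0 R" using coord_in[OF q] by simp
  have F: "F ?z \<in> ball 0 \<rho>" using G_in[OF z, of 0] by (simp add: G_def)
  have "chart_inv b (?z, F ?z) \<in> S" using graph[OF z F] by simp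
  moreover have "\<Phi> t (chart_inv b (?z, F ?z)) = q"
    using box_facts[OF z F] e q b by (simp add: \<Phi>_def) (metis chart_inv_coord prod.collapse)
  ultimately show "q \<in> \<Phi> t ` S" by (metis imageI)
qed

lemma image_iff_out: assumes q: "q \<notin> chart_dom b" and t: "t \<in> {0..1}"
  shows "q \<in> \<Phi> t ` S \<longleftrightarrow> q \<in> S"
proof
  assume "q \<in> \<Phi> t ` S"
  then obtain s where s: "s \<in> S" "q = \<Phi> t s" by blast
  then have "s \<notin> chart_dom b" using Phi_in(1)[OF _ t] q by auto
  then show "q \<in> S" using s by (simp add: \<Phi>_def)
next
  assume "q \<in> S"
  moreover have "\<Phi> t q = q" using q by (simp add: \<Phi>_def)
  ultimately show "q \<in> \<Phi> t ` S" by (metis imageI)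
qed

lemma closed_K: "closed K"
proof -
  have sub: "cball 0 R' \<times> cball 0 \<rho>' \<subseteq> coord b ` chart_dom b" using image radii by auto
  have "compact K" unfolding K_def
    by (intro compact_continuous_image continuous_on_subset[OF continuous_chart_inv[OF b] sub] compact_Times compact_cball)
  then show ?thesis by (rule compact_imp_closed)
qed

lemma K_iff: "q \<in> chart_dom b \<Longrightarrow> q \<in> K \<longleftrightarrow> norm (fst (coord b q)) \<le> R' \<and> norm (snd (coord b q)) \<le> \<rho>'"
proof -
  assume q: "q \<in> chart_dom b"
  have sub: "cball 0 R' \<times> cball 0 \<rho>' \<subseteq> coord b ` chart_dom b" using image radii by auto
  show ?thesis
  proof
    assume "q \<in> K"
    then obtain x where x: "x \<in> cball 0 R' \<times> cball 0 \<rho>'" "q = chart_inv b x" unfolding K_def by blast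
    then have "coord b q = x" using sub b by auto
    then show "norm (fst (coord b q)) \<le> R' \<and> norm (snd (coord b q)) \<le> \<rho>'" using x(1) by (auto simp: mem_Times_iff)
  next
    assume "norm (fst (coord b q)) \<le> R' \<and> norm (snd (coord b q)) \<le> \<rho>'"
    then have "coord b q \<in> cball 0 R' \<times> cball 0 \<rho>'" by (simp add: mem_Times_iff)
    then have "chart_inv b (coord b q) \<in> K" unfolding K_def by (rule imageI)
    then show "q \<in> K" using q b by simp
  qed
qed

lemma K_dom: "K \<subseteq> chart_dom b"
  unfolding K_def using image radii b by auto

lemma G_eq_outside: "q \<in> chart_dom b \<Longrightarrow> q \<notin> K \<Longrightarrow> t \<in> {0..1} \<Longrightarrow> s \<in> {0..1} \<Longrightarrow>
   snd (coord b q) = G t (fst (coord b q)) \<Longrightarrow> G t (fst (coord b q)) = G s (fst (coord b q))"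
  using K_iff[of q] bound[of "fst (coord b q)" t] coord_in[of q] H_outside[of "fst (coord b q)"] by (auto simp: G_def)

lemma image_iff_off_K:
  assumes "q \<notin> K" "t \<in> {0..1}" shows "q \<in> \<Phi> t ` S \<longleftrightarrow> q \<in> S"
proof (cases "q \<in> chart_dom b")
  case True
  have z: "(0 :: real) \<in> {0..1}" by simp
  have "snd (coord b q) = G t (fst (coord b q)) \<longleftrightarrow> snd (coord b q) = G 0 (fst (coord b q))"
  proof
    assume e: "snd (coord b q) = G t (fst (coord b q))"
    then show "snd (coord b q) = G 0 (fst (coord b q))"
      using G_eq_outside[OF True assms(1,2) z e] by (rule trans)
  next
    assume e: "snd (coord b q) = G 0 (fst (coord b q))"
    then show "snd (coord b q) = G t (fst (coord b q))"
      using G_eq_outside[OF True assms(1) z assms(2) e] by (rule trans)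
  qed
  moreover have "q \<in> S \<longleftrightarrow> snd (coord b q) = G 0 (fst (coord b q))" using S_iff[OF True] by (simp add: G_def)
  ultimately show ?thesis using image_iff_in[OF True assms(2)] by blast
qed (use image_iff_out assms in blast)

lemma Phi_off_K:
  assumes "q \<in> S" "q \<notin> K" "t \<in> {0..1}" shows "\<Phi> t q = q"
proof (cases "q \<in> chart_dom b")
  case True
  have e: "snd (coord b q) = G 0 (fst (coord b q))" using S_iff[OF True] assms(1) by (simp add: G_def)
  have "G t (fst (coord b q)) = snd (coord b q)" using G_eq_outside[OF True assms(2), of 0 t] e assms(3) by simp
  then show ?thesis using True b by (simp add: \<Phi>_def)
qed (simp add: \<Phi>_def)

lemma Phi_0: "q \<in> S \<Longrightarrow> \<Phi> 0 q = q"
proof (cases "q \<in> chart_dom b")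
  case True
  assume "q \<in> S"
  then have "F (fst (coord b q)) = snd (coord b q)" using S_iff[OF True] by simp
  then show ?thesis using True b by (simp add: \<Phi>_def G_def)
qed (simp add: \<Phi>_def)

lemma Phi_inj: assumes t: "t \<in> {0..1}" shows "inj_on (\<Phi> t) S"
proof (rule inj_onI)
  fix x y assume xy: "x \<in> S" "y \<in> S" "\<Phi> t x = \<Phi> t y"
  show "x = y"
  proof (cases "x \<in> chart_dom b")
    case True
    then have y: "y \<in> chart_dom b" using Phi_in(1)[OF True t] xy(3) by (auto simp: \<Phi>_def split: if_splits)
    have "coord b x = coord b y"
      using Phi_in(2)[OF True t] Phi_in(2)[OF y t] xy S_iff[OF True] S_iff[OF y] by (simp add: prod_eq_iff)
    then show ?thesis using inj_on_coord[OF b] True y by (simp add: inj_on_def)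
  next
    case False
    then have "y \<notin> chart_dom b" using Phi_in(1)[OF _ t, of y] xy(3) by (auto simp: \<Phi>_def)
    then show ?thesis using False xy(3) by (simp add: \<Phi>_def)
  qed
qed

text \<open>
  Inside the box, \<open>(z, w - G t z)\<close> are coordinates in which the deformed surface is flat. Every
  point outside the box has a neighbourhood that avoids the compact set \<open>K\<close>, and there the surface
  has not changed.
\<close>

lemma embedded_deformed: assumes t: "t \<in> {0..1}" shows "embedded_surface A (\<Phi> t ` S)"
  unfolding embedded_surface_def
proof
  fix q assume q: "q \<in> \<Phi> t ` S"
  show "\<exists>c\<in>A. q \<in> chart_dom c \<and> coord c ` (\<Phi> t ` S \<inter> chart_dom c) = coord c ` chart_dom c \<inter> {x. snd x = 0}"
  proof (cases "q \<in> chart_dom b")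
    case True
    let ?U = "ball 0 R \<times> (UNIV :: complex set)"
    define \<Psi> where "\<Psi> v = (fst v, snd v + G t (fst v))" for v :: c2
    have oU: "open ?U" by (intro open_Times open_ball open_UNIV)
    have smGU: "smooth_on ?U (\<lambda>v. G t (fst v))"
      by (rule smooth_on_compose[OF smG smooth_on_fst[OF oU smooth_on_id[OF oU]] oU open_ball]) auto
    have smU: "smooth_on ?U \<Psi>" unfolding \<Psi>_def by (intro smooth_intros oU smGU)
    define W where "W = ?U \<inter> \<Psi> -` (ball 0 R \<times> ball 0 \<rho>)"
    have oW: "open W" unfolding W_def
      by (rule continuous_open_preimage[OF smooth_on_continuous[OF smU] oU]) (intro open_Times open_ball)
    have smW: "smooth_on W \<Psi>" by (rule smooth_on_subset[OF smU]) (auto simp: W_def)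
    have injW: "inj_on \<Psi> W" by (auto simp: inj_on_def \<Psi>_def)
    have injD: "inj (frechet_derivative \<Psi> (at x))" if x: "x \<in> W" for x
    proof -
      have xU: "x \<in> ?U" using x by (simp add: W_def)
      have D: "frechet_derivative \<Psi> (at x) v = (fst v, snd v + frechet_derivative (\<lambda>v. G t (fst v)) (at x) v)" for v
        unfolding \<Psi>_def by (rule frechet_eq)
          (intro has_derivative_Pair has_derivative_add has_derivative_fst has_derivative_snd has_derivative_ident smooth_has_derivative[OF smGU xU])
      have lin: "linear (frechet_derivative \<Psi> (at x))" by (rule has_derivative_linear[OF smooth_has_derivative[OF smU xU]])
      have "frechet_derivative (\<lambda>v. G t (fst v)) (at x) v = 0" if "fst v = 0" for v
      proof -
        have "((\<lambda>v. G t (fst v)) has_derivative (\<lambda>v. frechet_derivative (G t) (at (fst x)) (fst v))) (at x)"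
          by (rule has_derivative_compose[OF has_derivative_fst[OF has_derivative_ident]])
            (rule smooth_has_derivative[OF smG], use xU in auto)
        from frechet_eq[OF this] show ?thesis
          using that linear_0[OF has_derivative_linear[OF smooth_has_derivative[OF smG]]] xU by (auto simp: mem_Times_iff)
      qed
      note vert = this
      have "v = 0" if v: "frechet_derivative \<Psi> (at x) v = 0" for v
      proof -
        have f: "fst v = 0" using v by (simp add: D prod_eq_iff)
        then have "snd v = 0" using v vert[OF f] by (simp add: D prod_eq_iff)
        then show ?thesis using f by (simp add: prod_eq_iff)
      qed
      then show ?thesis using linear_injective_0[OF lin] by blast
    qed
    have img: "\<Psi> x \<in> coord b ` chart_dom b" if "x \<in> W" for x using that image by (simp add: W_def)
    obtain d where d: "d \<in> A" "coord d ` chart_dom d = W" "chart_dom d \<subseteq> chart_dom b"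
      "\<And>q. q \<in> chart_dom d \<Longrightarrow> coord b q = \<Psi> (coord d q)"
      "\<And>x. x \<in> W \<Longrightarrow> chart_inv d x = chart_inv b (\<Psi> x)" "chart_dom d = chart_inv b ` \<Psi> ` W"
      by (rule parametrized_chart[OF b oW smW injW injD img]) (assumption | rule that)+
    have iff: "s \<in> \<Phi> t ` S \<longleftrightarrow> snd (coord d s) = 0" if s: "s \<in> chart_dom d" for s
      using image_iff_in[OF _ t, of s] d(3,4) s by (auto simp: \<Psi>_def)
    have "q \<in> chart_dom d"
    proof -
      let ?x = "coord b q"
      have "(fst ?x, snd ?x - G t (fst ?x)) \<in> W" "\<Psi> (fst ?x, snd ?x - G t (fst ?x)) = ?x"
        using coord_in[OF True] by (auto simp: W_def \<Psi>_def mem_Times_iff)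
      then have "?x \<in> \<Psi> ` W" by (metis imageI)
      then have "chart_inv b ?x \<in> chart_dom d" unfolding d(6) by (rule imageI)
      then show ?thesis using True b by simp
    qed
    moreover have "coord d ` (\<Phi> t ` S \<inter> chart_dom d) = coord d ` chart_dom d \<inter> {x. snd x = 0}"
      using iff by force
    ultimately show ?thesis using d(1) by blast
  next
    case False
    have qS: "q \<in> S" using q image_iff_out[OF False t] by blast
    have qK: "q \<notin> K" using K_dom False by blast
    obtain c where c: "c \<in> A" "q \<in> chart_dom c" "coord c ` (S \<inter> chart_dom c) = coord c ` chart_dom c \<inter> {x. snd x = 0}"
      using embedded qS unfolding embedded_surface_def by blast
    note iffc = surface_tangent_in_adapted_chart(2)[OF c(1,2) qS c(3)]
    let ?W = "coord c ` (chart_dom c - K)"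
    have oW: "open ?W" by (rule open_coord_image[OF c(1) open_Diff[OF open_dom[OF c(1)] closed_K]]) auto
    obtain d where d: "d \<in> A" "coord d ` chart_dom d = ?W" "chart_dom d = chart_inv c ` ?W"
      "\<And>q. q \<in> chart_dom d \<Longrightarrow> coord d q = coord c q" "\<And>x. x \<in> ?W \<Longrightarrow> chart_inv d x = chart_inv c x"
      "chart_dom d \<subseteq> chart_dom c"
      by (rule restricted_chart[OF c(1) oW]) (auto intro: that)
    have dd: "chart_dom d = chart_dom c - K" unfolding d(3) image_image using c(1) by (auto simp: image_iff)
    have iff: "s \<in> \<Phi> t ` S \<longleftrightarrow> snd (coord d s) = 0" if s: "s \<in> chart_dom d" for s
      using image_iff_off_K[OF _ t, of s] iffc[of "coord c s"] d(4)[OF s] s c(1) unfolding dd by auto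
    have "q \<in> chart_dom d" using c(2) qK by (simp add: dd)
    moreover have "coord d ` (\<Phi> t ` S \<inter> chart_dom d) = coord d ` chart_dom d \<inter> {x. snd x = 0}"
      using iff by force
    ultimately show ?thesis using d(1) by blast
  qed
qed

lemma open_off_K: "c \<in> A \<Longrightarrow> open (coord c ` (chart_dom c - K))"
  by (rule open_coord_image[OF _ open_Diff[OF open_dom closed_K]]) auto

lemma off_K: "c \<in> A \<Longrightarrow> y \<in> chart_dom c \<Longrightarrow> coord c y \<in> coord c ` (chart_dom c - K) \<Longrightarrow> y \<notin> K"
  using inj_on_coord[of c] by (auto simp: inj_on_def)

text \<open>
  In the coordinates of the box, \<open>\<Phi> t\<close> and its inverse replace \<open>w\<close> by \<open>G t z\<close> and by \<open>F z\<close>. These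
  maps are defined and smooth on the whole box, as required for smoothness on \<open>S\<close>. Away from \<open>K\<close>
  both leave the points of the surfaces fixed.
\<close>

lemma isotopy_Phi: "isotopy A S \<Phi>"
  unfolding isotopy_def
proof (intro conjI ballI)
  show "\<Phi> 0 x = x" if "x \<in> S" for x by (rule Phi_0[OF that])
  show "inj_on (\<Phi> t) S" "embedded_surface A (\<Phi> t ` S)" if "t \<in> {0..1}" for t
    by (rule Phi_inj[OF that], rule embedded_deformed[OF that])
  show "smooth_family A S \<Phi>"
    unfolding smooth_family_def
  proof (intro ballI)
    fix t :: real and x assume t: "t \<in> {0..1}" and x: "x \<in> S"
    show "\<exists>c\<in>A. \<exists>c'\<in>A. \<exists>N G. x \<in> chart_dom c \<and> open N \<and> (t, coord c x) \<in> N \<and> smooth_on N G \<and>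
      (\<forall>s\<in>{0..1}. \<forall>y\<in>S \<inter> chart_dom c. (s, coord c y) \<in> N \<longrightarrow> \<Phi> s y \<in> chart_dom c' \<and> coord c' (\<Phi> s y) = G (s, coord c y))"
    proof (cases "x \<in> chart_dom b")
      case True
      let ?N = "UNIV \<times> ball 0 R \<times> ball 0 \<rho> :: (real \<times> complex \<times> complex) set"
      let ?G = "\<lambda>p :: real \<times> complex \<times> complex. (fst (snd p), F (fst (snd p)) + fst p *\<^sub>R H (fst (snd p)))"
      have oN: "open ?N" by (intro open_Times open_ball open_UNIV)
      have f: "smooth_on ?N (\<lambda>p. fst (snd p))" by (intro smooth_intros oN)
      have "smooth_on ?N (\<lambda>p. F (fst (snd p)))" "smooth_on ?N (\<lambda>p. H (fst (snd p)))"
        by (rule smooth_on_compose[OF smF f oN open_ball], force, rule smooth_on_compose[OF smH f oN open_ball], force)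
      then have "smooth_on ?N ?G" by (intro smooth_intros oN)
      moreover have "(t, coord b x) \<in> ?N" using coord_in[OF True] by (auto simp: mem_Times_iff)
      moreover have "\<forall>s\<in>{0..1}. \<forall>y\<in>S \<inter> chart_dom b. (s, coord b y) \<in> ?N \<longrightarrow> \<Phi> s y \<in> chart_dom b \<and> coord b (\<Phi> s y) = ?G (s, coord b y)"
        by (intro ballI impI) (simp add: Phi_in G_def)
      ultimately have "x \<in> chart_dom b \<and> open ?N \<and> (t, coord b x) \<in> ?N \<and> smooth_on ?N ?G \<and>
          (\<forall>s\<in>{0..1}. \<forall>y\<in>S \<inter> chart_dom b. (s, coord b y) \<in> ?N \<longrightarrow> \<Phi> s y \<in> chart_dom b \<and> coord b (\<Phi> s y) = ?G (s, coord b y))"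
        using True oN by (intro conjI)
      then show ?thesis by (intro bexI[OF _ b] exI[of _ ?N] exI[of _ ?G])
    next
      case False
      have xK: "x \<notin> K" using K_dom False by blast
      obtain c where c: "c \<in> A" "x \<in> chart_dom c" using smooth_atlas unfolding smooth_structure_def by blast
      let ?N = "UNIV \<times> coord c ` (chart_dom c - K) :: (real \<times> complex \<times> complex) set"
      have oN: "open ?N" by (intro open_Times open_UNIV open_off_K c)
      have "smooth_on ?N snd" using smooth_on_snd[OF oN smooth_on_id[OF oN]] by simp
      moreover have "(t, coord c x) \<in> ?N" using c xK by auto
      moreover have "\<Phi> s y \<in> chart_dom c \<and> coord c (\<Phi> s y) = snd (s, coord c y)"
        if "s \<in> {0..1}" "y \<in> S \<inter> chart_dom c" "(s, coord c y) \<in> ?N" for s y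
        using Phi_off_K[of y s] off_K[OF c(1), of y] that by auto
      ultimately show ?thesis using c oN by blast
    qed
  qed
  show "smooth_map A (\<Phi> t ` S) (inv_into S (\<Phi> t))" if t: "t \<in> {0..1}" for t
    unfolding smooth_map_def
  proof (intro ballI)
    fix x assume x: "x \<in> \<Phi> t ` S"
    have inv: "inv_into S (\<Phi> t) (\<Phi> t s) = s" if "s \<in> S" for s by (rule inv_into_f_f[OF Phi_inj[OF t] that])
    show "\<exists>c\<in>A. \<exists>c'\<in>A. \<exists>N G. x \<in> chart_dom c \<and> open N \<and> coord c x \<in> N \<and> smooth_on N G \<and>
      (\<forall>y\<in>\<Phi> t ` S \<inter> chart_dom c. coord c y \<in> N \<longrightarrow> inv_into S (\<Phi> t) y \<in> chart_dom c' \<and> coord c' (inv_into S (\<Phi> t) y) = G (coord c y))"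
    proof (cases "x \<in> chart_dom b")
      case True
      let ?N = "ball 0 R \<times> ball 0 \<rho> :: (complex \<times> complex) set"
      have oN: "open ?N" by (intro open_Times open_ball)
      have f: "smooth_on ?N (\<lambda>p. fst p)" by (intro smooth_intros oN)
      have "smooth_on ?N (\<lambda>p. F (fst p))" by (rule smooth_on_compose[OF smF f oN open_ball]) auto
      then have "smooth_on ?N (\<lambda>p. (fst p, F (fst p)))" by (intro smooth_intros oN)
      moreover have "coord b x \<in> ?N" using coord_in[OF True] by (auto simp: mem_Times_iff)
      moreover have "inv_into S (\<Phi> t) y \<in> chart_dom b \<and> coord b (inv_into S (\<Phi> t) y) = (\<lambda>p. (fst p, F (fst p))) (coord b y)"
        if y: "y \<in> \<Phi> t ` S \<inter> chart_dom b" for y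
      proof -
        obtain s where s: "s \<in> S" "y = \<Phi> t s" using y by blast
        have sb: "s \<in> chart_dom b" using s y by (auto simp: \<Phi>_def split: if_splits)
        show ?thesis using inv[OF s(1)] s sb Phi_in(2)[OF sb t] S_iff[OF sb] by (simp add: prod_eq_iff)
      qed
      ultimately have "x \<in> chart_dom b \<and> open ?N \<and> coord b x \<in> ?N \<and> smooth_on ?N (\<lambda>p. (fst p, F (fst p))) \<and>
          (\<forall>y\<in>\<Phi> t ` S \<inter> chart_dom b. coord b y \<in> ?N \<longrightarrow> inv_into S (\<Phi> t) y \<in> chart_dom b \<and>
            coord b (inv_into S (\<Phi> t) y) = (\<lambda>p. (fst p, F (fst p))) (coord b y))"
        using True oN by (intro conjI ballI impI) simp_all
      then show ?thesis by (intro bexI[OF _ b] exI[of _ ?N] exI[of _ "\<lambda>p. (fst p, F (fst p))"])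
    next
      case False
      have xK: "x \<notin> K" using K_dom False by blast
      obtain c where c: "c \<in> A" "x \<in> chart_dom c" using smooth_atlas unfolding smooth_structure_def by blast
      let ?N = "coord c ` (chart_dom c - K)"
      have oN: "open ?N" by (rule open_off_K[OF c(1)])
      have "smooth_on ?N (\<lambda>x. x)" by (rule smooth_on_id[OF oN])
      moreover have "coord c x \<in> ?N" using c xK by auto
      moreover have "inv_into S (\<Phi> t) y \<in> chart_dom c \<and> coord c (inv_into S (\<Phi> t) y) = (\<lambda>x. x) (coord c y)"
        if y: "y \<in> \<Phi> t ` S \<inter> chart_dom c" "coord c y \<in> ?N" for y
      proof -
        have yK: "y \<notin> K" using off_K[OF c(1)] y by blast
        then have "y \<in> S" using image_iff_off_K[OF yK t] y by blast
        then have "inv_into S (\<Phi> t) y = y" using inv[of y] Phi_off_K[OF _ yK t] by simp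
        then show ?thesis using y by simp
      qed
      ultimately show ?thesis using c oN by blast
    qed
  qed
qed

text \<open>
  A form on a real plane is nondegenerate iff it is nonzero on one basis, and the hypothesis states
  this for the basis \<open>(1, D 1), (i, D i)\<close> of the tangent plane of the deformed graph.
\<close>

lemma symplectic_deformed:
  assumes S: "symplectic_surface A \<omega> S" and std: "\<And>q. q \<in> chart_dom b \<Longrightarrow> \<omega> b q = std_form"
    and pos: "\<And>z. z \<in> ball 0 R \<Longrightarrow> std_form (1, frechet_derivative (G 1) (at z) 1) (\<i>, frechet_derivative (G 1) (at z) \<i>) > 0"
  shows "symplectic_surface A \<omega> (\<Phi> 1 ` S)"
  unfolding symplectic_surface_def
proof (intro conjI ballI impI)
  show "embedded_surface A (\<Phi> 1 ` S)" by (rule embedded_deformed) simp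
  fix q c u assume q: "q \<in> \<Phi> 1 ` S" and c: "c \<in> A" "q \<in> chart_dom c" and u: "u \<in> tangent_space c (\<Phi> 1 ` S) q" "u \<noteq> 0"
  show "\<exists>v\<in>tangent_space c (\<Phi> 1 ` S) q. \<omega> c q u v \<noteq> 0"
  proof (cases "q \<in> chart_dom b")
    case True
    let ?z = "fst (coord b q)"
    let ?L = "frechet_derivative (G 1) (at ?z)" and ?D = "frechet_derivative (transition c b) (at (coord c q))"
    have z: "?z \<in> ball 0 R" using coord_in[OF True] by simp
    have T: "tangent_space b (\<Phi> 1 ` S) q = range (\<lambda>\<zeta>. (\<zeta>, ?L \<zeta>))"
    proof (rule graph_tangent[OF b True q open_image[OF b] _ subset_refl open_ball _ smG])
      show "chart_inv b x \<in> \<Phi> 1 ` S \<longleftrightarrow> snd x = G 1 (fst x)" if "x \<in> coord b ` chart_dom b" for x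
        using image_iff_in[of "chart_inv b x" 1] that b by simp
      show "coord b q \<in> coord b ` chart_dom b" using True by (rule imageI)
      show "fst x \<in> ball 0 R" if "x \<in> coord b ` chart_dom b" for x
        using that unfolding image by (simp add: mem_Times_iff)
    qed
    have linL: "linear ?L" by (rule has_derivative_linear[OF smooth_has_derivative[OF smG z]])
    have Du: "?D u \<in> tangent_space b (\<Phi> 1 ` S) q" by (rule tangent_space_transform[OF c(1) b c(2) True u(1)])
    then obtain \<zeta> where \<zeta>: "?D u = (\<zeta>, ?L \<zeta>)" unfolding T by blast
    have u_back: "frechet_derivative (transition b c) (at (coord b q)) (?D u) = u"
      by (rule transition_inverse[OF c(1) b c(2) True])
    have "\<zeta> \<noteq> 0"
    proof
      assume "\<zeta> = 0"
      then have "?D u = 0" using \<zeta> linear_0[OF linL] by (simp add: prod_eq_iff)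
      then have "u = 0" using u_back linear_0[OF has_derivative_linear[OF transition_has_derivative[OF b c(1) True c(2)]]] by simp
      then show False using u(2) by simp
    qed
    let ?v = "(\<i> * \<zeta>, ?L (\<i> * \<zeta>))"
    note exp = linear_complex_expand[OF linL]
    have "std_form (\<zeta>, ?L \<zeta>) ?v = (norm \<zeta>)\<^sup>2 * std_form (1, ?L 1) (\<i>, ?L \<i>)"
      unfolding exp[of \<zeta>] exp[of "\<i> * \<zeta>"] cmod_power2
      by (simp add: std_form_def algebra_simps power2_eq_square)
    then have "std_form (?D u) ?v \<noteq> 0" using \<zeta> pos[OF z] \<open>\<zeta> \<noteq> 0\<close> by simp
    moreover have v: "?v \<in> tangent_space b (\<Phi> 1 ` S) q" unfolding T by blast
    moreover have "\<omega> b q (?D u) ?v = \<omega> c q u (frechet_derivative (transition b c) (at (coord b q)) ?v)"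
      using form_transform[OF b c(1) True c(2), of "?D u" ?v] u_back by simp
    ultimately show ?thesis using tangent_space_transform[OF b c(1) True c(2) v] std[OF True] by metis
  next
    case False
    have qS: "q \<in> S" using q image_iff_out[OF False, of 1] by simp
    have W: "open (- K)" "q \<in> - K" using closed_K K_dom False by auto
    have "u \<in> tangent_space c S q"
      by (rule tangent_space_local[OF c(1) W _ u(1)]) (use image_iff_off_K[of _ 1] in auto)
    then obtain v where v: "v \<in> tangent_space c S q" "\<omega> c q u v \<noteq> 0"
      using S qS c u(2) unfolding symplectic_surface_def by blast
    have "v \<in> tangent_space c (\<Phi> 1 ` S) q"
      by (rule tangent_space_local[OF c(1) W _ v(1)]) (use image_iff_off_K[of _ 1] in auto)
    then show ?thesis using v(2) by blast
  qed
qed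

lemma local_deformation_Phi:
  assumes "\<And>x y. x \<in> chart_dom b \<Longrightarrow> y \<in> chart_dom b \<Longrightarrow> dist (coord c x) (coord c y) < \<epsilon>"
  shows "local_deformation A c (chart_dom b) \<epsilon> S (\<Phi> 1 ` S)"
  unfolding local_deformation_def
  using isotopy_Phi Phi_in(1) assms by (intro exI[of _ \<Phi>]) (auto simp: \<Phi>_def)

end

section \<open>Positivity and flattening of the graphs\<close>

text \<open>
  The decomposition into a complex linear and an antilinear part.
\<close>

lemma real_linear_complex:
  fixes L :: "complex \<Rightarrow> complex"
  assumes "linear L"
  shows "L \<zeta> = (L 1 - \<i> * L \<i>) / 2 * \<zeta> + (L 1 + \<i> * L \<i>) / 2 * cnj \<zeta>"
  by (subst linear_complex_expand[OF assms]) (simp add: complex_eq_iff field_simps)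

text \<open>
  For \<open>L \<zeta> = \<alpha> \<zeta> + \<beta> cnj \<zeta>\<close> one has \<open>L 1 = \<alpha> + \<beta>\<close> and \<open>L i = i (\<alpha> - \<beta>)\<close>, so this is the determinant
  of \<open>L\<close>.
\<close>

lemma Im_cnj_mult_split:
  "Im (cnj (\<alpha> + \<beta>) * (\<i> * (\<alpha> - \<beta>))) = (cmod \<alpha>)\<^sup>2 - (cmod \<beta>)\<^sup>2"
  unfolding cmod_power2 by (simp add: algebra_simps power2_eq_square)

lemma positive_basis_parametrized:
  fixes \<tau> :: "complex \<Rightarrow> complex \<times> complex"
  assumes lin: "linear \<tau>" and inj: "inj \<tau>" and T: "tangent_space c S q = range \<tau>"
  shows "\<omega> c q (\<tau> 1) (\<tau> \<i>) > 0 \<Longrightarrow> positive_basis \<omega> c S q (\<tau> 1) (\<tau> \<i>)"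
    "\<omega> c q (\<tau> \<i>) (\<tau> 1) > 0 \<Longrightarrow> positive_basis \<omega> c S q (\<tau> \<i>) (\<tau> 1)"
proof -
  have B: "{\<tau> 1, \<tau> \<i>} = \<tau> ` Basis" by (simp add: Basis_complex_def)
  have ne: "\<tau> 1 \<noteq> \<tau> \<i>" using inj by (auto simp: inj_eq complex_eq_iff)
  have ind: "independent {\<tau> 1, \<tau> \<i>}"
    unfolding B by (rule linear_independent_injective_image[OF lin independent_Basis inj_on_subset[OF inj subset_UNIV]])
  have sp: "span {\<tau> 1, \<tau> \<i>} = tangent_space c S q"
    unfolding B T linear_span_image[OF lin] span_Basis ..
  show "\<omega> c q (\<tau> 1) (\<tau> \<i>) > 0 \<Longrightarrow> positive_basis \<omega> c S q (\<tau> 1) (\<tau> \<i>)"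
    "\<omega> c q (\<tau> \<i>) (\<tau> 1) > 0 \<Longrightarrow> positive_basis \<omega> c S q (\<tau> \<i>) (\<tau> 1)"
    unfolding positive_basis_def using ne ind sp by (auto simp: insert_commute)
qed

lemma wedge_square_graphs:
  assumes "\<omega> c q = std_form"
  shows "wedge_square \<omega> c q (1, a) (\<i>, b) (1, a') (\<i>, b') = 2 * Im (cnj (a' - a) * (b' - b))"
    "wedge_square \<omega> c q (0, 1) (0, \<i>) (\<i>, b) (1, a) = - 2"
  unfolding wedge_square_def assms std_form_def by (simp_all add: algebra_simps)

context symplectic
begin

text \<open>
  As \<open>S\<close> is symplectic, the number in question is not 0. If it were negative, \<open>(i, L i), (1, L 1)\<close>
  would be a positive basis, and together with the positive basis \<open>(0, 1), (0, i)\<close> of the vertical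
  plane it would have the wrong orientation, whatever \<open>L\<close> is.
\<close>

lemma graph_tangent_positive:
  assumes d: "d \<in> A" "p \<in> chart_dom d" "\<omega> d p = std_form"
    and S: "symplectic_surface A \<omega> S" "p \<in> S" and S0: "tangent_space d S0 p = range (\<lambda>\<eta>. (0, \<eta>))"
    and T: "tangent_space d S p = range (\<lambda>\<zeta>. (\<zeta>, L \<zeta>))" and L: "linear L"
    and tp: "transverse_positive_at A \<omega> S0 S p"
  shows "std_form (1, L 1) (\<i>, L \<i>) > 0"
proof (rule ccontr)
  let ?\<tau> = "\<lambda>\<zeta>. (\<zeta>, L \<zeta>)" and ?\<upsilon> = "\<lambda>\<eta>. (0 :: complex, \<eta> :: complex)"
  have lin: "linear ?\<tau>" "linear ?\<upsilon>"
    by (auto intro!: linearI simp: linear_add[OF L] linear_cmul[OF L])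
  have inj: "inj ?\<tau>" "inj ?\<upsilon>" by (auto simp: inj_on_def)
  assume "\<not> std_form (1, L 1) (\<i>, L \<i>) > 0"
  moreover have "std_form (1, L 1) (\<i>, L \<i>) \<noteq> 0"
  proof
    assume z: "std_form (1, L 1) (\<i>, L \<i>) = 0"
    have "(1, L 1) \<in> tangent_space d S p" "(1 :: complex, L 1) \<noteq> 0" unfolding T by (auto simp: prod_eq_iff)
    then obtain v where v: "v \<in> tangent_space d S p" "std_form (1, L 1) v \<noteq> 0"
      using S d unfolding symplectic_surface_def by metis
    then obtain \<zeta> where \<zeta>: "v = ?\<tau> \<zeta>" unfolding T by blast
    have "?\<tau> \<zeta> = Re \<zeta> *\<^sub>R ?\<tau> 1 + Im \<zeta> *\<^sub>R ?\<tau> \<i>" by (rule linear_complex_expand[OF lin(1)])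
    then show False using v(2) z
      by (simp only: \<zeta> bilinear_radd[OF bilinear_std_form] bilinear_rmul[OF bilinear_std_form] std_form_alternating) simp
  qed
  ultimately have "std_form (\<i>, L \<i>) (1, L 1) > 0"
    using alternating_antisym[OF bilinear_std_form std_form_alternating, of "(\<i>, L \<i>)" "(1, L 1)"] by linarith
  then have "positive_basis \<omega> d S p (\<i>, L \<i>) (1, L 1)"
    using positive_basis_parametrized(2)[OF lin(1) inj(1) T, of \<omega>] d(3) by simp
  moreover have "positive_basis \<omega> d S0 p (0, 1) (0, \<i>)"
    using positive_basis_parametrized(1)[OF lin(2) inj(2) S0, of \<omega>] d(3) by (simp add: std_form_def)
  ultimately have "wedge_square \<omega> d p (0, 1) (0, \<i>) (\<i>, L \<i>) (1, L 1) > 0"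
    using tp d unfolding transverse_positive_at_def by blast
  then show False using wedge_square_graphs(2)[of \<omega> d p, OF d(3)] by simp
qed

text \<open>
  The orientation of the frame formed by two graphs is the sign of the determinant of \<open>L' - L\<close>.
\<close>

lemma graphs_tangent_positive:
  assumes d: "d \<in> A" "p \<in> chart_dom d" "\<omega> d p = std_form"
    and T: "tangent_space d S p = range (\<lambda>\<zeta>. (\<zeta>, L \<zeta>))" "tangent_space d S' p = range (\<lambda>\<zeta>. (\<zeta>, L' \<zeta>))"
    and L: "linear L" "linear L'" and pos: "std_form (1, L 1) (\<i>, L \<i>) > 0" "std_form (1, L' 1) (\<i>, L' \<i>) > 0"
    and tp: "transverse_positive_at A \<omega> S S' p"
  shows "Im (cnj (L' 1 - L 1) * (L' \<i> - L \<i>)) > 0"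
proof -
  have lin: "linear (\<lambda>\<zeta>. (\<zeta>, L \<zeta>))" "linear (\<lambda>\<zeta>. (\<zeta>, L' \<zeta>))"
    by (auto intro!: linearI simp: linear_add[OF L(1)] linear_cmul[OF L(1)] linear_add[OF L(2)] linear_cmul[OF L(2)])
  have inj: "inj (\<lambda>\<zeta>. (\<zeta>, L \<zeta>))" "inj (\<lambda>\<zeta>. (\<zeta>, L' \<zeta>))" by (auto simp: inj_on_def)
  have "positive_basis \<omega> d S p (1, L 1) (\<i>, L \<i>)" "positive_basis \<omega> d S' p (1, L' 1) (\<i>, L' \<i>)"
    using positive_basis_parametrized(1)[OF lin(1) inj(1) T(1), of \<omega>]
      positive_basis_parametrized(1)[OF lin(2) inj(2) T(2), of \<omega>] d(3) pos by auto
  then have "wedge_square \<omega> d p (1, L 1) (\<i>, L \<i>) (1, L' 1) (\<i>, L' \<i>) > 0"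
    using tp d unfolding transverse_positive_at_def by blast
  then show ?thesis using wedge_square_graphs(1)[of \<omega> d p, OF d(3)] by simp
qed

end

lemma finite_uniform_radius:
  fixes P :: "'i \<Rightarrow> real \<Rightarrow> bool"
  assumes "finite I" "\<And>i. i \<in> I \<Longrightarrow> \<exists>r>0. P i r"
    and "\<And>i r r'. i \<in> I \<Longrightarrow> P i r \<Longrightarrow> 0 < r' \<Longrightarrow> r' \<le> r \<Longrightarrow> P i r'"
  shows "\<exists>r>0. \<forall>i\<in>I. P i r"
  using assms
proof (induction I rule: finite_induct)
  case empty
  show ?case by (rule exI[of _ 1]) simp
next
  case (insert i I)
  have "\<exists>r>0. \<forall>i\<in>I. P i r" by (rule insert.IH) (use insert.prems in blast)+
  then obtain r where r: "r > 0" "\<forall>i\<in>I. P i r" by blast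
  obtain s where s: "s > 0" "P i s" using insert.prems(1) by blast
  have "P i (min r s)" using insert.prems(2)[of i s "min r s"] r s by simp
  moreover have "P j (min r s)" if "j \<in> I" for j using insert.prems(2)[of j r "min r s"] r s that by simp
  ultimately show ?case using r(1) s(1) by (intro exI[of _ "min r s"]) auto
qed

text \<open>
  The germ at 0 of a graph \<open>w = F z\<close> through the origin whose tangent plane has slope
  \<open>\<zeta> \<mapsto> \<alpha> \<zeta> + \<beta> cnj \<zeta>\<close>.
\<close>

locale graph_germ =
  fixes R :: real and F :: "complex \<Rightarrow> complex" and \<alpha> \<beta> :: complex
  assumes R: "R > 0" and smF: "smooth_on (ball 0 R) F" and F0: "F 0 = 0"
    and DF0: "\<And>\<zeta>. frechet_derivative F (at 0) \<zeta> = \<alpha> * \<zeta> + \<beta> * cnj \<zeta>"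
begin

lemma DF: "z \<in> ball 0 R \<Longrightarrow> (F has_derivative frechet_derivative F (at z)) (at z)"
  by (rule smooth_has_derivative[OF smF])

lemma near_zero:
  assumes e: "e > 0"
  obtains r where "0 < r" "r \<le> R" "\<And>z. norm z < r \<Longrightarrow> norm (F z - (\<alpha> * z + \<beta> * cnj z)) \<le> e * norm z"
    "\<And>z v. norm z < r \<Longrightarrow> v \<in> {1, \<i>} \<Longrightarrow> norm (frechet_derivative F (at z) v - (\<alpha> * v + \<beta> * cnj v)) \<le> e"
proof -
  have z: "0 \<in> ball 0 R" using R by simp
  obtain r1 where r1: "r1 > 0" "\<And>z. norm (z - 0) < r1 \<Longrightarrow> norm (F z - F 0 - frechet_derivative F (at 0) (z - 0)) \<le> e * norm (z - 0)"
    using DF[OF z] e unfolding has_derivative_at_alt by blast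
  have c: "isCont (\<lambda>z. frechet_derivative F (at z) v) 0" for v
    using smooth_on_continuous[OF smooth_frechet[OF smF, of v]] z
    by (simp add: continuous_on_eq_continuous_at)
  have "\<exists>r>0. \<forall>z. norm z < r \<longrightarrow> norm (frechet_derivative F (at z) v - (\<alpha> * v + \<beta> * cnj v)) \<le> e" for v
  proof -
    obtain r where "r > 0" "\<And>z. dist z 0 < r \<Longrightarrow> dist (frechet_derivative F (at z) v) (frechet_derivative F (at 0) v) < e"
      using c[of v] e unfolding continuous_at_eps_delta by blast
    then show ?thesis by (intro exI[of _ r]) (auto simp: dist_norm DF0 less_imp_le)
  qed
  then obtain r2 r3 where r23: "r2 > 0" "r3 > 0"
    "\<And>z. norm z < r2 \<Longrightarrow> norm (frechet_derivative F (at z) 1 - (\<alpha> * 1 + \<beta> * cnj 1)) \<le> e"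
    "\<And>z. norm z < r3 \<Longrightarrow> norm (frechet_derivative F (at z) \<i> - (\<alpha> * \<i> + \<beta> * cnj \<i>)) \<le> e" by metis
  show ?thesis
  proof (rule that[of "min (min r1 R) (min r2 r3)"])
    show "norm (F z - (\<alpha> * z + \<beta> * cnj z)) \<le> e * norm z" if "norm z < min (min r1 R) (min r2 r3)" for z
      using r1(2)[of z] that by (simp add: F0 DF0)
    show "norm (frechet_derivative F (at z) v - (\<alpha> * v + \<beta> * cnj v)) \<le> e"
      if "norm z < min (min r1 R) (min r2 r3)" "v \<in> {1, \<i>}" for z v
      using r23(3,4)[of z] that by auto
  qed (use r1 r23 R in auto)
qed

lemma flattening_small:
  assumes "\<rho> > 0"
  shows "\<exists>r>0. \<forall>z. norm z < r \<longrightarrow> norm (F z) < \<rho> \<and> norm (a * z) < \<rho>"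
proof -
  have "0 \<in> ball 0 R" using R by simp
  then have "isCont F 0" using smooth_on_continuous[OF smF] by (simp add: continuous_on_eq_continuous_at)
  then obtain r where r: "r > 0" "\<And>z. dist z 0 < r \<Longrightarrow> dist (F z) (F 0) < \<rho>"
    using assms unfolding continuous_at_eps_delta by blast
  have "isCont (\<lambda>z. a * z) 0" by (intro continuous_intros)
  then obtain s where s: "s > 0" "\<And>z. dist z 0 < s \<Longrightarrow> dist (a * z) (a * 0) < \<rho>"
    using assms unfolding continuous_at_eps_delta by blast
  show ?thesis using r s by (intro exI[of _ "min r s"]) (auto simp: F0)
qed

text \<open>
  The derivative of the flattened function at \<open>z\<close> is \<open>(\<alpha> + s \<kappa>) v + (1 - s) \<beta> cnj v\<close> with
  \<open>s = \<psi> z\<close>, up to an error. One part of the error comes from \<open>F\<close> and is small for small \<open>z\<close>. The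
  other one is the derivative of \<open>\<psi>\<close> times a quantity of size \<open>norm z\<close>, which is small by the
  hypothesis on \<open>\<psi>\<close>. The margin \<open>m\<close> absorbs both. The radius does not depend on \<open>\<psi>\<close>, so that \<open>\<psi>\<close>
  can be chosen afterwards, in common for all surfaces. The flattened function is written as
  \<open>F z + 1 *\<^sub>R H z\<close>, the end of the isotopy above.
\<close>

lemma flattening_positive:
  assumes m: "m > 0" "\<And>s. s \<in> {0..1} \<Longrightarrow> m \<le> 1 + (cmod (\<alpha> + s *\<^sub>R \<kappa>))\<^sup>2 - (cmod ((1 - s) *\<^sub>R \<beta>))\<^sup>2"
  shows "\<exists>r>0. \<forall>\<psi>. smooth_on UNIV \<psi> \<longrightarrow> (\<forall>z. 0 \<le> \<psi> z \<and> \<psi> z \<le> 1) \<longrightarrow>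
      (\<forall>z v. \<bar>frechet_derivative \<psi> (at z) v\<bar> * norm z \<le> r * norm v) \<longrightarrow>
      (\<forall>z. norm z < r \<longrightarrow>
        (let D = frechet_derivative (\<lambda>z. F z + 1 *\<^sub>R (\<psi> z *\<^sub>R ((\<alpha> + \<kappa>) * z - F z))) (at z) in std_form (1, D 1) (\<i>, D \<i>) > 0))"
proof -
  define C where "C = cmod \<alpha> + cmod \<kappa> + cmod \<beta> + 1"
  have C: "C \<ge> 1" by (simp add: C_def)
  define \<eta> where "\<eta> = min 1 (m / (4 * (2 * C + 1)))"
  have eta: "\<eta> > 0" "\<eta> \<le> 1" using m(1) C by (auto simp: \<eta>_def)
  have etam: "\<eta> * (2 * C + 1) \<le> m / 4"
  proof -
    have "\<eta> \<le> m / (4 * (2 * C + 1))" by (simp add: \<eta>_def)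
    then have "\<eta> * (4 * (2 * C + 1)) \<le> m" using C by (simp add: pos_le_divide_eq)
    then show ?thesis by (simp add: algebra_simps)
  qed
  obtain r0 where r0: "0 < r0" "r0 \<le> R" "\<And>z. norm z < r0 \<Longrightarrow> norm (F z - (\<alpha> * z + \<beta> * cnj z)) \<le> \<eta> / 2 * norm z"
    "\<And>z v. norm z < r0 \<Longrightarrow> v \<in> {1, \<i>} \<Longrightarrow> norm (frechet_derivative F (at z) v - (\<alpha> * v + \<beta> * cnj v)) \<le> \<eta> / 2"
    by (rule near_zero[of "\<eta> / 2"]) (use eta in auto)
  define \<delta> where "\<delta> = \<eta> / (4 * C)"
  have delta: "\<delta> > 0" "2 * C * \<delta> = \<eta> / 2" using eta C by (auto simp: \<delta>_def)
  have key: "std_form (1, D 1) (\<i>, D \<i>) > 0"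
    if \<psi>: "smooth_on UNIV \<psi>" "\<And>z. 0 \<le> \<psi> z \<and> \<psi> z \<le> 1" "\<And>z v. \<bar>frechet_derivative \<psi> (at z) v\<bar> * norm z \<le> \<delta> * norm v"
      and z: "norm z < r0" and D: "D = frechet_derivative (\<lambda>z. F z + 1 *\<^sub>R (\<psi> z *\<^sub>R ((\<alpha> + \<kappa>) * z - F z))) (at z)"
    for \<psi> z D
  proof -
    let ?s = "\<psi> z" and ?F' = "frechet_derivative F (at z)" and ?p = "frechet_derivative \<psi> (at z)"
    have zR: "z \<in> ball 0 R" using z r0(2) by simp
    \<comment> \<open>The member of the path at the stage \<open>s = \<psi> z\<close>, and the error.\<close>
    define A where "A v = (\<alpha> + ?s *\<^sub>R \<kappa>) * v + ((1 - ?s) *\<^sub>R \<beta>) * cnj v" for v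
    define E where "E v = (1 - ?s) *\<^sub>R (?F' v - (\<alpha> * v + \<beta> * cnj v)) + ?p v *\<^sub>R ((\<alpha> + \<kappa>) * z - F z)" for v
    have "((\<lambda>z. F z + 1 *\<^sub>R (\<psi> z *\<^sub>R ((\<alpha> + \<kappa>) * z - F z))) has_derivative
        (\<lambda>v. ?F' v + 1 *\<^sub>R (?s *\<^sub>R ((\<alpha> + \<kappa>) * v - ?F' v) + ?p v *\<^sub>R ((\<alpha> + \<kappa>) * z - F z)))) (at z)"
      by (intro has_derivative_add has_derivative_scaleR_right has_derivative_scaleR has_derivative_diff
          has_derivative_mult_right has_derivative_ident DF[OF zR] smooth_has_derivative[OF \<psi>(1)]) simp
    from frechet_eq[OF this] have DAE: "D v = A v + E v" for v
      unfolding D A_def E_def by (simp add: algebra_simps scaleR_conv_of_real)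
    have s: "0 \<le> ?s" "?s \<le> 1" using \<psi>(2)[of z] by auto
    have az: "norm ((\<alpha> + \<kappa>) * z - F z) \<le> 2 * C * norm z"
    proof -
      have "norm ((\<alpha> + \<kappa>) * z - F z) = norm (\<kappa> * z - \<beta> * cnj z - (F z - (\<alpha> * z + \<beta> * cnj z)))" by (simp add: algebra_simps)
      also have "\<dots> \<le> norm (\<kappa> * z) + norm (\<beta> * cnj z) + norm (F z - (\<alpha> * z + \<beta> * cnj z))"
        by (meson norm_triangle_ineq4 order_trans add_right_mono)
      also have "\<dots> \<le> cmod \<kappa> * norm z + cmod \<beta> * norm z + 1 * norm z"
        using r0(3)[OF z] mult_right_mono[of "\<eta> / 2" 1 "norm z"] eta by (simp add: norm_mult)
      also have "\<dots> = (cmod \<kappa> + cmod \<beta> + 1) * norm z" by (simp add: algebra_simps)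
      also have "\<dots> \<le> 2 * C * norm z" by (rule mult_right_mono) (auto simp: C_def)
      finally show ?thesis .
    qed
    have Eb: "norm (E v) \<le> \<eta>" if v: "v \<in> {1, \<i>}" for v
    proof -
      have nv: "norm v = 1" using v by auto
      have "norm (E v) \<le> (1 - ?s) * norm (?F' v - (\<alpha> * v + \<beta> * cnj v)) + \<bar>?p v\<bar> * norm ((\<alpha> + \<kappa>) * z - F z)"
        unfolding E_def using norm_triangle_ineq s by (metis (no_types, lifting) abs_of_nonneg diff_ge_0_iff_ge norm_scaleR)
      also have "\<dots> \<le> 1 * (\<eta> / 2) + \<bar>?p v\<bar> * (2 * C * norm z)"
        using r0(4)[OF z v] s az eta by (intro add_mono mult_mono mult_left_mono) auto
      also have "\<bar>?p v\<bar> * (2 * C * norm z) = 2 * C * (\<bar>?p v\<bar> * norm z)" by simp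
      also have "\<dots> \<le> 2 * C * \<delta>" using \<psi>(3)[of z v] C nv by (intro mult_left_mono) auto
      finally show ?thesis using delta(2) by simp
    qed
    have Ab: "norm (A v) \<le> C" if v: "v \<in> {1, \<i>}" for v
    proof -
      have nv: "norm v = 1" using v by auto
      have "norm (A v) \<le> norm (\<alpha> * v) + norm ((?s *\<^sub>R \<kappa>) * v) + norm (((1 - ?s) *\<^sub>R \<beta>) * cnj v)"
        unfolding A_def distrib_right by (meson norm_triangle_ineq order_trans add_right_mono)
      also have "\<dots> \<le> cmod \<alpha> + cmod \<kappa> + cmod \<beta>"
        using s nv mult_right_mono[of ?s 1 "cmod \<kappa>"] mult_right_mono[of "1 - ?s" 1 "cmod \<beta>"] by (simp add: norm_mult)
      finally show ?thesis by (simp add: C_def)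
    qed
    have im: "\<bar>Im (cnj x * y)\<bar> \<le> norm x * norm y" for x y :: complex
      using abs_Im_le_cmod[of "cnj x * y"] by (simp add: norm_mult)
    have "Im (cnj (D 1) * D \<i>) = Im (cnj (A 1) * A \<i>) + (Im (cnj (A 1) * E \<i>) + Im (cnj (E 1) * A \<i>) + Im (cnj (E 1) * E \<i>))"
      unfolding DAE by (simp add: algebra_simps)
    moreover have "norm (A 1) * norm (E \<i>) \<le> C * \<eta>" "norm (E 1) * norm (A \<i>) \<le> \<eta> * C" "norm (E 1) * norm (E \<i>) \<le> \<eta> * 1"
      using Ab[of 1] Ab[of \<i>] Eb[of 1] Eb[of \<i>] eta C by (auto intro!: mult_mono simp del: mult_1_right)
    moreover have "C * \<eta> + \<eta> * C + \<eta> * 1 \<le> m / 4" using etam by (simp add: algebra_simps)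
    moreover have "Im (cnj (A 1) * A \<i>) = (cmod (\<alpha> + ?s *\<^sub>R \<kappa>))\<^sup>2 - (cmod ((1 - ?s) *\<^sub>R \<beta>))\<^sup>2"
    proof -
      have "A 1 = (\<alpha> + ?s *\<^sub>R \<kappa>) + ((1 - ?s) *\<^sub>R \<beta>)" "A \<i> = \<i> * ((\<alpha> + ?s *\<^sub>R \<kappa>) - ((1 - ?s) *\<^sub>R \<beta>))"
        by (simp_all add: A_def algebra_simps)
      then show ?thesis using Im_cnj_mult_split by presburger
    qed
    moreover have "m \<le> 1 + (cmod (\<alpha> + ?s *\<^sub>R \<kappa>))\<^sup>2 - (cmod ((1 - ?s) *\<^sub>R \<beta>))\<^sup>2" using m(2) s by simp
    ultimately have "1 + Im (cnj (D 1) * D \<i>) > 0"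
      using im[of "A 1" "E \<i>"] im[of "E 1" "A \<i>"] im[of "E 1" "E \<i>"] m(1) by linarith
    then show ?thesis by (simp add: std_form_def)
  qed
  show ?thesis
  proof (intro exI[of _ "min r0 \<delta>"] conjI allI impI)
    show "min r0 \<delta> > 0" using r0(1) delta(1) by simp
    fix \<psi> :: "complex \<Rightarrow> real" and z :: complex
    assume a: "smooth_on UNIV \<psi>" "\<forall>z. 0 \<le> \<psi> z \<and> \<psi> z \<le> 1"
      "\<forall>z v. \<bar>frechet_derivative \<psi> (at z) v\<bar> * norm z \<le> min r0 \<delta> * norm v" "norm z < min r0 \<delta>"
    have "\<bar>frechet_derivative \<psi> (at z) v\<bar> * norm z \<le> \<delta> * norm v" for z v
      using a(3) mult_right_mono[of "min r0 \<delta>" \<delta> "norm v"] by (meson min.cobounded2 norm_ge_zero order_trans)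
    then show "let D = frechet_derivative (\<lambda>z. F z + 1 *\<^sub>R (\<psi> z *\<^sub>R ((\<alpha> + \<kappa>) * z - F z))) (at z) in std_form (1, D 1) (\<i>, D \<i>) > 0"
      unfolding Let_def by (intro key[OF a(1) _ _ _ refl]) (use a in auto)
  qed
qed

end

text \<open>
  If two flattened graphs met over \<open>z\<close>, then \<open>(\<alpha>1 - \<alpha>2) z\<close> would equal \<open>- (1 - s) (\<beta>1 - \<beta>2) cnj z\<close>
  up to \<open>o(norm z)\<close>, contradicting the strict inequality between the slopes. The common shift \<open>\<kappa>\<close>
  cancels.
\<close>

lemma flattening_disjoint:
  assumes "graph_germ R1 F1 \<alpha>1 \<beta>1" "graph_germ R2 F2 \<alpha>2 \<beta>2" and ab: "cmod (\<beta>1 - \<beta>2) < cmod (\<alpha>1 - \<alpha>2)"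
  shows "\<exists>r>0. \<forall>z s. 0 < norm z \<longrightarrow> norm z < r \<longrightarrow> 0 \<le> s \<longrightarrow> s \<le> 1 \<longrightarrow>
    F1 z + s *\<^sub>R ((\<alpha>1 + \<kappa>) * z - F1 z) \<noteq> F2 z + s *\<^sub>R ((\<alpha>2 + \<kappa>) * z - F2 z)"
proof -
  interpret g1: graph_germ R1 F1 \<alpha>1 \<beta>1 by fact
  interpret g2: graph_germ R2 F2 \<alpha>2 \<beta>2 by fact
  define e where "e = (cmod (\<alpha>1 - \<alpha>2) - cmod (\<beta>1 - \<beta>2)) / 4"
  have e: "e > 0" using ab by (simp add: e_def)
  obtain r1 where r1: "r1 > 0" "\<And>z. norm z < r1 \<Longrightarrow> norm (F1 z - (\<alpha>1 * z + \<beta>1 * cnj z)) \<le> e * norm z"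
    by (rule g1.near_zero[OF e]) blast
  obtain r2 where r2: "r2 > 0" "\<And>z. norm z < r2 \<Longrightarrow> norm (F2 z - (\<alpha>2 * z + \<beta>2 * cnj z)) \<le> e * norm z"
    by (rule g2.near_zero[OF e]) blast
  show ?thesis
  proof (intro exI[of _ "min r1 r2"] conjI allI impI notI)
    fix z :: complex and s :: real
    assume z: "0 < norm z" "norm z < min r1 r2" and s: "0 \<le> s" "s \<le> 1"
      and eq: "F1 z + s *\<^sub>R ((\<alpha>1 + \<kappa>) * z - F1 z) = F2 z + s *\<^sub>R ((\<alpha>2 + \<kappa>) * z - F2 z)"
    let ?q1 = "F1 z - (\<alpha>1 * z + \<beta>1 * cnj z)" and ?q2 = "F2 z - (\<alpha>2 * z + \<beta>2 * cnj z)"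
    have "(\<alpha>1 - \<alpha>2) * z = - ((1 - s) *\<^sub>R ((\<beta>1 - \<beta>2) * cnj z + ?q1 - ?q2))"
      using eq by (simp add: algebra_simps scaleR_conv_of_real)
    then have "cmod (\<alpha>1 - \<alpha>2) * norm z = (1 - s) * norm ((\<beta>1 - \<beta>2) * cnj z + ?q1 - ?q2)"
      using s by (metis abs_of_nonneg diff_ge_0_iff_ge norm_minus_cancel norm_mult norm_scaleR)
    also have "\<dots> \<le> 1 * norm ((\<beta>1 - \<beta>2) * cnj z + ?q1 - ?q2)" using s by (intro mult_right_mono) auto
    also have "\<dots> \<le> norm ((\<beta>1 - \<beta>2) * cnj z) + norm ?q1 + norm ?q2"
      using norm_triangle_ineq4[of "(\<beta>1 - \<beta>2) * cnj z + ?q1" ?q2] norm_triangle_ineq[of "(\<beta>1 - \<beta>2) * cnj z" ?q1] by simp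
    also have "\<dots> \<le> (cmod (\<beta>1 - \<beta>2) + 2 * e) * norm z"
    proof -
      have "norm ((\<beta>1 - \<beta>2) * cnj z) = cmod (\<beta>1 - \<beta>2) * norm z" by (simp add: norm_mult)
      moreover have "norm ?q1 \<le> e * norm z" "norm ?q2 \<le> e * norm z" using r1(2)[of z] r2(2)[of z] z by auto
      ultimately show ?thesis unfolding distrib_right by linarith
    qed
    finally have "cmod (\<alpha>1 - \<alpha>2) \<le> cmod (\<beta>1 - \<beta>2) + 2 * e" using z(1) by simp
    moreover have "4 * e = cmod (\<alpha>1 - \<alpha>2) - cmod (\<beta>1 - \<beta>2)" by (simp add: e_def)
    ultimately show False using e by linarith
  qed (use r1 r2 in auto)
qed

lemma darboux_chartI:
  assumes "d \<in> A" "\<And>q. q \<in> chart_dom d \<Longrightarrow> \<omega> d q = std_form"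
  shows "darboux_chart A \<omega> d"
  unfolding darboux_chart_def using assms by (simp add: std_form_def complex_eq_iff field_simps)

lemma interval_avoids_finite:
  fixes r :: real assumes "r > 0" "finite B"
  obtains t where "0 < t" "t < r" "t \<notin> B"
proof -
  have "infinite ({0<..<r} - B)" using assms by (simp add: infinite_Ioo)
  then have "{0<..<r} - B \<noteq> {}" by (metis finite.emptyI)
  then obtain x where "x \<in> {0<..<r} - B" by blast
  then show ?thesis using that[of x] by auto
qed

theorem theorem2p8:
  fixes A :: "('a::{t2_space,second_countable_topology}) chart set"
    and \<omega> :: "'a form2"
    and l :: nat
    and S :: "nat \<Rightarrow> 'a set"
    and p :: 'a
  assumes "symplectic_manifold A \<omega>"
    and "\<And>i. i \<le> l \<Longrightarrow> symplectic_surface A \<omega> (S i)"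
    and "\<And>i. i \<le> l \<Longrightarrow> p \<in> S i"
    and "\<And>i j. i \<le> l \<Longrightarrow> j \<le> l \<Longrightarrow> i \<noteq> j \<Longrightarrow> transverse_positive_at A \<omega> (S i) (S j) p"
  shows "\<forall>c\<in>A. \<forall>U. \<forall>\<epsilon>>0. p \<in> chart_dom c \<and> open U \<and> p \<in> U \<longrightarrow>
    (\<exists>S'. \<exists>b\<in>A. p \<in> chart_dom b \<and> chart_dom b \<subseteq> U \<inter> chart_dom c \<and>
      (\<forall>j\<in>{1..l}. symplectic_surface A \<omega> (S' j)) \<and>
      (\<forall>j\<in>{1..l}. local_deformation A c (chart_dom b) \<epsilon> (S j) (S' j)) \<and>
      (\<forall>j\<in>{1..l}. S 0 \<inter> S' j \<inter> chart_dom b = {p}) \<and>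
      (\<forall>i\<in>{1..l}. \<forall>j\<in>{1..l}. i \<noteq> j \<longrightarrow> S' i \<inter> S' j \<inter> chart_dom b = {p}) \<and>
      (\<exists>d a. darboux_chart A \<omega> d \<and> p \<in> chart_dom d \<and> coord d p = (0, 0) \<and>
         S 0 \<inter> chart_dom d = {q \<in> chart_dom d. fst (coord d q) = 0} \<and>
         (\<forall>j\<in>{1..l}. S' j \<inter> chart_dom d =
            {q \<in> chart_dom d. snd (coord d q) = a j * fst (coord d q)}) \<and>
         (\<forall>j\<in>{1..l}. a j \<noteq> 0) \<and> inj_on a {1..l}))"
proof (intro ballI allI impI)
  fix c U and \<epsilon> :: real
  assume c: "c \<in> A" and \<epsilon>: "\<epsilon> > 0" and "p \<in> chart_dom c \<and> open U \<and> p \<in> U"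
  then have pc: "p \<in> chart_dom c" and U: "open U" "p \<in> U" by auto
  interpret symplectic A \<omega> by unfold_locales (rule assms(1))
  let ?J = "{1..l}"
  have jl: "j \<le> l" "j \<noteq> 0" if "j \<in> ?J" for j using that by auto
  \<comment> \<open>With radius \<open>\<epsilon> / 2\<close>, any two points of \<open>V\<close> are less than \<open>\<epsilon>\<close> apart in the chart \<open>c\<close>.\<close>
  define V where "V = U \<inter> (chart_dom c \<inter> coord c -` ball (coord c p) (\<epsilon> / 2))"
  have V: "open V" "p \<in> V"
  proof -
    show "open V" unfolding V_def
      by (intro open_Int U continuous_open_preimage[OF continuous_coord[OF c] open_dom[OF c] open_ball])
    show "p \<in> V" using U pc \<epsilon> by (simp add: V_def)
  qed
  obtain d0 where d0: "d0 \<in> A" "p \<in> chart_dom d0" "chart_dom d0 \<subseteq> V" "coord d0 p = 0"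
    "\<And>q. q \<in> chart_dom d0 \<Longrightarrow> \<omega> d0 q = std_form"
    "\<And>q. q \<in> chart_dom d0 \<Longrightarrow> q \<in> S 0 \<longleftrightarrow> fst (coord d0 q) = 0"
    by (rule adapted_darboux_chart[OF assms(2)[OF le0] assms(3)[OF le0] V]) (rule that)
  have T0: "tangent_space d0 (S 0) p = range (\<lambda>\<eta>. (0, \<eta>))"
    by (rule vertical_tangent[OF d0(1,2) assms(3)[OF le0] d0(6)])
  have tp0: "transverse_positive_at A \<omega> (S 0) (S j) p" if "j \<in> ?J" for j
    by (rule assms(4)) (use jl[OF that] in auto)
  have "\<exists>R F. R > 0 \<and> smooth_on (ball 0 R) F \<and> F 0 = 0 \<and> (\<forall>z\<in>ball 0 R. \<forall>w\<in>ball 0 R.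
      (z, w) \<in> coord d0 ` chart_dom d0 \<and> (chart_inv d0 (z, w) \<in> S j \<longleftrightarrow> w = F z))" if j: "j \<in> ?J" for j
  proof -
    have "embedded_surface A (S j)" "p \<in> S j" using assms(2,3)[OF jl(1)[OF j]] by (auto simp: symplectic_surface_def)
    then show ?thesis
    proof (rule implicit_graph[OF d0(1,2,4)])
      fix \<eta> assume "(0, \<eta>) \<in> tangent_space d0 (S j) p"
      moreover have "(0, \<eta>) \<in> tangent_space d0 (S 0) p" unfolding T0 by blast
      moreover have "tangent_space d0 (S 0) p \<inter> tangent_space d0 (S j) p = {0}"
        using tp0[OF j] d0(1,2) unfolding transverse_positive_at_def by blast
      ultimately have "(0, \<eta>) = (0 :: c2)" by blast
      then show "\<eta> = 0" by (simp add: prod_eq_iff)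
    qed blast
  qed
  then obtain Rf Ff where RF: "\<And>j. j \<in> ?J \<Longrightarrow> Rf j > 0 \<and> smooth_on (ball 0 (Rf j)) (Ff j) \<and> Ff j 0 = 0 \<and>
      (\<forall>z\<in>ball 0 (Rf j). \<forall>w\<in>ball 0 (Rf j). (z, w) \<in> coord d0 ` chart_dom d0 \<and> (chart_inv d0 (z, w) \<in> S j \<longleftrightarrow> w = Ff j z))"
    by metis
  define L where "L j = frechet_derivative (Ff j) (at 0)" for j
  have linL: "linear (L j)" if "j \<in> ?J" for j
    unfolding L_def by (rule has_derivative_linear[OF smooth_has_derivative[of "ball 0 (Rf j)"]]) (use RF[OF that] in auto)
  have TL: "tangent_space d0 (S j) p = range (\<lambda>\<zeta>. (\<zeta>, L j \<zeta>))" if j: "j \<in> ?J" for j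
  proof -
    let ?N = "ball 0 (Rf j) \<times> ball 0 (Rf j) :: c2 set"
    have "tangent_space d0 (S j) p = range (\<lambda>\<zeta>. (\<zeta>, frechet_derivative (Ff j) (at (fst (coord d0 p))) \<zeta>))"
    proof (rule graph_tangent[OF d0(1,2) assms(3)[OF jl(1)[OF j]]])
      show "open ?N" by (intro open_Times open_ball)
      show "coord d0 p \<in> ?N" using RF[OF j] by (simp add: d0(4) mem_Times_iff)
      show "?N \<subseteq> coord d0 ` chart_dom d0" using RF[OF j] by blast
      show "smooth_on (ball 0 (Rf j)) (Ff j)" using RF[OF j] by blast
      show "chart_inv d0 x \<in> S j \<longleftrightarrow> snd x = Ff j (fst x)" if "x \<in> ?N" for x
        using RF[OF j] that by (cases x) auto
    qed (auto simp: mem_Times_iff)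
    then show ?thesis by (simp add: d0(4) L_def)
  qed
  define al where "al j = (L j 1 - \<i> * L j \<i>) / 2" for j
  define be where "be j = (L j 1 + \<i> * L j \<i>) / 2" for j
  have L1: "L j 1 = al j + be j" and Li: "L j \<i> = \<i> * (al j - be j)" for j
    by (simp_all add: al_def be_def field_simps)
  have germ: "graph_germ (Rf j) (Ff j) (al j) (be j)" if j: "j \<in> ?J" for j
  proof
    show "Rf j > 0" "smooth_on (ball 0 (Rf j)) (Ff j)" "Ff j 0 = 0" using RF[OF j] by blast+
    show "frechet_derivative (Ff j) (at 0) \<zeta> = al j * \<zeta> + be j * cnj \<zeta>" for \<zeta>
      using real_linear_complex[OF linL[OF j], of \<zeta>] unfolding al_def be_def L_def .
  qed
  have posL: "std_form (1, L j 1) (\<i>, L j \<i>) > 0" if j: "j \<in> ?J" for j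
    by (rule graph_tangent_positive[OF d0(1,2) d0(5)[OF d0(2)] assms(2)[OF jl(1)[OF j]] assms(3)[OF jl(1)[OF j]] T0 TL[OF j] linL[OF j] tp0[OF j]])
  define m where "m j = 1 + (cmod (al j))\<^sup>2 - (cmod (be j))\<^sup>2" for j
  have m: "m j > 0" if j: "j \<in> ?J" for j
  proof -
    have "std_form (1, L j 1) (\<i>, L j \<i>) = 1 + Im (cnj (al j + be j) * (\<i> * (al j - be j)))"
      by (simp only: L1 Li std_form_def fst_conv snd_conv) simp
    then show ?thesis using posL[OF j] unfolding Im_cnj_mult_split m_def by simp
  qed
  have separated: "cmod (be i - be j) < cmod (al i - al j)" if i: "i \<in> ?J" and j: "j \<in> ?J" and ne: "i \<noteq> j" for i j
  proof -
    have "transverse_positive_at A \<omega> (S j) (S i) p" by (rule assms(4)) (use jl i j ne in auto)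
    from graphs_tangent_positive[OF d0(1,2) d0(5)[OF d0(2)] TL[OF j] TL[OF i] linL[OF j] linL[OF i] posL[OF j] posL[OF i] this]
    have "0 < Im (cnj ((al i - al j) + (be i - be j)) * (\<i> * ((al i - al j) - (be i - be j))))"
      unfolding L1 Li by (simp add: algebra_simps)
    then have "(cmod (be i - be j))\<^sup>2 < (cmod (al i - al j))\<^sup>2" unfolding Im_cnj_mult_split by simp
    then show ?thesis by (rule power2_less_imp_less) simp
  qed
  \<comment> \<open>A shift this small costs at most half of the margin \<open>m j\<close>. It is taken real and different
    from every \<open>- Re (al j)\<close>, which keeps the slopes \<open>a j\<close> nonzero.\<close>
  have "\<exists>r>0. \<forall>j\<in>?J. 2 * cmod (al j) * r \<le> m j / 2"
  proof (rule finite_uniform_radius)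
    fix j assume j: "j \<in> ?J"
    have "2 * cmod (al j) * (m j / (4 * (cmod (al j) + 1))) \<le> m j / 2"
    proof -
      have pos: "cmod (al j) + 1 > 0" using norm_ge_zero[of "al j"] by linarith
      have "2 * cmod (al j) * (m j / (4 * (cmod (al j) + 1))) = m j / 2 * (cmod (al j) / (cmod (al j) + 1))"
        using pos by (simp add: divide_simps)
      also have "\<dots> \<le> m j / 2 * 1" using m[OF j] pos by (intro mult_left_mono) (auto simp: divide_le_eq_1)
      finally show ?thesis by simp
    qed
    then show "\<exists>r>0. 2 * cmod (al j) * r \<le> m j / 2"
      using m[OF j] by (intro exI[of _ "m j / (4 * (cmod (al j) + 1))"]) (auto intro!: divide_pos_pos add_nonneg_pos)
  next
    fix j r r' assume "2 * cmod (al j) * r \<le> m j / 2" "r' \<le> (r :: real)"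
    then show "2 * cmod (al j) * r' \<le> m j / 2" using mult_left_mono[of r' r "2 * cmod (al j)"] by simp
  qed simp
  then obtain r0 where r0: "r0 > 0" "\<And>j. j \<in> ?J \<Longrightarrow> 2 * cmod (al j) * r0 \<le> m j / 2" by blast
  obtain t where t: "0 < t" "t < r0" "t \<notin> (\<lambda>j. - Re (al j)) ` ?J"
    by (rule interval_avoids_finite[OF r0(1) finite_imageI[OF finite_atLeastAtMost]]) (rule that)
  define \<kappa> where "\<kappa> = complex_of_real t"
  define a where "a j = al j + \<kappa>" for j
  have a0: "a j \<noteq> 0" if "j \<in> ?J" for j
  proof
    assume "a j = 0"
    then have "t = - Re (al j)" by (simp add: a_def \<kappa>_def complex_eq_iff)
    then show False using t(3) that by blast
  qed
  have inja: "inj_on a ?J"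
  proof (rule inj_onI, rule ccontr)
    fix i j assume "i \<in> ?J" "j \<in> ?J" "a i = a j" "i \<noteq> j"
    then show False using separated[of i j] by (simp add: a_def)
  qed
  have mbound: "m j / 2 \<le> 1 + (cmod (al j + s *\<^sub>R \<kappa>))\<^sup>2 - (cmod ((1 - s) *\<^sub>R be j))\<^sup>2" if j: "j \<in> ?J" and s: "s \<in> {0..1}" for j s
  proof -
    have "(cmod ((1 - s) *\<^sub>R be j))\<^sup>2 \<le> (1 * cmod (be j))\<^sup>2"
      unfolding norm_scaleR using s by (intro power_mono mult_right_mono) auto
    moreover have "(cmod (al j + s *\<^sub>R \<kappa>))\<^sup>2 = (cmod (al j))\<^sup>2 + 2 * (s * t) * Re (al j) + (s * t)\<^sup>2"
      unfolding cmod_power2 by (simp add: \<kappa>_def power2_eq_square algebra_simps)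
    moreover have "- (2 * cmod (al j) * r0) \<le> 2 * (s * t) * Re (al j)"
    proof -
      have st: "0 \<le> s * t" "s * t \<le> r0" using s t mult_mono[of s 1 t r0] by auto
      have "\<bar>(s * t) * Re (al j)\<bar> \<le> r0 * cmod (al j)"
        unfolding abs_mult using st abs_Re_le_cmod[of "al j"] by (intro mult_mono) auto
      then show ?thesis by (simp add: mult.commute mult.left_commute abs_le_iff)
    qed
    ultimately show ?thesis using r0(2)[OF j] unfolding m_def by (smt (verit) zero_le_power2 mult_1 field_sum_of_halves)
  qed
  have "\<exists>r>0. \<forall>j\<in>?J. r \<le> Rf j"
    by (rule finite_uniform_radius) (use RF in auto)
  then obtain r1 where r1: "r1 > 0" "\<And>j. j \<in> ?J \<Longrightarrow> r1 \<le> Rf j" by blast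
  have "0 \<in> coord d0 ` chart_dom d0" using d0(2,4) by (metis imageI)
  then obtain r2 where r2: "r2 > 0" "ball 0 r2 \<subseteq> coord d0 ` chart_dom d0"
    using open_image[OF d0(1)] open_contains_ball by blast
  define \<rho> where "\<rho> = min r1 (r2 / 2)"
  have rho: "\<rho> > 0" "\<And>j. j \<in> ?J \<Longrightarrow> \<rho> \<le> Rf j" using r1 r2 by (auto simp: \<rho>_def min_le_iff_disj)
  have box: "(z, w) \<in> coord d0 ` chart_dom d0" if "norm z < \<rho>" "norm w < \<rho>" for z w
  proof -
    have "(z, w) \<in> ball 0 r2" using norm_Pair_le[of z w] that by (auto simp: \<rho>_def)
    then show ?thesis using r2(2) by blast
  qed
  have "\<exists>r>0. \<forall>j\<in>?J. \<forall>z. norm z < r \<longrightarrow> norm (Ff j z) < \<rho> / 2 \<and> norm (a j * z) < \<rho> / 2"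
  proof (rule finite_uniform_radius)
    show "\<exists>r>0. \<forall>z. norm z < r \<longrightarrow> norm (Ff j z) < \<rho> / 2 \<and> norm (a j * z) < \<rho> / 2" if j: "j \<in> ?J" for j
      by (rule graph_germ.flattening_small[OF germ[OF j]]) (use rho(1) in simp)
    show "\<forall>z. norm z < r' \<longrightarrow> norm (Ff j z) < \<rho> / 2 \<and> norm (a j * z) < \<rho> / 2"
      if "\<forall>z. norm z < r \<longrightarrow> norm (Ff j z) < \<rho> / 2 \<and> norm (a j * z) < \<rho> / 2" "r' \<le> r" for j and r r' :: real
      using that by (meson order_less_le_trans)
  qed simp
  then obtain r3 where r3: "r3 > 0" "\<And>j z. j \<in> ?J \<Longrightarrow> norm z < r3 \<Longrightarrow> norm (Ff j z) < \<rho> / 2 \<and> norm (a j * z) < \<rho> / 2" by blast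
  let ?pos = "\<lambda>j r. \<forall>\<psi>. smooth_on UNIV \<psi> \<longrightarrow> (\<forall>z. 0 \<le> \<psi> z \<and> \<psi> z \<le> 1) \<longrightarrow>
      (\<forall>z v. \<bar>frechet_derivative \<psi> (at z) v\<bar> * norm z \<le> r * norm v) \<longrightarrow>
      (\<forall>z. norm z < r \<longrightarrow>
        (let D = frechet_derivative (\<lambda>z. Ff j z + 1 *\<^sub>R (\<psi> z *\<^sub>R ((al j + \<kappa>) * z - Ff j z))) (at z) in std_form (1, D 1) (\<i>, D \<i>) > 0))"
  have "\<exists>r>0. \<forall>j\<in>?J. ?pos j r"
  proof (rule finite_uniform_radius)
    show "\<exists>r>0. ?pos j r" if j: "j \<in> ?J" for j
      by (rule graph_germ.flattening_positive[OF germ[OF j], of "m j / 2"]) (use m[OF j] mbound[OF j] in auto)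
    fix j and r r' :: real assume h: "?pos j r" and r': "0 < r'" "r' \<le> r"
    show "?pos j r'"
    proof (intro allI impI)
      fix \<psi> :: "complex \<Rightarrow> real" and z :: complex
      assume \<psi>: "smooth_on UNIV \<psi>" "\<forall>z. 0 \<le> \<psi> z \<and> \<psi> z \<le> 1"
        "\<forall>z v. \<bar>frechet_derivative \<psi> (at z) v\<bar> * norm z \<le> r' * norm v" and z: "norm z < r'"
      have "\<forall>z v. \<bar>frechet_derivative \<psi> (at z) v\<bar> * norm z \<le> r * norm v"
        using \<psi>(3) mult_right_mono[OF r'(2)] by (meson norm_ge_zero order_trans)
      then show "let D = frechet_derivative (\<lambda>z. Ff j z + 1 *\<^sub>R (\<psi> z *\<^sub>R ((al j + \<kappa>) * z - Ff j z))) (at z) in std_form (1, D 1) (\<i>, D \<i>) > 0"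
        using h \<psi>(1,2) z r'(2) by (meson order_less_le_trans)
    qed
  qed simp
  then obtain r4 where r4: "r4 > 0" "\<forall>j\<in>?J. ?pos j r4" by blast
  let ?I = "{(i, j). i \<in> ?J \<and> j \<in> ?J \<and> i \<noteq> j}"
  have "\<exists>r>0. \<forall>x\<in>?I. \<forall>z s. 0 < norm z \<longrightarrow> norm z < r \<longrightarrow> 0 \<le> s \<longrightarrow> s \<le> 1 \<longrightarrow>
      Ff (fst x) z + s *\<^sub>R ((al (fst x) + \<kappa>) * z - Ff (fst x) z) \<noteq> Ff (snd x) z + s *\<^sub>R ((al (snd x) + \<kappa>) * z - Ff (snd x) z)"
  proof (rule finite_uniform_radius)
    show "finite ?I" by (rule finite_subset[of _ "?J \<times> ?J"]) auto
    fix x assume x: "x \<in> ?I"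
    show "\<exists>r>0. \<forall>z s. 0 < norm z \<longrightarrow> norm z < r \<longrightarrow> 0 \<le> s \<longrightarrow> s \<le> 1 \<longrightarrow>
      Ff (fst x) z + s *\<^sub>R ((al (fst x) + \<kappa>) * z - Ff (fst x) z) \<noteq> Ff (snd x) z + s *\<^sub>R ((al (snd x) + \<kappa>) * z - Ff (snd x) z)"
      by (rule flattening_disjoint[OF germ germ separated]) (use x in auto)
  next
    fix x r and r' :: real
    assume "\<forall>z s. 0 < norm z \<longrightarrow> norm z < r \<longrightarrow> 0 \<le> s \<longrightarrow> s \<le> 1 \<longrightarrow>
      Ff (fst x) z + s *\<^sub>R ((al (fst x) + \<kappa>) * z - Ff (fst x) z) \<noteq> Ff (snd x) z + s *\<^sub>R ((al (snd x) + \<kappa>) * z - Ff (snd x) z)" "r' \<le> r"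
    then show "\<forall>z s. 0 < norm z \<longrightarrow> norm z < r' \<longrightarrow> 0 \<le> s \<longrightarrow> s \<le> 1 \<longrightarrow>
      Ff (fst x) z + s *\<^sub>R ((al (fst x) + \<kappa>) * z - Ff (fst x) z) \<noteq> Ff (snd x) z + s *\<^sub>R ((al (snd x) + \<kappa>) * z - Ff (snd x) z)"
      by (meson order_less_le_trans)
  qed
  then obtain r5 where r5: "r5 > 0" "\<forall>x\<in>?I. \<forall>z s. 0 < norm z \<longrightarrow> norm z < r5 \<longrightarrow> 0 \<le> s \<longrightarrow> s \<le> 1 \<longrightarrow>
      Ff (fst x) z + s *\<^sub>R ((al (fst x) + \<kappa>) * z - Ff (fst x) z) \<noteq> Ff (snd x) z + s *\<^sub>R ((al (snd x) + \<kappa>) * z - Ff (snd x) z)"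
    by blast
  \<comment> \<open>All the estimates hold over the ball of radius \<open>R\<close>. The flattening is confined to the ball
    of radius \<open>R / 2\<close>, hence to a compact part of the box.\<close>
  define R where "R = min (min \<rho> r3) (min r4 r5)"
  have R: "R > 0" "R \<le> \<rho>" "R \<le> r3" "R \<le> r4" "R \<le> r5" using rho r3 r4 r5 by (auto simp: R_def)
  obtain \<psi> :: "complex \<Rightarrow> real" and r where \<psi>: "0 < r" "r < R / 2" "smooth_on UNIV \<psi>" "\<And>z. norm z \<le> r \<Longrightarrow> \<psi> z = 1"
    "\<And>z. norm z \<ge> R / 2 \<Longrightarrow> \<psi> z = 0" "\<And>z. 0 \<le> \<psi> z" "\<And>z. \<psi> z \<le> 1"
    "\<And>z v. \<bar>frechet_derivative \<psi> (at z) v\<bar> * norm z \<le> r4 * norm v"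
    by (rule log_cutoff[of "R / 2" r4, where 'a=complex]) (use R(1) r4(1) that in auto)
  define H where "H j z = \<psi> z *\<^sub>R (a j * z - Ff j z)" for j z
  let ?W = "ball 0 R \<times> ball 0 \<rho> :: c2 set"
  have oW: "open ?W" by (intro open_Times open_ball)
  have Wsub: "?W \<subseteq> coord d0 ` chart_dom d0" using box R(2) by auto
  obtain b where b: "b \<in> A" "coord b ` chart_dom b = ?W" "chart_dom b = chart_inv d0 ` ?W"
    "\<And>q. q \<in> chart_dom b \<Longrightarrow> coord b q = coord d0 q" "\<And>x. x \<in> ?W \<Longrightarrow> chart_inv b x = chart_inv d0 x"
    "chart_dom b \<subseteq> chart_dom d0"
    by (rule restricted_chart[OF d0(1) oW Wsub]) (rule that)
  have pb: "p \<in> chart_dom b"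
  proof -
    have "coord d0 p \<in> ?W" using R(1) rho(1) by (simp add: d0(4) mem_Times_iff)
    then have "chart_inv d0 (coord d0 p) \<in> chart_dom b" unfolding b(3) by (rule imageI)
    then show ?thesis using d0(1,2) by simp
  qed
  have cbp: "coord b p = 0" using b(4)[OF pb] d0(4) by simp
  have formb: "\<omega> b q = std_form" if "q \<in> chart_dom b" for q
    using restricted_form[OF d0(1) b(1,6,4) that] d0(5) b(6) that by auto
  have S0b: "q \<in> S 0 \<longleftrightarrow> fst (coord b q) = 0" if "q \<in> chart_dom b" for q
    using d0(6)[of q] b(4)[OF that] b(6) that by auto
  have gd: "graph_deformation A \<omega> b R (R / 2) \<rho> (\<rho> / 2) (S j) (Ff j) (H j)" if j: "j \<in> ?J" for j
  proof
    have sub: "ball 0 R \<subseteq> ball (0 :: complex) (Rf j)" using R(2) rho(2)[OF j] by auto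
    have smFj: "smooth_on (ball 0 R) (Ff j)" by (rule smooth_on_subset[OF _ sub]) (use RF[OF j] in blast)
    show "smooth_on (ball 0 R) (Ff j)" by (rule smFj)
    show "smooth_on (ball 0 R) (H j)" unfolding H_def
      by (intro smooth_intros open_ball smFj smooth_on_subset[OF \<psi>(3) subset_UNIV])
    show "embedded_surface A (S j)" using assms(2)[OF jl(1)[OF j]] by (simp add: symplectic_surface_def)
    show "chart_inv b (z, w) \<in> S j \<longleftrightarrow> w = Ff j z" if "z \<in> ball 0 R" "w \<in> ball 0 \<rho>" for z w
    proof -
      have "z \<in> ball 0 (Rf j)" "w \<in> ball 0 (Rf j)" using that R(2) rho(2)[OF j] by auto
      then show ?thesis using RF[OF j] b(5)[of "(z, w)"] that by simp
    qed
    show "H j z = 0" if "R / 2 \<le> norm z" for z using \<psi>(5)[OF that] by (simp add: H_def)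
    show "norm (Ff j z + t *\<^sub>R H j z) \<le> \<rho> / 2" if z: "z \<in> ball 0 R" and t: "t \<in> {0..1}" for z t
    proof -
      let ?u = "t * \<psi> z"
      have u: "0 \<le> ?u" "?u \<le> 1" using t \<psi>(6,7)[of z] mult_mono[of t 1 "\<psi> z" 1] by auto
      have n: "norm (Ff j z) \<le> \<rho> / 2" "norm (a j * z) \<le> \<rho> / 2" using r3(2)[OF j, of z] z R(3) by auto
      have "Ff j z + t *\<^sub>R H j z = (1 - ?u) *\<^sub>R Ff j z + ?u *\<^sub>R (a j * z)"
        by (simp add: H_def algebra_simps)
      also have "norm \<dots> \<le> (1 - ?u) * norm (Ff j z) + ?u * norm (a j * z)"
        using norm_triangle_ineq[of "(1 - ?u) *\<^sub>R Ff j z" "?u *\<^sub>R (a j * z)"] u by simp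
      also have "\<dots> \<le> (1 - ?u) * (\<rho> / 2) + ?u * (\<rho> / 2)" using n u by (intro add_mono mult_left_mono) auto
      also have "\<dots> = \<rho> / 2" by (simp add: algebra_simps)
      finally show ?thesis .
    qed
  qed (use b(1,2) R(1) rho(1) in auto)
  define S' where "S' j = graph_deformation.\<Phi> b (Ff j) (H j) 1 ` S j" for j
  have S'_iff: "q \<in> S' j \<longleftrightarrow> snd (coord b q) = Ff j (fst (coord b q)) + \<psi> (fst (coord b q)) *\<^sub>R (a j * fst (coord b q) - Ff j (fst (coord b q)))"
    if j: "j \<in> ?J" and q: "q \<in> chart_dom b" for j q
    using graph_deformation.image_iff_in[OF gd[OF j] q, of 1] by (simp add: S'_def graph_deformation.G_def[OF gd[OF j]] H_def)
  have fstb: "norm (fst (coord b q)) < R" if "q \<in> chart_dom b" for q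
    using graph_deformation.coord_in b(2) that by (metis imageI mem_Times_iff mem_ball_0)
  have psi0: "\<psi> 0 = 1" using \<psi>(1,4) by simp
  have pS': "p \<in> S' j" if j: "j \<in> ?J" for j
    using S'_iff[OF j pb] RF[OF j] by (simp add: cbp)
  have only_p: "q = p" if q: "q \<in> chart_dom b" and j: "j \<in> ?J" and qS: "q \<in> S' j" and z: "fst (coord b q) = 0" for q j
  proof -
    have "snd (coord b q) = 0" using S'_iff[OF j q] qS RF[OF j] by (simp add: z)
    then have "coord b q = coord b p" using z by (simp add: cbp prod_eq_iff)
    then show ?thesis using inj_on_coord[OF b(1)] q pb by (simp add: inj_on_def)
  qed
  \<comment> \<open>Over the ball of radius \<open>r\<close> the cut-off function is 1 and the surfaces are complex lines.\<close>
  let ?W' = "ball 0 r \<times> ball 0 \<rho> :: c2 set"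
  have oW': "open ?W'" by (intro open_Times open_ball)
  have W'sub: "?W' \<subseteq> coord b ` chart_dom b" unfolding b(2) using \<psi>(2) R(1) by auto
  obtain d where d: "d \<in> A" "coord d ` chart_dom d = ?W'" "chart_dom d = chart_inv b ` ?W'"
    "\<And>q. q \<in> chart_dom d \<Longrightarrow> coord d q = coord b q" "\<And>x. x \<in> ?W' \<Longrightarrow> chart_inv d x = chart_inv b x"
    "chart_dom d \<subseteq> chart_dom b"
    by (rule restricted_chart[OF b(1) oW' W'sub]) (rule that)
  have pd: "p \<in> chart_dom d"
  proof -
    have "coord b p \<in> ?W'" using \<psi>(1) rho(1) by (simp add: cbp mem_Times_iff)
    then have "chart_inv b (coord b p) \<in> chart_dom d" unfolding d(3) by (rule imageI)
    then show ?thesis using b(1) pb by simp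
  qed
  have S'd: "q \<in> S' j \<longleftrightarrow> snd (coord d q) = a j * fst (coord d q)" if j: "j \<in> ?J" and q: "q \<in> chart_dom d" for j q
  proof -
    have qb: "q \<in> chart_dom b" using q d(6) by blast
    have "coord d q \<in> ?W'" using q d(2) by blast
    then have "\<psi> (fst (coord b q)) = 1" using d(4)[OF q] by (intro \<psi>(4)) (simp add: mem_Times_iff)
    then show ?thesis using S'_iff[OF j qb] d(4)[OF q] by simp
  qed
  have disjoint: "q = p" if i: "i \<in> ?J" and j: "j \<in> ?J" and ne: "i \<noteq> j" and q: "q \<in> chart_dom b" "q \<in> S' i" "q \<in> S' j" for i j q
  proof (rule only_p[OF q(1) i q(2)], rule ccontr)
    let ?z = "fst (coord b q)"
    assume "?z \<noteq> 0"
    then have z: "0 < norm ?z" "norm ?z < r5" using fstb[OF q(1)] R(5) by auto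
    have x: "(i, j) \<in> ?I" using i j ne by simp
    have "Ff i ?z + \<psi> ?z *\<^sub>R ((al i + \<kappa>) * ?z - Ff i ?z) \<noteq> Ff j ?z + \<psi> ?z *\<^sub>R ((al j + \<kappa>) * ?z - Ff j ?z)"
      using r5(2)[THEN bspec, OF x] z \<psi>(6,7)[of ?z] by simp
    then show False using S'_iff[OF i q(1)] S'_iff[OF j q(1)] q(2,3) by (simp add: a_def)
  qed
  show "\<exists>S'. \<exists>b\<in>A. p \<in> chart_dom b \<and> chart_dom b \<subseteq> U \<inter> chart_dom c \<and>
      (\<forall>j\<in>{1..l}. symplectic_surface A \<omega> (S' j)) \<and>
      (\<forall>j\<in>{1..l}. local_deformation A c (chart_dom b) \<epsilon> (S j) (S' j)) \<and>
      (\<forall>j\<in>{1..l}. S 0 \<inter> S' j \<inter> chart_dom b = {p}) \<and>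
      (\<forall>i\<in>{1..l}. \<forall>j\<in>{1..l}. i \<noteq> j \<longrightarrow> S' i \<inter> S' j \<inter> chart_dom b = {p}) \<and>
      (\<exists>d a. darboux_chart A \<omega> d \<and> p \<in> chart_dom d \<and> coord d p = (0, 0) \<and>
         S 0 \<inter> chart_dom d = {q \<in> chart_dom d. fst (coord d q) = 0} \<and>
         (\<forall>j\<in>{1..l}. S' j \<inter> chart_dom d =
            {q \<in> chart_dom d. snd (coord d q) = a j * fst (coord d q)}) \<and>
         (\<forall>j\<in>{1..l}. a j \<noteq> 0) \<and> inj_on a {1..l})"
  proof (intro exI[of _ S'] bexI[OF _ b(1)] exI[of _ d] exI[of _ a] conjI ballI impI)
    show "p \<in> chart_dom b" by (rule pb)
    have bV: "chart_dom b \<subseteq> V" using b(6) d0(3) by blast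
    then show "chart_dom b \<subseteq> U \<inter> chart_dom c" by (auto simp: V_def)
    show "symplectic_surface A \<omega> (S' j)" if j: "j \<in> ?J" for j
      unfolding S'_def
    proof (rule graph_deformation.symplectic_deformed[OF gd[OF j] assms(2)[OF jl(1)[OF j]] formb])
      fix z :: complex
      assume z: "z \<in> ball 0 R"
      have G: "graph_deformation.G (Ff j) (H j) 1 = (\<lambda>z. Ff j z + 1 *\<^sub>R (\<psi> z *\<^sub>R ((al j + \<kappa>) * z - Ff j z)))"
        by (simp add: graph_deformation.G_def[OF gd[OF j]] H_def a_def fun_eq_iff)
      have "norm z < r4" using z R(4) by simp
      then show "0 < std_form (1, frechet_derivative (graph_deformation.G (Ff j) (H j) 1) (at z) 1)
          (\<i>, frechet_derivative (graph_deformation.G (Ff j) (H j) 1) (at z) \<i>)"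
        unfolding G using r4(2)[THEN bspec, OF j, THEN spec, of \<psi>] \<psi>(3,6,7,8) unfolding Let_def by blast
    qed
    show "local_deformation A c (chart_dom b) \<epsilon> (S j) (S' j)" if j: "j \<in> ?J" for j
      unfolding S'_def
    proof (rule graph_deformation.local_deformation_Phi[OF gd[OF j]])
      fix x y assume "x \<in> chart_dom b" "y \<in> chart_dom b"
      then have "dist (coord c p) (coord c x) < \<epsilon> / 2" "dist (coord c p) (coord c y) < \<epsilon> / 2"
        using bV by (auto simp: V_def)
      then show "dist (coord c x) (coord c y) < \<epsilon>" by (metis dist_triangle_half_r)
    qed
    show "S 0 \<inter> S' j \<inter> chart_dom b = {p}" if j: "j \<in> ?J" for j
      using only_p[OF _ j] S0b pS'[OF j] pb assms(3)[OF le0] by blast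
    show "S' i \<inter> S' j \<inter> chart_dom b = {p}" if "i \<in> ?J" "j \<in> ?J" "i \<noteq> j" for i j
      using disjoint[OF that] pS' pb that by blast
    have "\<omega> d q = std_form" if "q \<in> chart_dom d" for q
      using restricted_form[OF b(1) d(1,6,4) that] formb d(6) that by auto
    then show "darboux_chart A \<omega> d" by (rule darboux_chartI[OF d(1)])
    show "p \<in> chart_dom d" by (rule pd)
    show "coord d p = (0, 0)" using d(4)[OF pd] cbp by (simp add: zero_prod_def)
    show "S 0 \<inter> chart_dom d = {q \<in> chart_dom d. fst (coord d q) = 0}" using S0b d(4,6) by auto
    show "S' j \<inter> chart_dom d = {q \<in> chart_dom d. snd (coord d q) = a j * fst (coord d q)}" if "j \<in> ?J" for j
      using S'd[OF that] by blast
    show "a j \<noteq> 0" if "j \<in> ?J" for j by (rule a0[OF that])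
    show "inj_on a ?J" by (rule inja)
  qed
qed

end
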